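(* Let $p,q$ be distinct primes, $b=p^2q$, and let $\mathcal D\subset\mathbb Z^+$ with $\#\mathcal D=b$, $0\in\mathcal D$ and $\gcd(\mathcal D)=1$. Then $\mathcal D$ is a tile digit set (with respect to $b$) if and only if it is a $k$-th order modulo product-form (with respect to $b$) for some $1\le k\le m$, where $m\ge1$ is an integer with $\Phi_{p^{2m}}(x)\mid P_{\mathcal D}(x)$.
   Context: $\mathbb Z^+$ denotes the nonnegative integers. For an integer $b\ge 2$, a set $\mathcal D\subset\mathbb Z^+$ with $\#\mathcal D=b$ is a tile digit set with respect to $b$ if $T(b,\mathcal D)=\{\sum_{k\ge1}b^{-k}d_k:d_k\in\mathcal D\}\subset\mathbb R$ has nonempty interior. $X\oplus Y=\{x+y: x\in X, y\in Y\}$ means all sums are distinct. For finite sets, $X\equiv Y\ (\mathrm{mod}\ n)$ means there is a bijection $X\to Y$ under which corresponding elements are congruent mod $n$; $X\equiv\mathbb Z_b$ means $X\equiv\{0,\dots,b-1\}\ (\mathrm{mod}\ b)$. For finite $\mathcal A\subset\mathbb Z^+$, $P_{\mathcal A}(x)=\sum_{a\in\mathcal A}x^a$. $\Phi_d$ is the $d$-th cyclotomic polynomial. The l.c.m. of the empty set is $1$. All sets below are finite subsets of $\mathbb Z^+$. (For a tile digit set with $b=p^2q$, $0\in\mathcal D$, $\gcd(\mathcal D)=1$ there is exactly one $m\ge1$ with $\Phi_{p^{2m}}\mid P_{\mathcal D}$: the set of prime powers $r^a>1$ with $\Phi_{r^a}\mid P_{\mathcal D}$ is $\{p,p^{2m},q^n\}$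 or $\{q,p^{2m},p^{2n+1}\}$.) First-order forms. Let $\mathcal E=\mathcal E_0\oplus\mathcal E_1\oplus\cdots\oplus\mathcal E_r\equiv\mathbb Z_b$ and $0=l_0\le l_1\le\cdots\le l_r$ be integers. The set $\mathcal E_0\oplus b^{l_1}\mathcal E_1\oplus\cdots\oplus b^{l_r}\mathcal E_r$ is a (first-order) product-form of $\mathcal E$. Let $S_i=\{d>1: d\mid b,\ \Phi_d(x)\mid P_{\mathcal E_i}(x)\}$, $\Psi_i(x)=\prod_{d\in S_i}\Phi_d(x)$, $K_1^{(i)}(x)=\Psi_0(x)\Psi_1(x^{b^{l_1}})\cdots\Psi_i(x^{b^{l_i}})$ and $n_i=\mathrm{l.c.m.}\{s:\Phi_s(x)\mid K_1^{(i)}(x)\}$ for $0\le i\le r$. If $\mathcal D^{(0)}\equiv\mathcal E_0\ (\mathrm{mod}\ n_0)$ and $\mathcal D^{(i)}\equiv\mathcal D^{(i-1)}\oplus b^{l_i}\mathcal E_i\ (\mathrm{mod}\ n_i)$ for $1\le i\le r$, then $\mathcal D=\mathcal D^{(r)}$ is called a (first-order) modulo product-form with respect to $\mathcal E$; its associated polynomial is $K_{\mathcal D}=K_1^{(r)}$. Higher-order forms. Let $k\ge2$ and let $\mathcal G$ be a $(k-1)$-th order modulo product-form with associated polynomial $K_{\mathcal G}$. Let $\mathcal G=\mathcal G_0\oplus\cdots\oplus\mathcal G_\ell$ be any decomposition (possibly different from the one that generated $\mathcal G$) and $0=r_0\le r_1\le\cdots\le r_\ell$. The set $\mathcal G_0\oplus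 b^{r_1}\mathcal G_1\oplus\cdots\oplus b^{r_\ell}\mathcal G_\ell$ is a $k$-th order product-form. Let $S_i^{(k)}=\{s:\Phi_s(x)\mid P_{\mathcal G_i}(x),\ \Phi_s(x)\mid K_{\mathcal G}(x)\}$, $K_k^{(i)}(x)=\prod_{j=0}^i\prod_{s\in S_j^{(k)}}\Phi_s(x^{b^{r_j}})$ and $n_i=\mathrm{l.c.m.}\{s:\Phi_s(x)\mid K_k^{(i)}(x)\}$. If $\mathcal D^{(0)}\equiv\mathcal G_0\ (\mathrm{mod}\ n_0)$ and $\mathcal D^{(i)}\equiv\mathcal D^{(i-1)}\oplus b^{r_i}\mathcal G_i\ (\mathrm{mod}\ n_i)$ for $1\le i\le\ell$, then $\mathcal D=\mathcal D^{(\ell)}$ is a $k$-th order modulo product-form, with associated polynomial $K_{\mathcal D}=K_k^{(\ell)}$. *)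

theory Defs
  imports
    "HOL-Analysis.Analysis"
    "HOL-Computational_Algebra.Polynomial"
    "HOL-Computational_Algebra.Primes"
    "HOL-Number_Theory.Cong"
begin

definition self_affine_tile :: "nat \<Rightarrow> nat set \<Rightarrow> real set" where
  "self_affine_tile b D =
     {(\<Sum>k. real (d k) / real b ^ Suc k) | d :: nat \<Rightarrow> nat. \<forall>k. d k \<in> D}"

definition tile_digit_set :: "nat \<Rightarrow> nat set \<Rightarrow> bool" where
  "tile_digit_set b D \<longleftrightarrow>
     b \<ge> 2 \<and> finite D \<and> card D = b \<and> interior (self_affine_tile b D) \<noteq> {}"

(* Polynomials are taken over the complex numbers, where the cyclotomic polynomial is the product
   over the primitive n-th roots of unity.  It is monic with integer coefficients, so divisibility
   of an integer polynomial by it means the same over the integers and over the complex numbers.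
   The value at n = 0 is the empty product 1, hence the explicit positivity conditions on indices
   below. *)
definition cyclotomic :: "nat \<Rightarrow> complex poly" where
  "cyclotomic n =
     (\<Prod>k | k \<in> {1..n} \<and> coprime k n. [:- cis (2 * pi * real k / real n), 1:])"

definition set_poly :: "nat set \<Rightarrow> complex poly" where
  "set_poly A = (\<Sum>a\<in>A. monom 1 a)"

definition set_cong :: "nat \<Rightarrow> nat set \<Rightarrow> nat set \<Rightarrow> bool" where
  "set_cong n X Y \<longleftrightarrow> (\<exists>f. bij_betw f X Y \<and> (\<forall>x\<in>X. [x = f x] (mod n)))"

(* Z is the direct sum of X 0, ..., X r: every element of Z is e 0 + ... + e r for exactly one
   choice of summands. *)
definition is_direct_sum :: "nat set \<Rightarrow> nat \<Rightarrow> (nat \<Rightarrow> nat set) \<Rightarrow> bool" where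
  "is_direct_sum Z r X \<longleftrightarrow> bij_betw (\<lambda>e. \<Sum>i\<le>r. e i) (PiE {..r} X) Z"

(* The congruence of W with the direct sum of X and Y; distinctness of the sums is part of it. *)
definition cong_direct_sum :: "nat \<Rightarrow> nat set \<Rightarrow> nat set \<Rightarrow> nat set \<Rightarrow> bool" where
  "cong_direct_sum n W X Y \<longleftrightarrow>
     (\<exists>Z. bij_betw (\<lambda>(x, y). x + y) (X \<times> Y) Z \<and> set_cong n W Z)"

definition kernel_poly ::
    "nat \<Rightarrow> (nat \<Rightarrow> nat) \<Rightarrow> (nat \<Rightarrow> nat set) \<Rightarrow> nat \<Rightarrow> complex poly" where
  "kernel_poly b l S i =
     (\<Prod>j\<le>i. \<Prod>s\<in>S j. pcompose (cyclotomic s) (monom 1 (b ^ l j)))"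

definition kernel_modulus :: "complex poly \<Rightarrow> nat" where
  "kernel_modulus K = Lcm {s. s \<ge> 1 \<and> cyclotomic s dvd K}"

(* The construction of D 0, ..., D r from the factors X 0, ..., X r with exponents l, common to all
   orders; the orders differ only in the index sets S. *)
definition modulo_chain ::
    "nat \<Rightarrow> nat \<Rightarrow> (nat \<Rightarrow> nat set) \<Rightarrow> (nat \<Rightarrow> nat) \<Rightarrow> (nat \<Rightarrow> nat set) \<Rightarrow> (nat \<Rightarrow> nat set) \<Rightarrow> bool" where
  "modulo_chain b r X l S D \<longleftrightarrow>
     l 0 = 0 \<and> (\<forall>i<r. l i \<le> l (Suc i)) \<and>
     set_cong (kernel_modulus (kernel_poly b l S 0)) (D 0) (X 0) \<and>
     (\<forall>i<r. cong_direct_sum (kernel_modulus (kernel_poly b l S (Suc i)))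
               (D (Suc i)) (D i) ((\<lambda>x. b ^ l (Suc i) * x) ` X (Suc i)))"

(* The associated polynomial depends on how the set was generated, not on the set alone; it is
   therefore carried along as the last argument. *)
inductive modulo_product_form_assoc ::
    "nat \<Rightarrow> nat \<Rightarrow> nat set \<Rightarrow> complex poly \<Rightarrow> bool" for b :: nat where
  first_order:
    "\<lbrakk> set_cong b E {0..<b}; is_direct_sum E r F;
       S = (\<lambda>i. {d. d > 1 \<and> d dvd b \<and> cyclotomic d dvd set_poly (F i)});
       modulo_chain b r F l S D \<rbrakk>
     \<Longrightarrow> modulo_product_form_assoc b 1 (D r) (kernel_poly b l S r)"
| higher_order:
    "\<lbrakk> modulo_product_form_assoc b k G K; is_direct_sum G r F;
       S = (\<lambda>i. {s. s \<ge> 1 \<and> cyclotomic s dvd set_poly (F i) \<and> cyclotomic s dvd K});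
       modulo_chain b r F l S D \<rbrakk>
     \<Longrightarrow> modulo_product_form_assoc b (Suc k) (D r) (kernel_poly b l S r)"

definition modulo_product_form :: "nat \<Rightarrow> nat \<Rightarrow> nat set \<Rightarrow> bool" where
  "modulo_product_form b k D \<longleftrightarrow> (\<exists>K. modulo_product_form_assoc b k D K)"

end

theory Submission
  imports Defs
begin

text \<open>
  Write \<open>D\<close> \<^emph>\<open>vanishes\<close> at \<open>s\<close> if \<open>\<Phi>\<^sub>s\<close> divides \<open>P\<^sub>D\<close>.  A tile digit set has distinct finite expansions,
  so by Kenyon's criterion each \<open>m > 0\<close> admits some \<open>k\<close> such that \<open>P\<^sub>D\<close> vanishes at \<open>e(m / b\<^sup>k)\<close>; in
  the grid of exponents \<open>(i, j)\<close> of \<open>p\<^sup>iq\<^sup>j\<close> this puts a zero on each line of slope \<open>(2, 1)\<close>.  Moreover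
  \<open>D\<close> tiles the integers periodically.  By Tijdeman's theorem the period may be taken to be
  \<open>p\<^sup>aq\<^sup>c\<close> and, as \<open>gcd(D) = 1\<close>, \<open>D\<close> is equidistributed modulo \<open>p\<close> or modulo \<open>q\<close>.  For two primes,
  vanishing at \<open>p\<^sup>iq\<^sup>j\<close> makes \<open>D\<close> modulo \<open>p\<^sup>iq\<^sup>j\<close> a union of cycles of length \<open>p\<close> and of
  length \<open>q\<close>, and because \<open>D\<close> has only \<open>p\<^sup>2q\<close> elements the two kinds cannot mix.  Hence the zeros fill
  a segment of a column and a
  segment of a row of the grid.  Such a segment says that \<open>D\<close> is, modulo \<open>p\<^sup>iq\<^sup>j\<close>, the direct sum of
  a smaller set and an arithmetic progression.  Peeling off the progressions shows that \<open>D\<close> is a modulo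
  product-form built on a mixed radix set; that set is \<open>{0..<b}\<close> or
  \<open>{0..<p} \<oplus> p\<^bsup>2t+1\<^esup>{0..<p} \<oplus> p\<^bsup>2t+2\<^esup>{0..<q}\<close>, which has order \<open>t\<close> by induction.

  Conversely, the zeros of the associated polynomial are zeros of \<open>P\<^sub>D\<close>, and each construction step shifts
  the zeros at \<open>e(m / b\<^sup>k)\<close> to larger \<open>k\<close> without losing any \<open>m\<close>.  If these \<open>k\<close> are bounded, the
  digit expansions are equidistributed and the attractor has interior.
\<close>

section \<open>Roots of unity and residue counts of finite sets\<close>

subsection \<open>Primitive roots of unity\<close>

text \<open>For m = p^\<alpha> q^\<beta> a zero at e(m / b^k) sits at the grid point (2k - \<alpha>,
  k - \<beta>), clipped at the axes, so \<alpha> and \<beta> translate the diagonal and each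
  translate must meet the set of zeros. On the axes only three zeros occur: p to one odd exponent, p
  to one even exponent 2m, and q to one exponent n. If \<open>D\<close> is equidistributed modulo q,
  both columns turn out long enough for order 1. If it is equidistributed modulo p, column 2m may
  have its first gap at height m - t with 0 <= t < m. The line through this gap can then be met only
  in row n, which forces the row to reach column 2(n + t). Shifting the progressions of {0..<b}
  yields row n at most up to column 2n. The surplus is absorbed by a mixed radix set whose row 1
  already reaches column 2t + 2; for t > 0 it has order t, so \<open>D\<close> has order t + 1, and
  t < m is the bound k <= m.\<close>

definition prim_root :: "nat \<Rightarrow> complex \<Rightarrow> bool" where
  "prim_root n z \<longleftrightarrow> 0 < n \<and> (\<forall>k. z ^ k = 1 \<longleftrightarrow> n dvd k)"

definition rou :: "nat \<Rightarrow> nat \<Rightarrow> complex" where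
  "rou m n = cis (2 * pi * real m / real n)"

lemma rou_power: "rou m n ^ k = rou (m * k) n"
  unfolding rou_def Complex.DeMoivre by (rule arg_cong[of _ _ cis]) simp

lemma cis_multiple_eq_1_iff:
  assumes "n > 0"
  shows "cis (2 * pi * real k / real n) = 1 \<longleftrightarrow> n dvd k"
proof
  assume "n dvd k"
  then obtain c where k: "k = n * c" by blast
  have "2 * pi * real k / real n = 2 * pi * real c"
    using assms by (simp add: k)
  then show "cis (2 * pi * real k / real n) = 1"
    by (simp add: cis_multiple_2pi)
next
  assume "cis (2 * pi * real k / real n) = 1"
  then have "cos (2 * pi * real k / real n) = 1"
    by (simp add: complex_eq_iff)
  then obtain x :: int where "2 * pi * real k / real n = of_int x * 2 * pi"
    by (auto simp: cos_one_2pi_int)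
  then have "real k = of_int x * real n"
    using assms by (simp add: field_simps)
  then have "int k = x * int n"
    by (metis of_int_eq_iff of_int_mult of_int_of_nat_eq)
  then show "n dvd k"
    by (metis dvd_triv_right int_dvd_int_iff)
qed

lemma rou_eq_1_iff: "n > 0 \<Longrightarrow> rou k n = 1 \<longleftrightarrow> n dvd k"
  by (simp add: rou_def cis_multiple_eq_1_iff)

lemma rou_cancel: "c > 0 \<Longrightarrow> rou (m * c) (n * c) = rou m n"
  unfolding rou_def by (rule arg_cong[of _ _ cis]) simp

lemma rou_eq_iff:
  assumes "n > 0"
  shows "rou k n = rou l n \<longleftrightarrow> [k = l] (mod n)"
proof (induction k l rule: linorder_wlog)
  case (le k l)
  have "rou l n = rou k n * rou (l - k) n"
    using le assms by (simp add: rou_def cis_mult field_simps of_nat_diff)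
  then have "rou k n = rou l n \<longleftrightarrow> rou (l - k) n = 1"
    by (auto simp: rou_def)
  also have "\<dots> \<longleftrightarrow> [l = k] (mod n)"
    using le assms by (simp add: rou_eq_1_iff cong_altdef_nat)
  finally show ?case by (simp add: cong_sym_eq)
next
  case (sym k l)
  then show ?case by (metis cong_sym)
qed

lemma rou_nonzero [simp]: "rou m n \<noteq> 0"
  by (simp add: rou_def)

lemma prim_root_rou_coprime:
  assumes "n > 0" "coprime m n"
  shows "prim_root n (rou m n)"
  using assms
  by (auto simp: prim_root_def rou_power rou_eq_1_iff coprime_dvd_mult_right_iff coprime_commute)

lemma prim_root_rou:
  assumes "n > 0"
  shows "prim_root (n div gcd m n) (rou m n)"
proof -
  let ?g = "gcd m n"
  have g: "?g > 0" using assms by simp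
  have "rou m n = rou ((m div ?g) * ?g) ((n div ?g) * ?g)" by simp
  also have "\<dots> = rou (m div ?g) (n div ?g)" by (rule rou_cancel[OF g])
  finally show ?thesis
    using assms g prim_root_rou_coprime[of "n div ?g" "m div ?g"]
    by (metis div_gcd_coprime div_greater_zero_iff gcd_le2_nat less_not_refl not_gr_zero dvd_div_eq_0_iff gcd_dvd2)
qed

lemma prim_root_pos: "prim_root n z \<Longrightarrow> 0 < n"
  by (simp add: prim_root_def)

lemma prim_root_power_eq_1: "prim_root n z \<Longrightarrow> z ^ k = 1 \<longleftrightarrow> n dvd k"
  by (simp add: prim_root_def)

lemma prim_root_unique: "prim_root n z \<Longrightarrow> prim_root m z \<Longrightarrow> n = m"
  by (metis dvd_antisym dvd_refl prim_root_def)

lemma root_of_unity_rou: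
  assumes "z ^ n = 1" "n > 0"
  shows "\<exists>k<n. z = rou k n"
proof -
  have "z \<in> {z. z ^ n = 1}" using assms by simp
  then obtain k where "k < n" "z = cis (2 * pi * real k / real n)"
    using Complex.bij_betw_roots_unity[OF assms(2)] unfolding bij_betw_def by auto
  then show ?thesis by (auto simp: rou_def)
qed

lemma prim_root_exists: "z ^ n = 1 \<Longrightarrow> n > 0 \<Longrightarrow> \<exists>s. prim_root s z \<and> s dvd n"
proof -
  assume *: "z ^ n = 1" "n > 0"
  then obtain k where "z = rou k n" using root_of_unity_rou by blast
  then have "prim_root (n div gcd k n) z" using * prim_root_rou by blast
  then show ?thesis using * prim_root_def by blast
qed

lemma prim_root_imp_rou:
  assumes "prim_root n z"
  shows "\<exists>k\<in>{1..n}. coprime k n \<and> z = rou k n"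
proof -
  have n: "n > 0" and "z ^ n = 1" using assms by (auto simp: prim_root_def)
  then obtain k where k: "k < n" "z = rou k n" using root_of_unity_rou by blast
  have "n div gcd k n = n"
    using prim_root_unique[OF assms] prim_root_rou[OF n, of k] unfolding k(2) by metis
  then have c: "coprime k n"
    using n by (simp add: coprime_iff_gcd_eq_1 dvd_imp_le div_eq_dividend_iff)
  show ?thesis
  proof (cases "k = 0")
    case True
    then have "n = 1" using c by simp
    then show ?thesis using k True by (auto simp: rou_def complex_eq_iff)
  next
    case False
    then show ?thesis using k c by auto
  qed
qed

lemma prim_root_rou_1: "n > 0 \<Longrightarrow> prim_root n (rou 1 n)"
  by (rule prim_root_rou_coprime) auto

lemma prim_root_power_coprime:
  assumes "prim_root n z" "prim_root n w"
  shows "\<exists>u>0. coprime u n \<and> w = z ^ u"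
proof -
  obtain k where k: "coprime k n" "z = rou k n" using prim_root_imp_rou[OF assms(1)] by blast
  obtain l where l: "l \<in> {1..n}" "coprime l n" "w = rou l n" using prim_root_imp_rou[OF assms(2)] by blast
  have n: "n > 0" using assms prim_root_pos by blast
  obtain k' where k': "[k * k' = 1] (mod n)" using k(1) cong_solve_coprime_nat by auto
  \<comment> \<open>Adding \<open>n\<close> does not change the residue but keeps the exponent
    positive, even for \<open>n = 1\<close>; \<open>coprime_large_residue\<close> asks for a
    positive residue.\<close>
  define u where "u = k' * l + n"
  have cop: "coprime k' n" using k'
    by (metis cong_imp_coprime coprime_1_left coprime_mult_left_iff cong_sym)
  have "coprime (k' * l + n) n" using cop l(2) by (metis coprime_mult_left_iff coprime_add_one_left
        gcd_add1 coprime_iff_gcd_eq_1)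
  moreover have "[k * u = l] (mod n)"
  proof -
    have "[k * u = (k * k') * l] (mod n)" unfolding u_def
      by (simp add: algebra_simps cong_def)
    also have "[(k * k') * l = 1 * l] (mod n)" using k' by (rule cong_scalar_right)
    finally show ?thesis by simp
  qed
  then have "rou (k * u) n = rou l n"
    using n by (simp add: rou_eq_iff)
  ultimately show ?thesis using n k l unfolding u_def[symmetric] by (metis rou_power add_gr_0 u_def)
qed

lemma prim_root_power:
  assumes "prim_root n z" "k > 0"
  shows "prim_root (n div gcd n k) (z ^ k)"
proof -
  have n: "n > 0" using assms prim_root_pos by blast
  have "(z ^ k) ^ j = 1 \<longleftrightarrow> n div gcd n k dvd j" for j
  proof -
    have "(z ^ k) ^ j = 1 \<longleftrightarrow> n dvd k * j"
      using assms(1) by (simp add: prim_root_def flip: power_mult)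
    also have "\<dots> \<longleftrightarrow> n div gcd n k dvd j"
    proof -
      define g where "g = gcd n k"
      have g: "g > 0" using n by (simp add: g_def)
      have e: "n = g * (n div g)" "k = g * (k div g)" by (simp_all add: g_def)
      have c: "coprime (n div g) (k div g)"
        unfolding g_def using n by (intro div_gcd_coprime) simp
      have "n dvd k * j \<longleftrightarrow> g * (n div g) dvd g * ((k div g) * j)"
        using e by (metis mult.assoc)
      also have "\<dots> \<longleftrightarrow> n div g dvd (k div g) * j" using g by simp
      also have "\<dots> \<longleftrightarrow> n div g dvd j" using c by (simp add: coprime_dvd_mult_right_iff)
      finally show ?thesis by (simp add: g_def)
    qed
    finally show ?thesis .
  qed
  moreover have "n div gcd n k > 0" using n by (simp add: div_greater_zero_iff dvd_imp_le)
  ultimately show ?thesis by (simp add: prim_root_def)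
qed

subsection \<open>Cyclotomic divisibility and vanishing exponential sums\<close>

definition esum :: "nat set \<Rightarrow> complex \<Rightarrow> complex" where
  "esum A z = (\<Sum>a\<in>A. z ^ a)"

text \<open>Divisibility by the cyclotomic polynomial (\<open>cyclotomic_dvd_set_poly_iff\<close>),
  put in terms of roots because the arguments are about character sums. It holds vacuously for
  \<open>s = 0\<close>.\<close>

definition vanishes :: "nat set \<Rightarrow> nat \<Rightarrow> bool" where
  "vanishes A s \<longleftrightarrow> (\<forall>z. prim_root s z \<longrightarrow> esum A z = 0)"

lemma poly_set_poly: "poly (set_poly A) z = esum A z"
  by (simp add: set_poly_def esum_def poly_sum poly_monom)

lemma inj_on_rou: "n > 0 \<Longrightarrow> inj_on (\<lambda>k. rou k n) {1..n}"
proof (rule inj_onI)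
  fix k l assume *: "n > 0" "k \<in> {1..n}" "l \<in> {1..n}" "rou k n = rou l n"
  then have "[k = l] (mod n)" by (simp add: rou_eq_iff)
  then have "[k - 1 = l - 1] (mod n)"
    using * by (metis One_nat_def atLeastAtMost_iff cong_add_rcancel_nat le_add_diff_inverse2)
  then have "k - 1 = l - 1" using * by (intro cong_less_modulus_unique_nat[of "k-1" "l-1" n]) auto
  then show "k = l" using * by auto
qed

lemma poly_cyclotomic_eq_0_iff:
  assumes "n > 0"
  shows "poly (cyclotomic n) z = 0 \<longleftrightarrow> prim_root n z"
proof -
  have "poly (cyclotomic n) z = 0 \<longleftrightarrow> (\<exists>k\<in>{1..n}. coprime k n \<and> z = rou k n)"
    by (auto simp: cyclotomic_def poly_prod rou_def)
  also have "\<dots> \<longleftrightarrow> prim_root n z"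
    using prim_root_imp_rou prim_root_rou_coprime[OF assms] by blast
  finally show ?thesis .
qed

lemma prod_linear_dvd:
  fixes P :: "complex poly"
  assumes "finite I" "inj_on f I" "\<And>i. i \<in> I \<Longrightarrow> poly P (f i) = 0"
  shows "(\<Prod>i\<in>I. [:- f i, 1:]) dvd P"
  using assms
proof (induction I arbitrary: P rule: finite_induct)
  case (insert x I)
  have "[:- f x, 1:] dvd P" using insert.prems by (simp add: poly_eq_0_iff_dvd)
  then obtain Q where Q: "P = [:- f x, 1:] * Q" by blast
  have "poly Q (f i) = 0" if "i \<in> I" for i
  proof -
    have "f i \<noteq> f x" using that insert by (auto simp: inj_on_def)
    moreover have "poly P (f i) = 0" using insert.prems that by auto
    ultimately show ?thesis by (simp add: Q)
  qed
  then have "(\<Prod>i\<in>I. [:- f i, 1:]) dvd Q"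
    using insert by (intro insert.IH) auto
  then have "[:- f x, 1:] * (\<Prod>i\<in>I. [:- f i, 1:]) dvd P"
    unfolding Q by (rule mult_dvd_mono[OF dvd_refl])
  then show ?case using insert.hyps by (simp only: prod.insert not_False_eq_True)
qed simp

lemma cyclotomic_dvd_iff:
  assumes "n > 0"
  shows "cyclotomic n dvd P \<longleftrightarrow> (\<forall>z. prim_root n z \<longrightarrow> poly P z = 0)"
proof
  assume "cyclotomic n dvd P"
  then show "\<forall>z. prim_root n z \<longrightarrow> poly P z = 0"
    using poly_cyclotomic_eq_0_iff[OF assms] by (metis dvd_trans poly_eq_0_iff_dvd)
next
  assume *: "\<forall>z. prim_root n z \<longrightarrow> poly P z = 0"
  show "cyclotomic n dvd P"
    unfolding cyclotomic_def rou_def [symmetric]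
    by (rule prod_linear_dvd)
      (use * prim_root_rou_coprime[OF assms] inj_on_rou[OF assms] in \<open>auto intro: inj_on_subset\<close>)
qed

lemma cyclotomic_dvd_set_poly_iff:
  "n > 0 \<Longrightarrow> cyclotomic n dvd set_poly A \<longleftrightarrow> vanishes A n"
  by (simp add: cyclotomic_dvd_iff vanishes_def poly_set_poly)

subsection \<open>Galois conjugation of roots of unity\<close>

definition ieval :: "int poly \<Rightarrow> complex \<Rightarrow> complex" where
  "ieval f z = poly (map_poly of_int f) z"

lemma ieval_0 [simp]: "ieval 0 z = 0"
  by (simp add: ieval_def)

lemma ieval_pCons [simp]: "ieval (pCons a f) z = of_int a + z * ieval f z"
  by (cases "a = 0 \<and> f = 0") (auto simp: ieval_def map_poly_pCons)

lemma ieval_add [simp]: "ieval (f + g) z = ieval f z + ieval g z"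
  by (induction f g rule: poly_induct2) (auto simp: algebra_simps)

lemma ieval_smult [simp]: "ieval (smult c f) z = of_int c * ieval f z"
  by (induction f) (auto simp: algebra_simps)

lemma ieval_minus [simp]: "ieval (- f) z = - ieval f z"
  using ieval_smult[of "-1" f z] by simp

lemma ieval_diff [simp]: "ieval (f - g) z = ieval f z - ieval g z"
  using ieval_add[of f "- g" z] by simp

lemma ieval_mult [simp]: "ieval (f * g) z = ieval f z * ieval g z"
  by (induction f) (auto simp: algebra_simps)

lemma ieval_1 [simp]: "ieval 1 z = 1"
  by (simp add: one_pCons)

lemma ieval_power [simp]: "ieval (f ^ n) z = ieval f z ^ n"
  by (induction n) auto

lemma ieval_pcompose [simp]: "ieval (pcompose f g) z = ieval f (ieval g z)"
  by (induction f) (auto simp: pcompose_pCons)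

lemma ieval_monom [simp]: "ieval (monom c n) z = of_int c * z ^ n"
  by (induction n) (auto simp: monom_Suc monom_0)

lemma ieval_sum [simp]: "ieval (sum f A) z = (\<Sum>a\<in>A. ieval (f a) z)"
  by (induction A rule: infinite_finite_induct) auto

lemma frobenius_binomial:
  fixes x y :: "'a :: comm_ring_1"
  assumes "prime p"
  shows "\<exists>c. (x + y) ^ p = x ^ p + y ^ p + of_nat p * c"
proof -
  have p: "p > 1" using assms prime_gt_1_nat by blast
  have "(x + y) ^ p = (\<Sum>k\<le>p. of_nat (p choose k) * x ^ k * y ^ (p - k))"
    by (rule binomial_ring)
  also have "{..p} = insert 0 (insert p {0<..<p})" using p by auto
  also have "(\<Sum>k\<in>insert 0 (insert p {0<..<p}). of_nat (p choose k) * x ^ k * y ^ (p - k)) =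
      x ^ p + y ^ p + (\<Sum>k\<in>{0<..<p}. of_nat (p choose k) * x ^ k * y ^ (p - k))"
    using p by simp
  also have "(\<Sum>k\<in>{0<..<p}. of_nat (p choose k) * x ^ k * y ^ (p - k)) =
      of_nat p * (\<Sum>k\<in>{0<..<p}. of_nat ((p choose k) div p) * x ^ k * y ^ (p - k))"
    unfolding sum_distrib_left
  proof (rule sum.cong)
    fix k assume k: "k \<in> {0<..<p}"
    then have "p dvd p choose k" using assms by (intro dvd_choose_prime) auto
    then have "of_nat (p choose k) = of_nat p * (of_nat ((p choose k) div p) :: 'a)"
      by (metis dvd_mult_div_cancel of_nat_mult)
    then show "of_nat (p choose k) * x ^ k * y ^ (p - k) =
        of_nat p * (of_nat ((p choose k) div p) * x ^ k * y ^ (p - k))"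
      by (simp add: mult.assoc)
  qed simp
  finally show ?thesis by blast
qed

lemma fermat_int:
  assumes "prime p"
  shows "int p dvd a ^ p - a"
proof (induction a rule: int_induct[where k = 0])
  case base
  then show ?case using prime_gt_0_nat[OF assms] by (simp add: zero_power)
next
  case (step1 i)
  obtain c where "(i + 1) ^ p = i ^ p + 1 ^ p + int p * c"
    using frobenius_binomial[OF assms, of i 1] by auto
  then have "(i + 1) ^ p - (i + 1) = (i ^ p - i) + int p * c" by simp
  then show ?case using step1 by (metis dvd_add dvd_triv_left)
next
  case (step2 i)
  obtain c where "((i - 1) + 1) ^ p = (i - 1) ^ p + 1 ^ p + int p * c"
    using frobenius_binomial[OF assms, of "i - 1" 1] by auto
  then have "(i - 1) ^ p - (i - 1) = (i ^ p - i) - int p * c" by simp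
  then show ?case using step2 by (metis dvd_diff dvd_triv_left)
qed

text \<open>This congruence serves twice: for the conjugation of roots of unity and for Tijdeman's
  multiplication of a tile by a prime.\<close>

lemma frobenius_int_poly:
  fixes f :: "int poly"
  assumes "prime p"
  shows "\<exists>g. f ^ p = pcompose f (monom 1 p) + of_nat p * g"
proof (induction f)
  case 0
  then show ?case using prime_gt_0_nat[OF assms] by (intro exI[of _ 0]) (auto simp: power_0_left)
next
  case (pCons a f)
  then obtain g where g: "f ^ p = pcompose f (monom 1 p) + of_nat p * g" by blast
  obtain c where c: "([:a:] + monom 1 1 * f) ^ p = [:a:] ^ p + (monom 1 1 * f) ^ p + of_nat p * c"
    using frobenius_binomial[OF assms] by blast
  have "int p dvd a ^ p - a" by (rule fermat_int[OF assms])
  then obtain e where e: "a ^ p = a + int p * e" by (metis add.commute diff_add_cancel dvdE)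
  have "[:a:] ^ p = [:a:] + of_nat p * [:e:]"
    by (simp add: e poly_const_pow of_nat_poly)
  moreover have "(monom 1 1 * f) ^ p = monom 1 p * pcompose f (monom 1 p) + of_nat p * (monom 1 p * g)"
    by (simp add: power_mult_distrib monom_power g algebra_simps)
  moreover have "pCons a f = [:a:] + monom 1 1 * f" by (simp add: monom_Suc monom_0)
  moreover have "pcompose (pCons a f) (monom 1 p) = [:a:] + monom 1 p * pcompose f (monom 1 p)"
    by (simp add: pcompose_pCons)
  ultimately have "pCons a f ^ p = pcompose (pCons a f) (monom 1 p) + of_nat p * ([:e:] + monom 1 p * g + c)"
    using c by (simp only: distrib_left add_ac)
  then show ?case by blast
qed

text \<open>
  Landau's argument: modulo a fixed denominator, the values \<open>f (z ^ k)\<close> have bounded integral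
  coordinates, while \<open>f (w ^ p) - f w ^ p\<close> has coordinates divisible by \<open>p\<close>.  Hence
  \<open>f w = 0\<close> implies \<open>f (w ^ p) = 0\<close> for all large primes \<open>p\<close>, and every residue coprime to the
  order of \<open>z\<close> contains a product of large primes.
\<close>

lemma root_power_mod:
  fixes z :: "'a :: monoid_mult"
  assumes "z ^ n = 1"
  shows "z ^ k = z ^ (k mod n)"
proof -
  have "z ^ k = z ^ (k mod n + n * (k div n))" by simp
  also have "\<dots> = z ^ (k mod n)" using assms by (simp only: power_add power_mult power_one mult_1_right)
  finally show ?thesis .
qed

text \<open>Coordinates come from division by an integer polynomial \<open>h\<close> of least degree
  with root \<open>z\<close>, which gives uniqueness. As \<open>h\<close> is not known to be monic,
  each new power of \<open>z\<close> costs one factor of its leading coefficient; the powers repeat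
  after \<open>n\<close> steps, so the n-th power of that coefficient is a common
  denominator.\<close>

lemma integral_coordinates:
  assumes "z ^ n = 1" "n > 0"
  obtains c :: int and d where "c \<noteq> 0"
    and "\<And>R. \<exists>r. (r = 0 \<or> degree r < d) \<and> of_int c * ieval R z = ieval r z"
    and "\<And>r. r = 0 \<or> degree r < d \<Longrightarrow> ieval r z = 0 \<Longrightarrow> r = 0"
proof -
  define P where "P = (\<lambda>h. h \<noteq> 0 \<and> ieval h z = 0)"
  have "ieval (monom 1 n - 1) z = 0" using assms by simp
  moreover have "monom 1 n - 1 \<noteq> (0 :: int poly)"
    using assms by (auto simp: monom_eq_1_iff)
  ultimately have "P (monom 1 n - 1)" by (simp add: P_def)
  then obtain h where h: "P h" "\<And>g. P g \<Longrightarrow> degree h \<le> degree g"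
    by (metis ex_has_least_nat)
  define d where "d = degree h"
  define c where "c = lead_coeff h"
  have uniq: "r = 0" if "r = 0 \<or> degree r < d" "ieval r z = 0" for r
  proof (rule ccontr)
    assume "r \<noteq> 0"
    then have "degree h \<le> degree r" using that h(2)[of r] by (simp add: P_def)
    then show False using that \<open>r \<noteq> 0\<close> by (simp add: d_def)
  qed
  have c: "c \<noteq> 0" using h(1) by (auto simp: c_def P_def)
  have "d > 0"
  proof (rule ccontr)
    assume "\<not> d > 0"
    then obtain a where "h = [:a:]" unfolding d_def by (metis degree_eq_zeroE gr0I)
    then show False using h(1) by (auto simp: P_def)
  qed
  have step: "\<exists>s. (s = 0 \<or> degree s < d) \<and> of_int c * ieval r z = ieval s z"
    if "degree r \<le> d" for r
  proof -
    define s where "s = smult c r - smult (coeff r d) h"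
    have "degree s \<le> d" unfolding s_def
      using that by (intro degree_diff_le) (auto simp: d_def intro: order_trans[OF degree_smult_le])
    moreover have "coeff s d = 0" by (simp add: s_def c_def d_def)
    ultimately have "s = 0 \<or> degree s < d"
      using eq_zero_or_degree_less by blast
    moreover have "of_int c * ieval r z = ieval s z"
      using h(1) by (simp add: s_def P_def)
    ultimately show ?thesis by blast
  qed
  have pow: "\<exists>r. (r = 0 \<or> degree r < d) \<and> of_int (c ^ i) * z ^ i = ieval r z" for i
  proof (induction i)
    case 0
    then show ?case using \<open>d > 0\<close> by (intro exI[of _ 1]) auto
  next
    case (Suc i)
    then obtain r where r: "r = 0 \<or> degree r < d" "of_int (c ^ i) * z ^ i = ieval r z" by blast
    have "degree (pCons 0 r) \<le> d" using r(1) by auto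
    from step[OF this] obtain s where
      s: "s = 0 \<or> degree s < d" "of_int c * ieval (pCons 0 r) z = ieval s z" by blast
    have "of_int (c ^ Suc i) * z ^ Suc i = of_int c * (z * (of_int (c ^ i) * z ^ i))"
      by simp
    also have "\<dots> = ieval s z" using s(2) r(2) by simp
    finally show ?case using s(1) by blast
  qed
  have smult_ok: "smult a r = 0 \<or> degree (smult a r) < d" if "r = 0 \<or> degree r < d" for a and r :: "int poly"
    using that by auto
  have pown: "\<exists>r. (r = 0 \<or> degree r < d) \<and> of_int (c ^ n) * z ^ i = ieval r z" for i
  proof -
    have z: "z ^ i = z ^ (i mod n)" using assms(1) by (rule root_power_mod)
    obtain r where r: "r = 0 \<or> degree r < d" "of_int (c ^ (i mod n)) * z ^ (i mod n) = ieval r z"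
      using pow by blast
    have "i mod n \<le> n" using assms by (simp add: less_imp_le)
    then have "c ^ n = c ^ (n - i mod n) * c ^ (i mod n)" by (simp flip: power_add)
    then have "of_int (c ^ n) * z ^ i = ieval (smult (c ^ (n - i mod n)) r) z"
      using r(2) by (simp add: z mult.assoc)
    then show ?thesis using smult_ok[OF r(1)] by blast
  qed
  have all: "\<exists>r. (r = 0 \<or> degree r < d) \<and> of_int (c ^ n) * (z ^ i * ieval R z) = ieval r z" for R i
  proof (induction R arbitrary: i)
    case 0
    then show ?case by (intro exI[of _ 0]) auto
  next
    case (pCons a R)
    obtain r where r: "r = 0 \<or> degree r < d" "of_int (c ^ n) * (z ^ Suc i * ieval R z) = ieval r z"
      using pCons by blast
    obtain s where s: "s = 0 \<or> degree s < d" "of_int (c ^ n) * z ^ i = ieval s z"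
      using pown by blast
    have "of_int (c ^ n) * (z ^ i * ieval (pCons a R) z) = ieval (smult a s + r) z"
      using r(2) s(2) by (simp add: algebra_simps)
    moreover have "smult a s + r = 0 \<or> degree (smult a s + r) < d"
      using \<open>d > 0\<close> r(1) s(1) by (auto intro!: degree_add_less)
    ultimately show ?case by blast
  qed
  show thesis
  proof (rule that)
    show "c ^ n \<noteq> 0" using c by simp
    show "\<exists>r. (r = 0 \<or> degree r < d) \<and> of_int (c ^ n) * ieval R z = ieval r z" for R
      using all[of 0 R] by simp
    show "r = 0" if "r = 0 \<or> degree r < d" "ieval r z = 0" for r
      using uniq[OF that] .
  qed
qed

lemma large_prime_power_root:
  assumes "z ^ n = 1" "n > 0"
  shows "\<exists>B :: nat. \<forall>p k. prime p \<longrightarrow> p > B \<longrightarrow> ieval f (z ^ k) = 0 \<longrightarrow> ieval f (z ^ (k * p)) = 0"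
proof -
  obtain c :: int and d where c: "c \<noteq> 0"
    and ex: "\<And>R. \<exists>r. (r = 0 \<or> degree r < d) \<and> of_int c * ieval R z = ieval r z"
    and uniq: "\<And>r. r = 0 \<or> degree r < d \<Longrightarrow> ieval r z = 0 \<Longrightarrow> r = 0"
    by (rule integral_coordinates[OF assms], rule that)
  have "\<exists>r. (r = 0 \<or> degree r < d) \<and> of_int c * ieval f (z ^ k) = ieval r z" for k
    using ex[of "pcompose f (monom 1 k)"] by simp
  then have "\<exists>r. \<forall>k. (r k = 0 \<or> degree (r k) < d) \<and> of_int c * ieval f (z ^ k) = ieval (r k) z"
    by (intro choice allI)
  then obtain r where r: "\<And>k. (r k = 0 \<or> degree (r k) < d) \<and> of_int c * ieval f (z ^ k) = ieval (r k) z"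
    by (elim exE) (rule that, erule spec)
  \<comment> \<open>The sum of all coordinates of the finitely many values of \<open>f\<close> at
    powers of \<open>z\<close>, hence a bound for each of them.\<close>
  define B where "B = (\<Sum>k<n. \<Sum>i\<le>degree (r k). nat \<bar>coeff (r k) i\<bar>)"
  have bound: "nat \<bar>coeff (r k) i\<bar> \<le> B" if "k < n" for k i
  proof (cases "i \<le> degree (r k)")
    case True
    then have "nat \<bar>coeff (r k) i\<bar> \<le> (\<Sum>i\<le>degree (r k). nat \<bar>coeff (r k) i\<bar>)"
      by (intro member_le_sum) auto
    also have "\<dots> \<le> B" unfolding B_def
      using that by (intro member_le_sum[where f = "\<lambda>k. \<Sum>i\<le>degree (r k). nat \<bar>coeff (r k) i\<bar>"]) auto
    finally show ?thesis .
  next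
    case False
    then show ?thesis by (simp add: coeff_eq_0)
  qed
  have main: "ieval f (z ^ (k * p)) = 0" if asm: "prime p" "p > B" "ieval f (z ^ k) = 0" for p k
  proof -
    obtain g where g: "f ^ p = pcompose f (monom 1 p) + of_nat p * g"
      using frobenius_int_poly[OF asm(1), of f] by blast
    have "ieval (f ^ p) (z ^ k) = 0" using asm prime_gt_0_nat[OF asm(1)] by simp
    then have eq: "ieval f (z ^ (k * p)) = - of_nat p * ieval g (z ^ k)"
      unfolding g by (simp add: of_nat_poly power_mult eq_neg_iff_add_eq_0)
    obtain s where s: "s = 0 \<or> degree s < d" "of_int c * ieval g (z ^ k) = ieval s z"
      using ex[of "pcompose g (monom 1 k)"] by auto
    define m where "m = (k * p) mod n"
    have zm: "z ^ (k * p) = z ^ m" unfolding m_def using assms(1) by (rule root_power_mod)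
    have "ieval (r m + smult (int p) s) z = 0"
    proof -
      have "ieval (r m) z = of_int c * (- of_nat p * ieval g (z ^ k))" using r[of m] eq zm by simp
      also have "\<dots> = - of_nat p * ieval s z" unfolding s(2) [symmetric] by (simp only: mult_ac)
      finally show ?thesis by simp
    qed
    moreover have "r m + smult (int p) s = 0 \<or> degree (r m + smult (int p) s) < d"
      using r[of m] s(1) by (auto intro!: degree_add_less)
    ultimately have rs: "r m + smult (int p) s = 0" using uniq by blast
    have "r m = 0"
    proof (rule poly_eqI)
      fix i
      have "coeff (r m) i + int p * coeff s i = 0" using arg_cong[OF rs, of "\<lambda>q. coeff q i"] by simp
      then have "coeff (r m) i = int p * (- coeff s i)" by simp
      then have dv: "int p dvd coeff (r m) i" by (rule dvdI)
      have "nat \<bar>coeff (r m) i\<bar> < p" using bound[of m i] asm(2) assms by (simp add: m_def)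
      then have "\<bar>coeff (r m) i\<bar> < int p" by linarith
      moreover have "\<bar>int p\<bar> \<le> \<bar>coeff (r m) i\<bar>" if "coeff (r m) i \<noteq> 0"
        using that dv by (rule dvd_imp_le_int)
      ultimately show "coeff (r m) i = coeff 0 i" by fastforce
    qed
    then have "of_int c * ieval f (z ^ m) = 0" using r[of m] by simp
    then show ?thesis unfolding zm using c by (simp only: mult_eq_0_iff of_int_eq_0_iff simp_thms)
  qed
  show ?thesis by (intro exI[of _ B] allI impI) (rule main)
qed

text \<open>Conjugation by \<open>u\<close> can be carried out one prime factor at a time, so a
  product of large primes in the residue class is enough and Dirichlet's theorem is avoided. Adding
  \<open>n\<close> times all small primes that do not divide \<open>u\<close> removes every small
  prime factor.\<close>

lemma coprime_large_residue:
  fixes u n B :: nat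
  assumes "coprime u n" "n > 0" "u > 0"
  shows "\<exists>k>0. [k = u] (mod n) \<and> (\<forall>p. prime p \<longrightarrow> p dvd k \<longrightarrow> p > B)"
proof -
  define Q where "Q = {p. prime p \<and> p \<le> B \<and> \<not> p dvd u}"
  have fin: "finite Q" unfolding Q_def by (rule finite_subset[of _ "{..B}"]) auto
  define k where "k = u + n * \<Prod>Q"
  have "p > B" if p: "prime p" "p dvd k" for p
  proof (rule ccontr)
    assume "\<not> p > B"
    show False
    proof (cases "p dvd u")
      case True
      then have "p dvd n * \<Prod>Q" using p(2) unfolding k_def by (simp add: dvd_add_right_iff)
      moreover have "\<not> p dvd n" using assms(1) True p(1)
        by (metis coprime_common_divisor_nat not_prime_1 dvd_refl nat_dvd_1_iff_1)
      ultimately have "p dvd \<Prod>Q" using p(1) prime_dvd_mult_iff by blast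
      then obtain q where "q \<in> Q" "p dvd q" using p(1) fin by (auto simp: prime_dvd_prod_iff)
      then show False using True p(1) primes_dvd_imp_eq[of p q] by (auto simp: Q_def)
    next
      case False
      then have "p \<in> Q" using p(1) \<open>\<not> p > B\<close> by (auto simp: Q_def)
      then have "p dvd n * \<Prod>Q" using fin by (intro dvd_mult dvd_prodI)
      then have "p dvd u" using p(2) unfolding k_def by (simp add: dvd_add_left_iff)
      then show False using False by blast
    qed
  qed
  moreover have "[k = u] (mod n)" by (simp add: k_def cong_def)
  ultimately show ?thesis using assms(3) by (intro exI[of _ k]) (auto simp: k_def)
qed

text \<open>Takes the place of the irreducibility of the cyclotomic polynomials: one vanishing
  character sum yields vanishing at all roots of the same order.\<close>

theorem galois_conjugate_root:
  assumes "prim_root n z" "prim_root n w" "ieval f z = 0"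
  shows "ieval f w = 0"
proof -
  have n: "n > 0" and z: "z ^ n = 1" using assms(1) by (auto simp: prim_root_def)
  obtain B :: nat where B: "\<And>p k. prime p \<Longrightarrow> p > B \<Longrightarrow> ieval f (z ^ k) = 0 \<Longrightarrow> ieval f (z ^ (k * p)) = 0"
    using large_prime_power_root[OF z n, of f] by metis
  obtain u where u: "u > 0" "coprime u n" "w = z ^ u"
    using prim_root_power_coprime[OF assms(1,2)] by blast
  obtain k where k: "k > 0" "[k = u] (mod n)" "\<forall>p. prime p \<longrightarrow> p dvd k \<longrightarrow> p > B"
    using coprime_large_residue[OF u(2) n u(1), of B] by blast
  have "k > 0 \<Longrightarrow> \<forall>p. prime p \<longrightarrow> p dvd k \<longrightarrow> p > B \<Longrightarrow> ieval f (z ^ k) = 0" for k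
  proof (induction k rule: less_induct)
    case (less k)
    show ?case
    proof (cases "k = 1")
      case True
      then show ?thesis using assms(3) by simp
    next
      case False
      then obtain p where p: "prime p" "p dvd k" using prime_factor_nat by blast
      then obtain l where l: "k = l * p" by (metis dvd_def mult.commute)
      have "l < k" "l > 0" using l less.prems(1) prime_gt_1_nat[OF p(1)] by auto
      then have "ieval f (z ^ l) = 0" using less.prems(2) l by (intro less.IH) auto
      then show ?thesis unfolding l using B[OF p(1)] less.prems(2) p by blast
    qed
  qed
  then have "ieval f (z ^ k) = 0" using k by blast
  moreover have "z ^ k = w"
    using k(2) u(3) root_power_mod[OF z, of k] root_power_mod[OF z, of u] by (simp add: cong_def)
  ultimately show ?thesis by simp
qed

corollary vanishes_if_root:
  assumes "prim_root s z" "esum A z = 0"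
  shows "vanishes A s"
proof -
  have "ieval (\<Sum>a\<in>A. monom 1 a) w = esum A w" for w
    by (simp add: esum_def)
  then show ?thesis
    using galois_conjugate_root[OF assms(1)] assms(2) unfolding vanishes_def by metis
qed

subsection \<open>Residue counts and their Fourier transform\<close>

definition cnt :: "nat set \<Rightarrow> nat \<Rightarrow> nat \<Rightarrow> nat" where
  "cnt A N x = card {a \<in> A. [a = x] (mod N)}"

text \<open>For N = h r this says that \<open>A\<close> modulo N, counted with multiplicity, is a
  union of cycles x, x + h, ..., x + (r - 1) h.\<close>

definition shift_inv :: "nat set \<Rightarrow> nat \<Rightarrow> nat \<Rightarrow> bool" where
  "shift_inv A N h \<longleftrightarrow> (\<forall>x. cnt A N (x + h) = cnt A N x)"

lemma cnt_cong: "[x = y] (mod N) \<Longrightarrow> cnt A N x = cnt A N y"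
  unfolding cnt_def by (metis cong_sym cong_trans)

lemma cnt_add_period [simp]: "cnt A N (x + N) = cnt A N x"
  by (rule cnt_cong) (simp add: cong_def)

lemma cnt_mod: "cnt A N (x mod N) = cnt A N x"
  by (rule cnt_cong) (simp add: cong_def)

lemma cnt_le_card: "finite A \<Longrightarrow> cnt A N x \<le> card A"
  unfolding cnt_def by (rule card_mono) auto

lemma cnt_1 [simp]: "cnt A (Suc 0) x = card A"
  unfolding cnt_def by (simp add: cong_def)

lemma cnt_pos: "finite A \<Longrightarrow> a \<in> A \<Longrightarrow> cnt A N a > 0"
  unfolding cnt_def by (subst card_gt_0_iff) auto

lemma sum_by_residue:
  fixes g :: "nat \<Rightarrow> 'a :: comm_semiring_1"
  assumes "finite A" "N > 0" "\<And>a. g a = g (a mod N)"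
  shows "(\<Sum>a\<in>A. g a) = (\<Sum>x<N. of_nat (cnt A N x) * g x)"
proof -
  have "(\<Sum>a\<in>A. g a) = (\<Sum>x<N. \<Sum>a\<in>{a \<in> A. a mod N = x}. g a)"
    using assms by (intro sum.group [symmetric]) auto
  also have "\<dots> = (\<Sum>x<N. of_nat (cnt A N x) * g x)"
  proof (rule sum.cong)
    fix x assume x: "x \<in> {..<N}"
    have "(\<Sum>a\<in>{a \<in> A. a mod N = x}. g a) = (\<Sum>a\<in>{a \<in> A. a mod N = x}. g x)"
      using assms(3) by (intro sum.cong) auto
    then show "(\<Sum>a\<in>{a \<in> A. a mod N = x}. g a) = of_nat (cnt A N x) * g x"
      using x by (simp add: cnt_def cong_def)
  qed simp
  finally show ?thesis .
qed

lemma sum_cnt: "finite A \<Longrightarrow> N > 0 \<Longrightarrow> (\<Sum>x<N. cnt A N x) = card A"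
  using sum_by_residue[of A N "\<lambda>_. 1 :: nat"] by simp

lemma sum_rou:
  assumes "N > 0"
  shows "(\<Sum>t<N. rou t N ^ a * inverse (rou t N) ^ x) = (if [a = x] (mod N) then of_nat N else 0)"
proof -
  define w where "w = rou a N / rou x N"
  have "rou t N ^ a * inverse (rou t N) ^ x = w ^ t" for t
  proof -
    have "rou t N ^ a = rou a N ^ t" "rou t N ^ x = rou x N ^ t" by (simp_all add: rou_power mult.commute)
    then show ?thesis by (simp add: w_def divide_inverse power_mult_distrib power_inverse)
  qed
  then have eq: "(\<Sum>t<N. rou t N ^ a * inverse (rou t N) ^ x) = (\<Sum>t<N. w ^ t)" by simp
  show ?thesis
  proof (cases "[a = x] (mod N)")
    case True
    then have "w = 1" using assms by (simp add: w_def rou_eq_iff)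
    then show ?thesis using True eq by simp
  next
    case False
    then have w: "w \<noteq> 1" using assms by (simp add: w_def rou_eq_iff)
    have "w ^ N = 1" using assms by (simp add: w_def power_divide rou_power rou_eq_iff cong_def)
    then have "(\<Sum>t<N. w ^ t) = 0" using w by (simp add: geometric_sum)
    then show ?thesis using False eq by simp
  qed
qed

lemma cnt_fourier:
  assumes "finite A" "N > 0"
  shows "of_nat N * of_nat (cnt A N x) = (\<Sum>t<N. inverse (rou t N) ^ x * esum A (rou t N))"
proof -
  have "(\<Sum>t<N. inverse (rou t N) ^ x * esum A (rou t N)) =
      (\<Sum>t<N. \<Sum>a\<in>A. rou t N ^ a * inverse (rou t N) ^ x)"
    unfolding esum_def sum_distrib_left by (simp add: mult.commute)
  also have "\<dots> = (\<Sum>a\<in>A. \<Sum>t<N. rou t N ^ a * inverse (rou t N) ^ x)"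
    by (rule sum.swap)
  also have "\<dots> = (\<Sum>a\<in>A. if [a = x] (mod N) then of_nat N else 0)"
    by (simp only: sum_rou[OF assms(2)])
  also have "\<dots> = (\<Sum>a\<in>{a \<in> A. [a = x] (mod N)}. of_nat N)"
    by (rule sum.inter_filter [symmetric]) (rule assms)
  also have "\<dots> = of_nat N * of_nat (cnt A N x)" by (simp add: cnt_def mult.commute)
  finally show ?thesis by simp
qed

lemma sum_shift_periodic:
  fixes g :: "nat \<Rightarrow> 'a :: ab_group_add"
  assumes "\<And>x. g (x + N) = g x"
  shows "(\<Sum>x<N. g (x + h)) = (\<Sum>x<N. g x)"
proof (induction h)
  case (Suc h)
  have "(\<Sum>x<N. g (Suc (x + h))) + g h = (\<Sum>x<Suc N. g (x + h))"
    by (subst sum.lessThan_Suc_shift) (simp add: add.commute)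
  also have "\<dots> = (\<Sum>x<N. g (x + h)) + g h"
    using assms[of h] by (simp add: add.commute)
  finally show ?case using Suc by simp
qed simp

lemma periodic_mult:
  fixes h :: nat
  assumes "\<And>x. g (x + h) = g x"
  shows "g (x + k * h) = g x"
proof (induction k)
  case (Suc k)
  have "x + Suc k * h = (x + k * h) + h" by simp
  then show ?case using assms[of "x + k * h"] Suc by metis
qed simp

lemma sum_periodic:
  fixes g :: "nat \<Rightarrow> 'a :: comm_semiring_1"
  assumes "\<And>x. g (x + h) = g x"
  shows "(\<Sum>x<r * h. g x) = of_nat r * (\<Sum>x<h. g x)"
proof (induction r)
  case (Suc r)
  have "g (x + k * h) = g x" for k x by (rule periodic_mult) (rule assms)
  then have "(\<Sum>x<h. g (r * h + x)) = (\<Sum>x<h. g x)" by (simp add: add.commute)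
  moreover have "{..<Suc r * h} = {..<r * h} \<union> {r * h..<r * h + h}" by auto
  moreover have "(\<Sum>x\<in>{r * h..<r * h + h}. g x) = (\<Sum>x<h. g (r * h + x))"
    by (rule sum.reindex_bij_witness[of _ "\<lambda>x. r * h + x" "\<lambda>x. x - r * h"]) auto
  ultimately show ?case using Suc by (simp add: sum.union_disjoint ivl_disj_int algebra_simps)
qed simp

text \<open>The dictionary between zeros and cycles. A shift by \<open>h\<close> multiplies the sum
  at a root \<open>z\<close> of order s by \<open>z ^ h\<close>, so invariance kills the sum unless
  s divides \<open>h\<close>; Fourier inversion gives the other direction.\<close>

theorem shift_inv_iff:
  assumes "finite A" "N > 0"
  shows "shift_inv A N h \<longleftrightarrow> (\<forall>s. s dvd N \<longrightarrow> \<not> s dvd h \<longrightarrow> vanishes A s)"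
proof
  assume *: "\<forall>s. s dvd N \<longrightarrow> \<not> s dvd h \<longrightarrow> vanishes A s"
  have "cnt A N (x + h) = cnt A N x" for x
  proof -
    have key: "inverse (rou t N) ^ (x + h) * esum A (rou t N) = inverse (rou t N) ^ x * esum A (rou t N)" for t
    proof (cases "N div gcd t N dvd h")
      case True
      then have "rou t N ^ h = 1" using prim_root_rou[OF assms(2), of t] by (simp add: prim_root_power_eq_1)
      then show ?thesis by (simp add: power_add power_inverse)
    next
      case False
      moreover have "N div gcd t N dvd N" by (metis dvd_div_mult_self dvd_triv_left gcd_dvd2)
      ultimately have "esum A (rou t N) = 0"
        using * prim_root_rou[OF assms(2), of t] unfolding vanishes_def by blast
      then show ?thesis by simp
    qed
    have "of_nat N * of_nat (cnt A N (x + h)) = (of_nat N * of_nat (cnt A N x) :: complex)"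
      unfolding cnt_fourier[OF assms] by (simp only: key)
    then show ?thesis using assms by (simp only: mult_cancel_left of_nat_eq_iff of_nat_eq_0_iff) simp
  qed
  then show "shift_inv A N h" by (simp add: shift_inv_def)
next
  assume *: "shift_inv A N h"
  show "\<forall>s. s dvd N \<longrightarrow> \<not> s dvd h \<longrightarrow> vanishes A s"
    unfolding vanishes_def
  proof (intro allI impI)
    fix s z assume s: "s dvd N" "\<not> s dvd h" "prim_root s z"
    have zN: "z ^ N = 1" and zh: "z ^ h \<noteq> 1" using s by (simp_all add: prim_root_power_eq_1)
    have e: "esum A z = (\<Sum>x<N. of_nat (cnt A N x) * z ^ x)"
      unfolding esum_def using assms root_power_mod[OF zN] by (intro sum_by_residue)
    have "(\<Sum>x<N. of_nat (cnt A N (x + h)) * z ^ (x + h)) = (\<Sum>x<N. of_nat (cnt A N x) * z ^ x)"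
      by (rule sum_shift_periodic) (simp add: power_add zN)
    moreover have "(\<Sum>x<N. of_nat (cnt A N (x + h)) * z ^ (x + h)) = z ^ h * esum A z"
      using * unfolding e shift_inv_def by (simp add: sum_distrib_left power_add algebra_simps)
    ultimately have "z ^ h * esum A z = esum A z" using e by simp
    then show "esum A z = 0" using zh by simp
  qed
qed

text \<open>Vanishing mixed second differences: along the directions \<open>h\<close> and
  \<open>k\<close> the count is the sum of a function constant in one direction and a function
  constant in the other. This is the additive structure in de Bruijn's theorem before nonnegativity
  enters.\<close>

definition four_point :: "nat set \<Rightarrow> nat \<Rightarrow> nat \<Rightarrow> nat \<Rightarrow> bool" where
  "four_point A N h k \<longleftrightarrow>
     (\<forall>x u v. cnt A N x + cnt A N (x + u * h + v * k) = cnt A N (x + u * h) + cnt A N (x + v * k))"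

text \<open>The relation is linear and holds for each Fourier mode separately: a mode of order N is
  absent, and any other mode is invariant under \<open>h\<close> or under \<open>k\<close>.\<close>

lemma four_point_if_vanishes:
  assumes "finite A" "N > 0" "vanishes A N"
    and "\<And>s. s dvd N \<Longrightarrow> s \<noteq> N \<Longrightarrow> s dvd h \<or> s dvd k"
  shows "four_point A N h k"
  unfolding four_point_def
proof (intro allI)
  fix x u v
  define S where "S = (\<lambda>t y. inverse (rou t N) ^ y * esum A (rou t N))"
  have "S t x + S t (x + u * h + v * k) = S t (x + u * h) + S t (x + v * k)" for t
  proof -
    define s where "s = N div gcd t N"
    have s: "prim_root s (rou t N)" using prim_root_rou[OF assms(2)] by (simp add: s_def)
    have "s dvd N" unfolding s_def by (metis dvd_div_mult_self dvd_triv_left gcd_dvd2)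
    then consider "s = N" | "s dvd h" | "s dvd k" using assms(4) by blast
    then show ?thesis
    proof cases
      case 1
      then show ?thesis using assms(3) s by (simp add: S_def vanishes_def)
    next
      case 2
      then have "rou t N ^ (u * h) = 1" using s by (simp add: prim_root_power_eq_1)
      then show ?thesis by (simp add: S_def power_add power_inverse)
    next
      case 3
      then have "rou t N ^ (v * k) = 1" using s by (simp add: prim_root_power_eq_1)
      then show ?thesis by (simp add: S_def power_add power_inverse)
    qed
  qed
  then have "of_nat N * of_nat (cnt A N x) + of_nat N * of_nat (cnt A N (x + u * h + v * k)) =
      (of_nat N * of_nat (cnt A N (x + u * h)) + of_nat N * of_nat (cnt A N (x + v * k)) :: complex)"
    unfolding cnt_fourier[OF assms(1,2)] S_def sum.distrib [symmetric] by (intro sum.cong) auto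
  then have "of_nat (N * (cnt A N x + cnt A N (x + u * h + v * k))) =
      (of_nat (N * (cnt A N (x + u * h) + cnt A N (x + v * k))) :: complex)"
    by (simp only: of_nat_mult of_nat_add distrib_left)
  then have "N * (cnt A N x + cnt A N (x + u * h + v * k)) = N * (cnt A N (x + u * h) + cnt A N (x + v * k))"
    by (simp only: of_nat_eq_iff)
  then show "cnt A N x + cnt A N (x + u * h + v * k) = cnt A N (x + u * h) + cnt A N (x + v * k)"
    using assms(2) by simp
qed

lemma cnt_shift_mult: "shift_inv A N h \<Longrightarrow> cnt A N (x + v * h) = cnt A N x"
  by (rule periodic_mult) (simp add: shift_inv_def)

lemma cnt_refine:
  assumes "finite A" "M > 0" "r > 0"
  shows "cnt A M x = (\<Sum>v<r. cnt A (M * r) (x + v * M))"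
proof -
  let ?B = "\<lambda>v. {a \<in> A. [a = x + v * M] (mod M * r)}"
  have "{a \<in> A. [a = x] (mod M)} = (\<Union>v<r. ?B v)"
  proof (intro equalityI subsetI)
    fix a assume a: "a \<in> {a \<in> A. [a = x] (mod M)}"
    \<comment> \<open>The element \<open>a\<close> is moved up by a multiple of the modulus so that
      \<open>x\<close> can be subtracted within the natural numbers.\<close>
    define c where "c = a + M * r * x"
    have "1 * x \<le> M * r * x" using assms by (intro mult_le_mono1) (simp add: Suc_le_eq)
    then have cx: "c \<ge> x" unfolding c_def by linarith
    have "[c = x] (mod M)" using a by (simp add: c_def cong_def mult.assoc)
    then have "M dvd c - x" using cx by (simp add: cong_altdef_nat cong_sym_eq)
    then obtain w where w: "c = x + M * w" using cx by (metis dvdE le_add_diff_inverse)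
    have "[c = x + (w mod r) * M] (mod M * r)"
    proof -
      have "w = w mod r + r * (w div r)" by simp
      then have "x + M * w = x + (w mod r) * M + M * r * (w div r)"
        by (metis (no_types, lifting) add.assoc distrib_left mult.assoc mult.commute)
      then show ?thesis unfolding w by (simp only: cong_def mod_mult_self2)
    qed
    moreover have "[a = c] (mod M * r)" by (simp add: c_def cong_def)
    ultimately have "[a = x + (w mod r) * M] (mod M * r)" by (metis cong_trans)
    then show "a \<in> (\<Union>v<r. ?B v)" using a assms(3) by auto
  next
    fix a assume "a \<in> (\<Union>v<r. ?B v)"
    then obtain v where "a \<in> A" "[a = x + v * M] (mod M * r)" by blast
    then have "[a = x + v * M] (mod M)" by (metis cong_modulus_mult_nat)
    then show "a \<in> {a \<in> A. [a = x] (mod M)}" using \<open>a \<in> A\<close> by (simp add: cong_def)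
  qed
  moreover have "card (\<Union>v<r. ?B v) = (\<Sum>v<r. card (?B v))"
  proof (rule card_UN_disjoint)
    show "\<forall>v\<in>{..<r}. \<forall>w\<in>{..<r}. v \<noteq> w \<longrightarrow> ?B v \<inter> ?B w = {}"
    proof (intro ballI impI)
      fix v w assume vw: "v \<in> {..<r}" "w \<in> {..<r}" "v \<noteq> w"
      have "\<not> [x + v * M = x + w * M] (mod M * r)"
      proof
        assume "[x + v * M = x + w * M] (mod M * r)"
        then have "[M * v = M * w] (mod M * r)" by (simp add: cong_add_lcancel_nat mult.commute)
        then have "M * v mod (M * r) = M * w mod (M * r)" by (simp add: cong_def)
        then have "M * (v mod r) = M * (w mod r)" by (simp only: mult_mod_right)
        then show False using vw assms by simp
      qed
      then show "?B v \<inter> ?B w = {}" by (auto simp: cong_def)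
    qed
  qed (use assms in auto)
  ultimately show ?thesis unfolding cnt_def by simp
qed

lemma cnt_shift_collapse:
  assumes "finite A" "M > 0" "r > 0" "shift_inv A (M * r) M"
  shows "cnt A M x = r * cnt A (M * r) x"
  using cnt_refine[OF assms(1-3), of x] cnt_shift_mult[OF assms(4)] by simp

lemma cnt_coarse_dvd:
  assumes "finite A" "M > 0" "M dvd N" "N > 0" "\<And>x. c dvd cnt A N x"
  shows "c dvd cnt A M x"
proof -
  obtain r where r: "N = M * r" using assms by blast
  then have "r > 0" using assms by auto
  show ?thesis unfolding cnt_refine[OF assms(1,2) \<open>r > 0\<close>, of x] using assms(5) r
    by (auto intro: dvd_sum)
qed

lemma cnt_coarse_le:
  assumes "finite A" "M dvd N"
  shows "cnt A N x \<le> cnt A M x"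
  unfolding cnt_def using assms by (intro card_mono) (auto intro: cong_dvd_modulus_nat)

subsection \<open>Vanishing at prime powers\<close>

lemma dvd_prime_pow_proper:
  fixes p :: nat
  assumes "prime p" "s dvd p ^ Suc i" "\<not> s dvd p ^ i"
  shows "s = p ^ Suc i"
  using assms divides_primepow_nat[OF assms(1)]
  by (metis le_SucE le_imp_power_dvd)

lemma shift_inv_if_vanishes_prime_power:
  assumes "finite A" "prime p" "vanishes A (p ^ Suc i)"
  shows "shift_inv A (p ^ Suc i) (p ^ i)"
  using assms dvd_prime_pow_proper[OF assms(2)] prime_gt_0_nat[OF assms(2)]
  by (subst shift_inv_iff) (metis zero_less_power)+

text \<open>A counting form of \<Phi>(1) = p for prime powers: each vanishing level collapses cycles
  of length \<open>p\<close>, so it contributes one factor \<open>p\<close> to the counts at all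
  coarser levels.\<close>

theorem prime_power_vanishes_dvd_card:
  assumes "finite A" "prime p" "finite S" "\<And>i. i \<in> S \<Longrightarrow> i \<ge> 1 \<and> vanishes A (p ^ i)"
  shows "p ^ card S dvd card A"
proof -
  define M where "M = Max (insert 0 S)"
  have M: "i \<le> M" if "i \<in> S" for i using that assms(3) by (simp add: M_def)
  have p: "p > 0" using assms(2) prime_gt_0_nat by blast
  \<comment> \<open>Induction from the finest level down to \<open>k = 0\<close>, where the count is
    the cardinality.\<close>
  have "p ^ card {i \<in> S. k < i} dvd cnt A (p ^ k) x" if "k \<le> M" for k x
    using that
  proof (induction arbitrary: x rule: inc_induct)
    case base
    have "{i \<in> S. M < i} = {}" using M by force
    then show ?case by (simp only: card.empty power_0 one_dvd)
  next
    case (step k)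
    have IH: "p ^ card {i \<in> S. Suc k < i} dvd cnt A (p ^ k * p) x" for x
      using step.IH by (simp add: mult.commute)
    show ?case
    proof (cases "Suc k \<in> S")
      case True
      have "{i \<in> S. k < i} = insert (Suc k) {i \<in> S. Suc k < i}" using True by auto
      then have "card {i \<in> S. k < i} = Suc (card {i \<in> S. Suc k < i})"
        using assms(3) by simp
      moreover have "shift_inv A (p ^ k * p) (p ^ k)"
        using shift_inv_if_vanishes_prime_power[OF assms(1,2), of k] assms(4)[OF True] by (simp add: mult.commute)
      then have "cnt A (p ^ k) x = p * cnt A (p ^ k * p) x"
        using assms(1) p by (intro cnt_shift_collapse) auto
      ultimately show ?thesis using IH[of x] by (simp add: mult_dvd_mono)
    next
      case False
      then have "k < i \<longleftrightarrow> Suc k < i" if "i \<in> S" for i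
        using that by (cases "i = Suc k") auto
      then have e: "{i \<in> S. k < i} = {i \<in> S. Suc k < i}" by blast
      show ?thesis unfolding e
        by (rule cnt_coarse_dvd[where N = "p ^ k * p"]) (use p assms(1) in \<open>simp_all add: IH\<close>)
    qed
  qed
  from this[of 0] have "p ^ card {i \<in> S. 0 < i} dvd card A" by simp
  moreover have "{i \<in> S. 0 < i} = S" using assms(4) by force
  ultimately show ?thesis by simp
qed

subsection \<open>The dichotomy for sets with two prime factors\<close>

text \<open>
  Nonnegative form of de Bruijn's theorem: the count splits as \<open>\<beta>\<close>, the minimum over the cycle of
  length \<open>p\<close>, plus a remainder that is constant on the cycles of length \<open>q\<close>; comparing total
  masses, one of the two parts is zero.
\<close>

theorem four_point_dichotomy:
  assumes "finite A" "coprime p q" "p > 0" "q > 0" "N = p * h" "N = q * k" "N > 0"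
    and fp: "four_point A N h k" and card: "card A = p * q"
  shows "shift_inv A N h \<or> shift_inv A N k"
proof -
  define b where "b = (\<lambda>x. LEAST n. \<exists>u. cnt A N (x + u * h) = n)"
  have b_ex: "\<exists>u. cnt A N (x + u * h) = b x" for x
    unfolding b_def by (rule LeastI_ex) blast
  have b_le: "b x \<le> cnt A N (x + u * h)" for x u
    unfolding b_def by (rule Least_le) blast
  define a where "a = (\<lambda>x. cnt A N x - b x)"
  have ab: "cnt A N x = a x + b x" for x
    using b_le[of x 0] by (simp add: a_def)
  have b_shift: "b (x + h) = b x" for x
  proof (rule antisym)
    obtain u where u: "cnt A N (x + u * h) = b x" using b_ex by blast
    have "cnt A N (x + u * h) = cnt A N (x + u * h + N)" by simp
    \<comment> \<open>A step back by \<open>h\<close> is written as \<open>p - 1\<close> steps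
      forward around the cycle.\<close>
    also have "x + u * h + N = x + h + (u + p - 1) * h"
      using assms(3,5) by (cases p) (auto simp: algebra_simps)
    finally show "b (x + h) \<le> b x" using b_le[of "x + h" "u + p - 1"] u by simp
  next
    obtain u where u: "cnt A N (x + h + u * h) = b (x + h)" using b_ex by blast
    have "x + h + u * h = x + Suc u * h" by simp
    then show "b x \<le> b (x + h)" using b_le[of x "Suc u"] u by metis
  qed
  have a_shift: "a (x + k) = a x" for x
  proof -
    have fp': "cnt A N x + cnt A N (x + k + u * h) = cnt A N (x + u * h) + cnt A N (x + k)" for u
      using fp[unfolded four_point_def, rule_format, of x u 1] by (simp add: add_ac)
    obtain u where u: "cnt A N (x + u * h) = b x" using b_ex by blast
    obtain v where v: "cnt A N (x + k + v * h) = b (x + k)" using b_ex by blast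
    have "b (x + k) \<le> cnt A N (x + k + u * h)" "b x \<le> cnt A N (x + v * h)" using b_le by blast+
    then have "cnt A N x + b (x + k) = b x + cnt A N (x + k)"
      using fp'[of u] fp'[of v] u v by linarith
    then show ?thesis using ab[of x] ab[of "x + k"] by linarith
  qed
  define X Y where "X = (\<Sum>x<k. a x)" and "Y = (\<Sum>x<h. b x)"
  have "(\<Sum>x<N. a x) = q * X" "(\<Sum>x<N. b x) = p * Y"
    using sum_periodic[of a k q, OF a_shift] sum_periodic[of b h p, OF b_shift] assms(5,6)
    by (simp_all add: X_def Y_def)
  moreover have "(\<Sum>x<N. a x + b x) = p * q"
    using sum_cnt[OF assms(1,7)] card ab by simp
  \<comment> \<open>Coprimality gives X = p X', and dividing by p leaves q X' + Y = q, so X' = 0 or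
    Y = 0. Here the size \<open>p * q\<close> is decisive.\<close>
  ultimately have eq: "q * X + p * Y = p * q" by (simp add: sum.distrib)
  then have "p dvd q * X" by (metis dvd_add_left_iff dvd_triv_left)
  then obtain X' where X': "X = p * X'" using assms(2) by (auto simp: coprime_dvd_mult_right_iff)
  have "p * (q * X' + Y) = p * q" using eq X' by (simp add: algebra_simps)
  then have "q * X' + Y = q" using assms(3) by simp
  then have "X' = 0 \<or> Y = 0" using assms(4) by (cases X') auto
  then show ?thesis
  proof
    assume "X' = 0"
    then have "(\<Sum>x<N. a x) = 0" using \<open>(\<Sum>x<N. a x) = q * X\<close> X' by simp
    then have a0: "a x = 0" if "x < N" for x using that by simp
    have "cnt A N x = b x" for x
    proof -
      have "a (x + v * k) = a x" for x v
        by (rule periodic_mult) (rule a_shift)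
      then have "a (x mod N + (x div N * q) * k) = a (x mod N)" by blast
      moreover have "x mod N + (x div N * q) * k = x" by (metis assms(6) mod_div_mult_eq mult.assoc)
      ultimately have "a x = a (x mod N)" by simp
      then show ?thesis using ab[of x] a0[of "x mod N"] assms(7) by simp
    qed
    then have "shift_inv A N h" using b_shift by (simp add: shift_inv_def)
    then show ?thesis ..
  next
    assume "Y = 0"
    then have b0: "b x = 0" if "x < N" for x using that \<open>(\<Sum>x<N. b x) = p * Y\<close> by simp
    have "cnt A N x = a x" for x
    proof -
      have "b (x + v * h) = b x" for x v
        by (rule periodic_mult) (rule b_shift)
      then have "b (x mod N + (x div N * p) * h) = b (x mod N)" by blast
      moreover have "x mod N + (x div N * p) * h = x" by (metis assms(5) mod_div_mult_eq mult.assoc)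
      ultimately have "b x = b (x mod N)" by simp
      then show ?thesis using ab[of x] b0[of "x mod N"] assms(7) by simp
    qed
    then have "shift_inv A N k" using a_shift by (simp add: shift_inv_def)
    then show ?thesis ..
  qed
qed

subsection \<open>Residue classes\<close>

text \<open>Where \<open>D\<close> is equidistributed modulo \<open>p\<close> or modulo
  \<open>q\<close>, its classes have only \<open>p * q\<close> or \<open>p ^ 2\<close> elements; at
  these sizes the two kinds of cycles can be kept apart.\<close>

definition res_class :: "nat set \<Rightarrow> nat \<Rightarrow> nat \<Rightarrow> nat set" where
  "res_class A m u = {a \<in> A. a mod m = u}"

lemma finite_res_class [simp]: "finite A \<Longrightarrow> finite (res_class A m u)"
  by (simp add: res_class_def)

lemma card_res_class: "u < m \<Longrightarrow> card (res_class A m u) = cnt A m u"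
  by (simp add: res_class_def cnt_def cong_def)

lemma cnt_res_class:
  assumes "m dvd N"
  shows "cnt (res_class A m u) N x = (if x mod m = u then cnt A N x else 0)"
proof -
  have *: "a mod m = x mod m" if "[a = x] (mod N)" for a
    using cong_dvd_modulus_nat[OF that assms] by (simp add: cong_def)
  have "(a \<in> A \<and> a mod m = u) \<and> [a = x] (mod N) \<longleftrightarrow> x mod m = u \<and> a \<in> A \<and> [a = x] (mod N)" for a
    using *[of a] by metis
  then have eq: "{a \<in> res_class A m u. [a = x] (mod N)} = {a. x mod m = u \<and> a \<in> A \<and> [a = x] (mod N)}"
    unfolding res_class_def mem_Collect_eq by (rule Collect_cong)
  show ?thesis unfolding cnt_def eq by (cases "x mod m = u") simp_all
qed

lemma mod_add_dvd: "(m :: nat) dvd h \<Longrightarrow> (x + v * h) mod m = x mod m"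
  by (metis dvd_mult mod_add_right_eq dvd_imp_mod_0 add.right_neutral)

lemma shift_inv_res_class:
  assumes "m dvd N" "m dvd h" "shift_inv A N h"
  shows "shift_inv (res_class A m u) N h"
  using assms mod_add_dvd[OF assms(2), of _ 1] by (simp add: shift_inv_def cnt_res_class)

lemma shift_inv_if_res_class:
  assumes "m > 0" "m dvd N" "m dvd h" "\<And>u. u < m \<Longrightarrow> shift_inv (res_class A m u) N h"
  shows "shift_inv A N h"
  unfolding shift_inv_def
proof
  fix x
  have "shift_inv (res_class A m (x mod m)) N h" using assms by simp
  then have "cnt (res_class A m (x mod m)) N (x + h) = cnt (res_class A m (x mod m)) N x"
    by (simp add: shift_inv_def)
  then show "cnt A N (x + h) = cnt A N x"
    using assms(2) mod_add_dvd[OF assms(3), of x 1] by (simp add: cnt_res_class)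
qed

lemma four_point_res_class:
  assumes "m dvd N" "m dvd h" "m dvd k" "four_point A N h k"
  shows "four_point (res_class A m u) N h k"
proof -
  have "(x + a * h + b * k) mod m = x mod m" "(x + a * h) mod m = x mod m" "(x + b * k) mod m = x mod m"
    for x a b using mod_add_dvd[OF assms(2)] mod_add_dvd[OF assms(3)] by simp_all
  then show ?thesis
    using assms(1,4) by (simp add: four_point_def cnt_res_class)
qed

lemma vanishes_if_res_class:
  assumes "finite A" "m > 0" "\<And>u. u < m \<Longrightarrow> vanishes (res_class A m u) s"
  shows "vanishes A s"
  unfolding vanishes_def
proof (intro allI impI)
  fix z assume z: "prim_root s z"
  have "esum A z = (\<Sum>u<m. esum (res_class A m u) z)"
    unfolding esum_def res_class_def using assms by (intro sum.group [symmetric]) auto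
  then show "esum A z = 0" using assms(3) z by (simp add: vanishes_def)
qed

section \<open>The attractor: interior, distinct expansions and zeros of the digit
  polynomial\<close>

subsection \<open>Finite digit expansions\<close>

locale digit_system =
  fixes b :: nat and D :: "nat set"
  assumes b_ge_2: "b \<ge> 2" and finite_D: "finite D" and card_D: "card D = b" and zero_D: "0 \<in> D"
begin

text \<open>The values D + b D + ... + b^(K-1) D of the digit strings of length K, as a plain set:
  coinciding sums are merged, which is how distinctness becomes a statement about
  cardinality.\<close>

primrec DK :: "nat \<Rightarrow> nat set" where
  "DK 0 = {0}"
| "DK (Suc K) = (\<lambda>(d, x). d + b * x) ` (D \<times> DK K)"

definition maxD :: nat where "maxD = Max D"

lemma le_maxD: "d \<in> D \<Longrightarrow> d \<le> maxD"
  unfolding maxD_def using finite_D by simp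

lemma b_pos: "b > 0"
  using b_ge_2 by simp

lemma finite_DK [simp]: "finite (DK K)"
  by (induction K) (auto simp: finite_D)

lemma zero_DK: "0 \<in> DK K"
  by (induction K) (force simp: zero_D)+

lemma DK_add: "DK (K + L) = (\<lambda>(x, y). x + b ^ K * y) ` (DK K \<times> DK L)"
proof (induction K)
  case 0
  then show ?case by force
next
  case (Suc K)
  have "DK (Suc K + L) = (\<lambda>(d, x). d + b * x) ` (D \<times> (\<lambda>(x, y). x + b ^ K * y) ` (DK K \<times> DK L))"
    using Suc by simp
  also have "\<dots> = (\<lambda>(x, y). x + b ^ Suc K * y) ` ((\<lambda>(d, x). d + b * x) ` (D \<times> DK K) \<times> DK L)"
    by (force simp: image_iff algebra_simps)
  finally show ?case by simp
qed

lemma DK_1: "DK 1 = D"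
  by force

lemma DK_addI: "x \<in> DK K \<Longrightarrow> y \<in> DK L \<Longrightarrow> x + b ^ K * y \<in> DK (K + L)"
  unfolding DK_add by force

text \<open>The bound maxD (b^K - 1), written without subtraction so that the induction
  closes.\<close>

lemma DK_le: "x \<in> DK K \<Longrightarrow> x + maxD \<le> maxD * b ^ K"
proof (induction K arbitrary: x)
  case (Suc K)
  then obtain d y where x: "x = d + b * y" "d \<in> D" "y \<in> DK K" by auto
  have "x + maxD \<le> 2 * maxD + b * y" using x le_maxD by fastforce
  also have "\<dots> \<le> b * (y + maxD)" using mult_le_mono1[OF b_ge_2, of maxD] by (simp add: algebra_simps)
  also have "\<dots> \<le> b * (maxD * b ^ K)" using Suc.IH[OF x(3)] by simp
  finally show ?case by (simp add: mult_ac)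
qed simp

lemma card_DK_le: "card (DK K) \<le> b ^ K"
proof (induction K)
  case (Suc K)
  have "card (DK (Suc K)) \<le> card (D \<times> DK K)"
    unfolding DK.simps by (rule card_image_le) (simp add: finite_D)
  also have "\<dots> \<le> b * b ^ K" using Suc by (simp add: card_cartesian_product card_D)
  finally show ?case by simp
qed simp

lemma card_DK_mult_le: "card (DK (j * K)) \<le> card (DK K) ^ j"
proof (induction j)
  case (Suc j)
  have "card (DK (K + j * K)) \<le> card (DK K \<times> DK (j * K))"
    unfolding DK_add by (rule card_image_le) simp
  also have "\<dots> \<le> card (DK K) * card (DK K) ^ j" using Suc by (simp add: card_cartesian_product)
  finally show ?case by simp
qed simp

lemma digit_sum_DK: "(\<And>i. i < j \<Longrightarrow> e i \<in> D) \<Longrightarrow> (\<Sum>i<j. b ^ i * e i) \<in> DK j"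
proof (induction j)
  case (Suc j)
  then have "(\<Sum>i<j. b ^ i * e i) + b ^ j * e j \<in> DK (j + 1)"
    by (intro DK_addI) (auto simp only: DK_1 less_Suc_eq)
  then show ?case by simp
qed simp

subsection \<open>The attractor\<close>

abbreviation tile :: "real set" where "tile \<equiv> self_affine_tile b D"

definition expansion :: "(nat \<Rightarrow> nat) \<Rightarrow> real" where
  "expansion d = (\<Sum>k. real (d k) / real b ^ Suc k)"

lemma tile_eq: "tile = expansion ` (PiE UNIV (\<lambda>_. D))"
  unfolding self_affine_tile_def expansion_def by (auto simp: PiE_UNIV_domain)

lemma tileE:
  assumes "t \<in> tile"
  obtains d where "\<And>k. d k \<in> D" "t = expansion d"
  using assms unfolding self_affine_tile_def expansion_def [symmetric] by blast

lemma expansion_in_tile: "(\<And>k. d k \<in> D) \<Longrightarrow> expansion d \<in> tile"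
  unfolding self_affine_tile_def expansion_def by blast

lemma summable_geometric_b: "summable (\<lambda>k. real maxD / real b ^ Suc k)"
proof -
  have "summable (\<lambda>k. (1 / real b) ^ k)" using b_ge_2 by (intro summable_geometric) auto
  then have "summable (\<lambda>k. real maxD / real b * (1 / real b) ^ k)" by (rule summable_mult)
  then show ?thesis by (simp add: power_divide)
qed

lemma summable_expansion:
  assumes "\<And>k. d k \<in> D"
  shows "summable (\<lambda>k. real (d k) / real b ^ Suc k)"
  by (rule summable_comparison_test'[OF summable_geometric_b, where N = 0])
    (use assms le_maxD in \<open>simp add: divide_right_mono\<close>)

lemma expansion_Cons:
  assumes "\<And>k. d k \<in> D"
  shows "real b * expansion d = real (d 0) + expansion (\<lambda>k. d (Suc k))"
proof -
  have "expansion d = real (d 0) / real b + (\<Sum>k. real (d (Suc k)) / real b ^ Suc (Suc k))"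
    unfolding expansion_def using suminf_split_head[OF summable_expansion[of d, OF assms]] by simp
  also have "(\<Sum>k. real (d (Suc k)) / real b ^ Suc (Suc k)) =
      (\<Sum>k. (1 / real b) * (real (d (Suc k)) / real b ^ Suc k))"
    by (simp add: mult_ac)
  also have "\<dots> = 1 / real b * expansion (\<lambda>k. d (Suc k))"
    unfolding expansion_def by (rule suminf_mult) (rule summable_expansion, rule assms)
  finally show ?thesis using b_pos by (simp add: field_simps)
qed

lemma tile_bounds: "t \<in> tile \<Longrightarrow> 0 \<le> t \<and> t \<le> real maxD"
proof -
  assume "t \<in> tile"
  then obtain d where d: "\<And>k. d k \<in> D" "t = expansion d" by (rule tileE) (rule that)
  have s: "summable (\<lambda>k. real (d k) / real b ^ Suc k)" using summable_expansion d(1) .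
  have "t \<le> (\<Sum>k. real maxD / real b ^ Suc k)"
    unfolding d(2) expansion_def using d(1) le_maxD
    by (intro suminf_le s summable_geometric_b) (simp add: divide_right_mono)
  also have "\<dots> \<le> (\<Sum>k. real maxD / 2 * (1 / 2) ^ k)"
  proof (rule suminf_le[OF _ summable_geometric_b])
    show "summable (\<lambda>k. real maxD / 2 * (1 / 2 :: real) ^ k)"
      by (intro summable_mult summable_geometric) simp
    fix k
    have "(2 :: real) ^ Suc k \<le> real b ^ Suc k" using b_ge_2 by (intro power_mono) auto
    then show "real maxD / real b ^ Suc k \<le> real maxD / 2 * (1 / 2) ^ k"
      using b_pos by (simp add: power_divide frac_le del: power_Suc flip: power_Suc)
  qed
  also have "\<dots> = real maxD" by (subst suminf_mult) (simp_all add: suminf_geometric summable_geometric)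
  finally have "t \<le> real maxD" .
  moreover have "0 \<le> t" unfolding d(2) expansion_def using s by (intro suminf_nonneg) auto
  ultimately show ?thesis by simp
qed

lemma tile_split1: "t \<in> tile \<Longrightarrow> \<exists>d\<in>D. \<exists>t'\<in>tile. real b * t = real d + t'"
proof -
  assume "t \<in> tile"
  then obtain d where d: "\<And>k. d k \<in> D" "t = expansion d" by (rule tileE) (rule that)
  have "real b * t = real (d 0) + expansion (\<lambda>k. d (Suc k))" unfolding d(2) by (rule expansion_Cons) (rule d(1))
  moreover have "expansion (\<lambda>k. d (Suc k)) \<in> tile" by (rule expansion_in_tile) (rule d(1))
  ultimately show ?thesis using d(1) by blast
qed

lemma tile_cons: "t \<in> tile \<Longrightarrow> d \<in> D \<Longrightarrow> (real d + t) / real b \<in> tile"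
proof -
  assume "t \<in> tile" "d \<in> D"
  from this(1) obtain e where e: "\<And>k. e k \<in> D" "t = expansion e" by (rule tileE) (rule that)
  define e' where "e' = (\<lambda>k. case k of 0 \<Rightarrow> d | Suc k \<Rightarrow> e k)"
  have e': "e' k \<in> D" for k using e \<open>d \<in> D\<close> by (auto simp: e'_def split: nat.split)
  have "real b * expansion e' = real d + t" using expansion_Cons[OF e'] e(2) by (simp add: e'_def)
  then have "(real d + t) / real b = expansion e'" using b_pos by (simp add: field_simps)
  then show ?thesis using expansion_in_tile[OF e'] by simp
qed

lemma tile_split: "t \<in> tile \<Longrightarrow> \<exists>x\<in>DK K. \<exists>t'\<in>tile. real b ^ K * t = real x + t'"
proof (induction K arbitrary: t)
  case (Suc K)
  from tile_split1[OF this(2)] obtain d t1 where 1: "d \<in> D" "t1 \<in> tile" "real b * t = real d + t1"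
    by (elim bexE) (rule that)
  from Suc.IH[OF 1(2)] obtain x t' where 2: "x \<in> DK K" "t' \<in> tile" "real b ^ K * t1 = real x + t'"
    by (elim bexE) (rule that)
  have "real b ^ Suc K * t = real b ^ K * (real b * t)" by simp
  also have "\<dots> = real (x + b ^ K * d) + t'" unfolding 1(3) using 2(3) by (simp add: distrib_left)
  finally have "real b ^ Suc K * t = real (x + b ^ K * d) + t'" .
  moreover have "x + b ^ K * d \<in> DK (Suc K)"
    using DK_addI[OF 2(1), of d 1] 1(1) by (simp only: DK_1 Suc_eq_plus1)
  ultimately show ?case using 2(2) by blast
qed simp

lemma zero_tile: "0 \<in> tile"
proof -
  have "expansion (\<lambda>_. 0) = 0" by (simp add: expansion_def)
  then show ?thesis using zero_D unfolding tile_eq by force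
qed

lemma DK_in_tile: "x \<in> DK K \<Longrightarrow> real x / real b ^ K \<in> tile"
proof (induction K arbitrary: x)
  case 0
  then show ?case using zero_tile by simp
next
  case (Suc K)
  then obtain y d where x: "x = y + b ^ K * d" "y \<in> DK K" "d \<in> D"
    using DK_add[of K 1] by (auto simp only: DK_1 Suc_eq_plus1 image_iff)
  have "real x / real b ^ Suc K = (real d + real y / real b ^ K) / real b"
    unfolding x(1) using b_pos by (simp add: field_simps)
  then show ?case using tile_cons[OF Suc.IH[OF x(2)] x(3)] by simp
qed

text \<open>The attractor is the image of the compact product space of digit sequences under
  \<open>expansion\<close>, which is a uniform limit of functions of finitely many digits.\<close>

lemma closed_tile: "closed tile"
proof -
  have "compact (PiE UNIV (\<lambda>_ :: nat. D))"
  proof -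
    have "compactin (product_topology (\<lambda>_. euclidean) UNIV) (PiE UNIV (\<lambda>_ :: nat. D))"
      by (subst compactin_PiE) (simp add: finite_D finite_imp_compact)
    then show ?thesis by (simp add: euclidean_product_topology)
  qed
  moreover have "continuous_on (PiE UNIV (\<lambda>_. D)) expansion"
    unfolding expansion_def
  proof (rule uniform_limit_theorem)
    show "uniform_limit (PiE UNIV (\<lambda>_. D)) (\<lambda>n d. \<Sum>k<n. real (d k) / real b ^ Suc k)
        (\<lambda>d. \<Sum>k. real (d k) / real b ^ Suc k) sequentially"
    proof (rule Weierstrass_m_test[OF _ summable_geometric_b])
      fix n d assume "d \<in> PiE UNIV (\<lambda>_ :: nat. D)"
      then have "d n \<in> D" by auto
      then show "norm (real (d n) / real b ^ Suc n) \<le> real maxD / real b ^ Suc n"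
        using le_maxD by (simp add: divide_right_mono)
    qed
    have "continuous_on UNIV (\<lambda>x :: nat. real x)"
      unfolding continuous_on_open_vimage[OF open_UNIV] by (simp add: open_discrete)
    then have cont: "continuous_on (PiE UNIV (\<lambda>_. D)) (\<lambda>d :: nat \<Rightarrow> nat. real (d k))" for k
      by (rule continuous_on_compose2)
        (rule continuous_on_subset[OF continuous_on_product_coordinates subset_UNIV], simp)
    show "\<forall>\<^sub>F n in sequentially. continuous_on (PiE UNIV (\<lambda>_. D)) (\<lambda>d. \<Sum>k<n. real (d k) / real b ^ Suc k)"
      using b_pos
      by (intro always_eventually allI continuous_on_sum continuous_on_divide cont continuous_on_const) auto
  qed simp
  ultimately have "compact tile" unfolding tile_eq by (rule compact_continuous_image[rotated])
  then show ?thesis by (rule compact_imp_closed)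
qed

subsection \<open>Interior and distinctness of expansions\<close>

lemma length_le_card_DK:
  assumes "{u..v} \<subseteq> tile" "u \<le> v"
  shows "(v - u) * real b ^ K \<le> real (card (DK K)) * real maxD"
proof -
  define I where "I = (\<lambda>x :: nat. {real x / real b ^ K .. (real x + real maxD) / real b ^ K})"
  have bK: "real b ^ K > 0" using b_pos by simp
  have "{u..v} \<subseteq> (\<Union>x\<in>DK K. I x)"
  proof
    fix t assume "t \<in> {u..v}"
    then obtain x t' where x: "x \<in> DK K" "t' \<in> tile" "real b ^ K * t = real x + t'"
      using tile_split assms(1) by blast
    have "t = (real x + t') / real b ^ K" using x(3) bK by (simp add: field_simps)
    then have "t \<in> I x" using tile_bounds[OF x(2)] bK by (auto simp: I_def divide_right_mono)
    then show "t \<in> (\<Union>x\<in>DK K. I x)" using x(1) by blast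
  qed
  moreover have "(\<Union>x\<in>DK K. I x) \<in> fmeasurable lborel"
    by (rule fmeasurable_compact) (auto intro!: compact_UN simp: I_def)
  ultimately have "measure lborel {u..v} \<le> measure lborel (\<Union>x\<in>DK K. I x)"
    by (intro measure_mono_fmeasurable) auto
  also have "\<dots> \<le> (\<Sum>x\<in>DK K. measure lborel (I x))"
    by (rule measure_UNION_le) (auto simp: I_def)
  also have "\<dots> = (\<Sum>x\<in>DK K. real maxD / real b ^ K)"
    using bK by (intro sum.cong) (auto simp: I_def divide_right_mono simp flip: diff_divide_distrib)
  finally show ?thesis using assms(2) bK by (simp add: field_simps)
qed

text \<open>A single coincidence at length K makes the ratio r = card (DK K) / b^K less than 1.
  Repeating it over j blocks covers the attractor by intervals of total length at most r^j maxD,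
  which tends to 0, whereas an interval inside the attractor keeps its length.\<close>

theorem card_DK_if_interior:
  assumes "interior tile \<noteq> {}"
  shows "card (DK K) = b ^ K"
proof (rule ccontr)
  assume "card (DK K) \<noteq> b ^ K"
  then have less: "card (DK K) < b ^ K" using card_DK_le[of K] by simp
  obtain t e where e: "e > 0" "cball t e \<subseteq> tile" using assms by (auto simp: mem_interior_cball)
  have sub: "{t - e..t + e} \<subseteq> tile" using e(2) by (simp add: cball_eq_atLeastAtMost)
  define r where "r = real (card (DK K)) / real b ^ K"
  have bK: "real b ^ K > 0" using b_pos by simp
  have "real (card (DK K)) < real b ^ K" using less by (metis of_nat_less_iff of_nat_power)
  then have r: "0 \<le> r" "r < 1" using bK by (auto simp: r_def)
  have bound: "2 * e \<le> r ^ j * real maxD" for j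
  proof -
    have "2 * e * real b ^ (j * K) \<le> real (card (DK (j * K))) * real maxD"
      using length_le_card_DK[OF sub, of "j * K"] e(1) by simp
    also have "\<dots> \<le> real (card (DK K) ^ j) * real maxD"
      using card_DK_mult_le[of j K] by (intro mult_right_mono) (simp_all only: of_nat_le_iff of_nat_0_le_iff)
    finally have "2 * e * (real b ^ K) ^ j \<le> real (card (DK K)) ^ j * real maxD"
      by (simp add: mult.commute flip: power_mult)
    then have "2 * e \<le> real (card (DK K)) ^ j * real maxD / (real b ^ K) ^ j"
      using bK by (simp add: pos_le_divide_eq)
    then show ?thesis by (simp add: r_def power_divide)
  qed
  have "(\<lambda>j. r ^ j * real maxD) \<longlonglongrightarrow> 0 * real maxD"
    using r by (intro tendsto_intros LIMSEQ_realpow_zero)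
  then have "2 * e \<le> 0 * real maxD" using bound by (intro LIMSEQ_le_const) auto
  then show False using e(1) by simp
qed

end

subsection \<open>Maximal sets with distinct translates\<close>

lemma upt_multiple_decomp:
  fixes b t :: nat
  assumes "b \<ge> 2" "t > 0"
  shows "\<exists>a m. t = b ^ a * m \<and> \<not> b dvd m"
  using assms(2)
proof (induction t rule: less_induct)
  case (less t)
  show ?case
  proof (cases "b dvd t")
    case False
    then show ?thesis by (intro exI[of _ 0] exI[of _ t]) simp
  next
    case True
    then obtain s where s: "t = b * s" by blast
    then have "s > 0" "s < t" using less.prems assms(1) by auto
    then obtain a m where "s = b ^ a * m" "\<not> b dvd m" using less.IH by blast
    then show ?thesis using s by (intro exI[of _ "Suc a"] exI[of _ m]) simp
  qed
qed

context digit_system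
begin

text \<open>A packing of translates of the set of all finite expansions, scaled by
  \<open>b ^ j\<close>. A largest packing at level 0 plays the part of a tiling complement; the
  other levels serve to compare residue classes modulo \<open>b ^ j\<close>.\<close>

definition direct :: "nat \<Rightarrow> nat set \<Rightarrow> bool" where
  "direct j A \<longleftrightarrow> finite A \<and> (\<forall>K. inj_on (\<lambda>(a, x). a + b ^ j * x) (A \<times> DK K))"

end

locale distinct_digit_system = digit_system +
  assumes card_DK: "\<And>K. card (DK K) = b ^ K"
begin

lemma inj_on_DK_add: "inj_on (\<lambda>(x, y). x + b ^ K * y) (DK K \<times> DK L)"
  by (rule eq_card_imp_inj_on)
    (simp_all add: card_DK card_cartesian_product power_add flip: DK_add)

lemma direct_0_singleton: "direct 0 {0}"
  by (auto simp: direct_def inj_on_def)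

text \<open>Once b^K exceeds every element of \<open>A\<close>, the b^K card A distinct sums lie in
  an interval holding at most (maxD + 1) b^K integers.\<close>

lemma card_direct_le:
  assumes "direct 0 A"
  shows "card A \<le> maxD + 1"
proof -
  have fin: "finite A" using assms by (simp add: direct_def)
  define c where "c = Max (insert 0 A)"
  have c: "a \<le> c" if "a \<in> A" for a using that fin by (simp add: c_def)
  define K where "K = Suc c"
  have "c < 2 ^ c" by (rule less_exp)
  also have "(2 :: nat) ^ c \<le> b ^ K"
  proof -
    have "(2 :: nat) ^ c \<le> b ^ c" using b_ge_2 by (rule power_mono) simp
    also have "\<dots> \<le> b ^ K" using b_pos by (simp add: K_def)
    finally show ?thesis .
  qed
  finally have cK: "Suc c \<le> b ^ K" by simp
  have "inj_on (\<lambda>(a, x). a + x) (A \<times> DK K)" using assms by (simp add: direct_def)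
  then have "card (A \<times> DK K) \<le> card {..c + maxD * b ^ K}"
  proof (rule card_inj_on_le)
    show "(\<lambda>(a, x). a + x) ` (A \<times> DK K) \<subseteq> {..c + maxD * b ^ K}"
      using c DK_le by (fastforce intro: add_mono)
  qed simp
  then have "card A * b ^ K \<le> Suc c + maxD * b ^ K" by (simp add: card_cartesian_product card_DK)
  also have "\<dots> \<le> (maxD + 1) * b ^ K" using cK by simp
  finally have "card A * b ^ K \<le> (maxD + 1) * b ^ K" .
  then show ?thesis using b_pos by (metis mult_le_cancel2 zero_less_power)
qed

lemma ex_max_direct: "\<exists>A. direct 0 A \<and> (\<forall>B. direct 0 B \<longrightarrow> card B \<le> card A)"
proof (rule ex_has_greatest_nat[where k = "{0}" and b = "maxD + 2"])
  show "\<forall>B. direct 0 B \<longrightarrow> card B < maxD + 2" using card_direct_le by fastforce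
qed (rule direct_0_singleton)

text \<open>Largest in cardinality, not merely maximal under inclusion: this gives the upper bound
  for every residue class, and hence equality in \<open>filled_uniform\<close>.\<close>

definition filler :: "nat set" where
  "filler = (SOME A. direct 0 A \<and> (\<forall>B. direct 0 B \<longrightarrow> card B \<le> card A))"

lemma direct_filler: "direct 0 filler" and card_le_filler: "direct 0 B \<Longrightarrow> card B \<le> card filler"
  using someI_ex[OF ex_max_direct] unfolding filler_def by blast+

lemma finite_filler: "finite filler"
  using direct_filler by (simp add: direct_def)

lemma card_filler_pos: "card filler > 0"
  using card_le_filler[OF direct_0_singleton] by simp

lemma inj_on_filler: "inj_on (\<lambda>(a, x). a + x) (filler \<times> DK K)"
  using direct_filler by (simp add: direct_def)

text \<open>Within one residue class modulo \<open>b ^ j\<close>, integer division by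
  \<open>b ^ j\<close> is injective and turns a packing of level j into one of level 0.\<close>

lemma direct_class_le:
  assumes "direct j B"
  shows "card {x \<in> B. x mod b ^ j = r} \<le> card filler"
proof -
  define C where "C = {x \<in> B. x mod b ^ j = r}"
  have finB: "finite B" using assms by (simp add: direct_def)
  have rec: "x = x div b ^ j * b ^ j + r" if "x \<in> C" for x
    using that div_mult_mod_eq[of x "b ^ j"] by (simp add: C_def)
  have inj: "inj_on (\<lambda>x. x div b ^ j) C"
    by (rule inj_onI) (metis rec)
  have "direct 0 ((\<lambda>x. x div b ^ j) ` C)"
    unfolding direct_def
  proof (intro conjI allI)
    show "finite ((\<lambda>x. x div b ^ j) ` C)" using finB by (simp add: C_def)
    fix K
    have "inj_on (\<lambda>(a, x). a + b ^ j * x) (B \<times> DK K)" using assms by (simp add: direct_def)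
    then have I: "x = x' \<and> y = y'"
      if "x + b ^ j * y = x' + b ^ j * y'" "x \<in> C" "x' \<in> C" "y \<in> DK K" "y' \<in> DK K" for x x' y y'
      using that unfolding inj_on_def C_def by fastforce
    show "inj_on (\<lambda>(a, x). a + b ^ 0 * x) ((\<lambda>x. x div b ^ j) ` C \<times> DK K)"
    proof (rule inj_onI, clarsimp)
      fix x y x' y'
      assume *: "x div b ^ j + y = x' div b ^ j + y'" "x \<in> C" "x' \<in> C" "y \<in> DK K" "y' \<in> DK K"
      have "x + b ^ j * y = b ^ j * (x div b ^ j + y) + r"
        using rec[OF *(2)] by (simp add: algebra_simps)
      also have "\<dots> = x' + b ^ j * y'"
        unfolding *(1) using rec[OF *(3)] by (simp add: algebra_simps)
      finally show "x div b ^ j = x' div b ^ j \<and> y = y'" using I * by blast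
    qed
  qed
  then have "card ((\<lambda>x. x div b ^ j) ` C) \<le> card filler" by (rule card_le_filler)
  then show ?thesis using card_image[OF inj] by (simp add: C_def)
qed

lemma card_by_class: "finite B \<Longrightarrow> card B = (\<Sum>r<b ^ j. card {x \<in> B. x mod b ^ j = r})"
  using b_pos by (subst sum.group [of B "{..<b ^ j}" "\<lambda>x. x mod b ^ j" "\<lambda>_. 1 :: nat", simplified, symmetric]) auto

lemma card_direct_level_le:
  assumes "direct j B"
  shows "card B \<le> card filler * b ^ j"
proof -
  have "card B = (\<Sum>r<b ^ j. card {x \<in> B. x mod b ^ j = r})"
    using assms by (intro card_by_class) (simp add: direct_def)
  also have "\<dots> \<le> (\<Sum>r<b ^ j. card filler)" by (intro sum_mono direct_class_le assms)
  finally show ?thesis by (simp add: mult.commute)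
qed

definition filled :: "nat \<Rightarrow> nat set" where
  "filled j = (\<lambda>(a, x). a + x) ` (filler \<times> DK j)"

lemma card_filled: "card (filled j) = card filler * b ^ j"
  unfolding filled_def using card_image[OF inj_on_filler]
  by (simp add: card_cartesian_product card_DK)

lemma finite_filled [simp]: "finite (filled j)"
  by (simp add: filled_def finite_filler)

lemma direct_filled: "direct j (filled j)"
  unfolding direct_def
proof (intro conjI allI)
  fix K
  show "inj_on (\<lambda>(a, x). a + b ^ j * x) (filled j \<times> DK K)"
  proof (rule inj_onI, clarsimp simp: filled_def)
    fix y y' a x a' x'
    assume *: "a + x + b ^ j * y = a' + x' + b ^ j * y'" "y \<in> DK K" "y' \<in> DK K"
      "a \<in> filler" "a' \<in> filler" "x \<in> DK j" "x' \<in> DK j"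
    have "(a, x + b ^ j * y) = (a', x' + b ^ j * y')"
      using * DK_addI by (intro inj_onD[OF inj_on_filler[of "j + K"]]) (auto simp: add.assoc)
    then have "a = a'" and e: "x + b ^ j * y = x' + b ^ j * y'" by auto
    have "(x, y) = (x', y')"
      using * e by (intro inj_onD[OF inj_on_DK_add[of j K]]) auto
    then show "a + x = a' + x' \<and> y = y'" using \<open>a = a'\<close> by simp
  qed
qed simp

lemma filled_uniform: "r < b ^ j \<Longrightarrow> card {x \<in> filled j. x mod b ^ j = r} = card filler"
proof -
  assume r: "r < b ^ j"
  have "(\<Sum>r<b ^ j. card {x \<in> filled j. x mod b ^ j = r}) = (\<Sum>r<b ^ j. card filler)"
    using card_by_class[of "filled j" j] by (simp add: card_filled mult.commute)
  then show ?thesis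
    using r direct_class_le[OF direct_filled]
      sum_mono_inv[of "\<lambda>r. card {x \<in> filled j. x mod b ^ j = r}" "{..<b ^ j}" "\<lambda>_. card filler" r]
    by auto
qed

text \<open>\<open>filled j\<close> already attains the largest cardinality of a packing of level j,
  so adjoining a new \<open>z\<close> creates a collision. The old elements do not collide among
  themselves, so the collision involves \<open>z\<close>.\<close>

lemma filler_extend: "\<exists>K. \<exists>d\<in>DK K. \<exists>a\<in>filler. \<exists>x\<in>DK (j + K). z + b ^ j * d = a + x"
proof (cases "z \<in> filled j")
  case True
  then show ?thesis by (intro exI[of _ 0]) (auto simp: filled_def)
next
  case False
  have "\<not> direct j (insert z (filled j))"
    using card_direct_level_le[of j "insert z (filled j)"] False by (auto simp: card_filled)
  then obtain K where "\<not> inj_on (\<lambda>(a, x). a + b ^ j * x) (insert z (filled j) \<times> DK K)"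
    by (auto simp: direct_def)
  then obtain s t where st: "s \<in> insert z (filled j) \<times> DK K" "t \<in> insert z (filled j) \<times> DK K"
    "(\<lambda>(a, x). a + b ^ j * x) s = (\<lambda>(a, x). a + b ^ j * x) t" "s \<noteq> t"
    unfolding inj_on_def by blast
  obtain u y u' y' where s: "s = (u, y)" and t: "t = (u', y')" by (metis surj_pair)
  have uy: "u \<in> insert z (filled j)" "u' \<in> insert z (filled j)"
    "y \<in> DK K" "y' \<in> DK K" "u + b ^ j * y = u' + b ^ j * y'" "(u, y) \<noteq> (u', y')"
    using st unfolding s t by simp_all
  have inj: "inj_on (\<lambda>(a, x). a + b ^ j * x) (filled j \<times> DK K)"
    using direct_filled by (simp add: direct_def)
  have "\<exists>d\<in>DK K. \<exists>v\<in>filled j. \<exists>d'\<in>DK K. z + b ^ j * d = v + b ^ j * d'"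
  proof -
    consider "u = z" "u' = z" | "u = z" "u' \<in> filled j" | "u \<in> filled j" "u' = z" | "u \<in> filled j" "u' \<in> filled j"
      using uy by blast
    then show ?thesis
    proof cases
      case 1
      then have "y = y'" using uy b_pos by simp
      then show ?thesis using 1 uy by simp
    next
      case 2
      then show ?thesis using uy by blast
    next
      case 3
      then have "z + b ^ j * y' = u + b ^ j * y" using uy by simp
      then show ?thesis using uy 3 by blast
    next
      case 4
      then have "(u, y) = (u', y')" using uy by (intro inj_onD[OF inj]) auto
      then show ?thesis using uy by simp
    qed
  qed
  then obtain d v d' where 1: "d \<in> DK K" "v \<in> filled j" "d' \<in> DK K" "z + b ^ j * d = v + b ^ j * d'" by blast
  then obtain a x where 2: "a \<in> filler" "x \<in> DK j" "v = a + x" by (auto simp: filled_def)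
  have "z + b ^ j * d = a + (x + b ^ j * d')" using 1 2 by simp
  then show ?thesis using 1 2 DK_addI by blast
qed

text \<open>Integers are brought in one at a time. The translation needed for the next one appends
  higher digits, and the earlier representations survive because the same digits can be appended to
  them.\<close>

theorem filler_window: "\<exists>K d. \<forall>w<L. \<exists>a\<in>filler. \<exists>x\<in>DK K. w + d = a + x"
proof (induction L)
  case (Suc L)
  then obtain K d where Kd: "\<And>w. w < L \<Longrightarrow> \<exists>a\<in>filler. \<exists>x\<in>DK K. w + d = a + x" by blast
  obtain M e a x where e: "e \<in> DK M" "a \<in> filler" "x \<in> DK (K + M)" "(L + d) + b ^ K * e = a + x"
    using filler_extend[of K "L + d"] by blast
  have "\<exists>a\<in>filler. \<exists>x\<in>DK (K + M). w + (d + b ^ K * e) = a + x" if w: "w < Suc L" for w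
  proof (cases "w = L")
    case True
    then show ?thesis using e by (intro bexI[of _ a] bexI[of _ x]) auto
  next
    case False
    then obtain a' x' where "a' \<in> filler" "x' \<in> DK K" "w + d = a' + x'" using Kd w by (meson less_SucE)
    then show ?thesis using DK_addI[OF _ e(1), of x' K]
      by (intro bexI[of _ a'] bexI[of _ "x' + b ^ K * e"]) auto
  qed
  then show ?case by blast
qed auto

subsection \<open>Kenyon's criterion\<close>

lemma esum_mult:
  assumes "inj_on (\<lambda>(x, y). x + c * y) (X \<times> Y)"
  shows "esum ((\<lambda>(x, y). x + c * y) ` (X \<times> Y)) z = esum X z * esum Y (z ^ c)"
proof -
  have "esum ((\<lambda>(x, y). x + c * y) ` (X \<times> Y)) z = (\<Sum>(x, y)\<in>X \<times> Y. z ^ x * (z ^ c) ^ y)"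
    unfolding esum_def using assms
    by (subst sum.reindex) (auto intro!: sum.cong simp: power_add power_mult)
  also have "\<dots> = esum X z * esum Y (z ^ c)"
    by (simp add: esum_def sum_product sum.cartesian_product)
  finally show ?thesis .
qed

lemma esum_DK: "esum (DK K) z = (\<Prod>k<K. esum D (z ^ b ^ k))"
proof (induction K)
  case (Suc K)
  have "esum (DK (K + 1)) z = esum (DK K) z * esum (DK 1) (z ^ b ^ K)"
    unfolding DK_add by (rule esum_mult[OF inj_on_DK_add])
  then show ?case using Suc unfolding DK_1 by (simp del: DK.simps)
qed (simp add: esum_def)

lemma esum_filled: "esum (filled j) z = esum filler z * (\<Prod>k<j. esum D (z ^ b ^ k))"
  using esum_mult[of 1 filler "DK j" z] inj_on_filler[of j] by (simp add: filled_def esum_DK)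

text \<open>\<open>filled j\<close> is equidistributed modulo b^j, so its sum at e(m / b^j) vanishes
  for m < b^j. The sum factors; as j grows the factor of \<open>filler\<close> tends to its
  cardinality, which is not 0, so eventually a factor coming from \<open>D\<close> must
  vanish.\<close>

theorem Kenyon_zero:
  assumes "m > 0"
  shows "\<exists>k\<ge>1. esum D (rou m (b ^ k)) = 0"
proof -
  have "(\<lambda>j. esum filler (rou m (b ^ j))) \<longlonglongrightarrow> esum filler (cis 0)"
  proof -
    have "(\<lambda>j. (1 / real b) ^ j) \<longlonglongrightarrow> 0" using b_ge_2 by (intro LIMSEQ_realpow_zero) auto
    then have "(\<lambda>j. 2 * pi * real m * (1 / real b) ^ j) \<longlonglongrightarrow> 2 * pi * real m * 0"
      by (rule tendsto_mult[OF tendsto_const])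
    moreover have "2 * pi * real m / real (b ^ j) = 2 * pi * real m * (1 / real b) ^ j" for j
      by (simp add: power_divide)
    ultimately have "(\<lambda>j. 2 * pi * real m / real (b ^ j)) \<longlonglongrightarrow> 0"
      by (simp only: mult_zero_right)
    then have "(\<lambda>j. cis (2 * pi * real m / real (b ^ j))) \<longlonglongrightarrow> cis 0"
      by (rule isCont_tendsto_compose[rotated]) (simp add: cis_conv_exp continuous_intros)
    then show ?thesis unfolding esum_def rou_def by (intro tendsto_sum tendsto_power)
  qed
  moreover have "esum filler (cis 0) \<noteq> 0" using card_filler_pos by (simp add: esum_def)
  ultimately have ev: "\<forall>\<^sub>F j in sequentially. esum filler (rou m (b ^ j)) \<noteq> 0"
    by (rule tendsto_imp_eventually_ne)
  have "\<forall>\<^sub>F j in sequentially. m < j" by (rule eventually_gt_at_top)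
  with ev have "\<forall>\<^sub>F j in sequentially. esum filler (rou m (b ^ j)) \<noteq> 0 \<and> m < j"
    by (rule eventually_conj)
  then obtain j where j: "esum filler (rou m (b ^ j)) \<noteq> 0" "m < j"
    using eventually_happens'[OF sequentially_bot] by blast
  have bj: "b ^ j > 0" using b_pos by simp
  have "j < 2 ^ j" by (rule less_exp)
  also have "(2 :: nat) ^ j \<le> b ^ j" using b_ge_2 by (rule power_mono) simp
  finally have "m < b ^ j" using j(2) by simp
  then have nd: "\<not> b ^ j dvd m" using assms nat_dvd_not_less by blast
  define s where "s = b ^ j div gcd m (b ^ j)"
  have s: "prim_root s (rou m (b ^ j))" unfolding s_def by (rule prim_root_rou[OF bj])
  have "s dvd b ^ j" unfolding s_def by (metis dvd_div_mult_self dvd_triv_left gcd_dvd2)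
  moreover have "\<not> s dvd 1" using s nd rou_eq_1_iff[OF bj, of m] prim_root_power_eq_1[OF s, of 1] by simp
  moreover have "shift_inv (filled j) (b ^ j) 1"
  proof -
    have "cnt (filled j) (b ^ j) x = card filler" for x
      using filled_uniform[of "x mod b ^ j" j] bj by (simp add: cnt_def cong_def)
    then show ?thesis by (simp add: shift_inv_def)
  qed
  ultimately have "vanishes (filled j) s" using shift_inv_iff[of "filled j" "b ^ j" 1] bj by auto
  then have "esum (filled j) (rou m (b ^ j)) = 0" using s by (simp add: vanishes_def)
  then have "(\<Prod>k<j. esum D (rou m (b ^ j) ^ b ^ k)) = 0" using j(1) by (simp add: esum_filled)
  then obtain k where k: "k < j" "esum D (rou m (b ^ j) ^ b ^ k) = 0" by auto
  have "rou m (b ^ j) ^ b ^ k = rou (m * b ^ k) (b ^ (j - k) * b ^ k)"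
    using k(1) by (simp add: rou_power flip: power_add)
  also have "\<dots> = rou m (b ^ (j - k))" using b_pos by (simp add: rou_cancel)
  finally show ?thesis using k by (intro exI[of _ "j - k"]) auto
qed

end

context digit_system
begin

definition digit_value :: "nat \<Rightarrow> (nat \<Rightarrow> nat) \<Rightarrow> nat" where
  "digit_value j e = (\<Sum>i<j. b ^ i * e i)"

lemma sum_digit_value:
  "(\<Sum>e\<in>PiE {..<j} (\<lambda>_. D). z ^ digit_value j e) = (\<Prod>i<j. esum D (z ^ b ^ i))"
  unfolding esum_def digit_value_def
  by (subst prod_sum_PiE) (simp_all add: finite_D power_sum power_mult)

lemma digit_value_fourier:
  fixes N x :: nat
  assumes "N > 0"
  shows "of_nat N * of_nat (card {e \<in> PiE {..<j} (\<lambda>_. D). [digit_value j e = x] (mod N)}) =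
    (\<Sum>t<N. inverse (rou t N) ^ x * (\<Prod>i<j. esum D (rou t N ^ b ^ i)))"
proof -
  have fin: "finite (PiE {..<j} (\<lambda>_. D))" by (simp add: finite_PiE finite_D)
  have "(\<Sum>t<N. inverse (rou t N) ^ x * (\<Prod>i<j. esum D (rou t N ^ b ^ i))) =
      (\<Sum>t<N. \<Sum>e\<in>PiE {..<j} (\<lambda>_. D). rou t N ^ digit_value j e * inverse (rou t N) ^ x)"
    unfolding sum_digit_value [symmetric] sum_distrib_left by (simp add: mult.commute)
  also have "\<dots> = (\<Sum>e\<in>PiE {..<j} (\<lambda>_. D). \<Sum>t<N. rou t N ^ digit_value j e * inverse (rou t N) ^ x)"
    by (rule sum.swap)
  also have "\<dots> = (\<Sum>e\<in>PiE {..<j} (\<lambda>_. D). if [digit_value j e = x] (mod N) then of_nat N else 0)"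
    by (simp only: sum_rou[OF assms])
  also have "\<dots> = (\<Sum>e\<in>{e \<in> PiE {..<j} (\<lambda>_. D). [digit_value j e = x] (mod N)}. of_nat N)"
    by (rule sum.inter_filter [symmetric]) (rule fin)
  finally show ?thesis by (simp add: mult.commute)
qed

text \<open>Write a frequency t as b^a m with m not divisible by \<open>b\<close>. For a < j - k0
  the zero belonging to m occurs among the j factors of the transform; for the remaining t the mode
  is invariant under \<open>b ^ k0\<close>. So the number of strings per residue has period
  \<open>b ^ k0\<close>, and it is positive at 0.\<close>

lemma DK_hits_multiples:
  assumes zero: "\<And>m. \<not> b dvd m \<Longrightarrow> \<exists>k\<ge>1. k \<le> k0 \<and> esum D (rou m (b ^ k)) = 0" and "k0 \<le> j"
  shows "\<exists>x\<in>DK j. [x = b ^ k0 * y] (mod b ^ j)"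
proof -
  define f where "f = (\<lambda>x. card {e \<in> PiE {..<j} (\<lambda>_. D). [digit_value j e = x] (mod b ^ j)})"
  have bj: "b ^ j > 0" using b_pos by simp
  have shift: "f (x + b ^ k0) = f x" for x
  proof -
    have "inverse (rou t (b ^ j)) ^ (x + b ^ k0) * (\<Prod>i<j. esum D (rou t (b ^ j) ^ b ^ i)) =
        inverse (rou t (b ^ j)) ^ x * (\<Prod>i<j. esum D (rou t (b ^ j) ^ b ^ i))" for t
    proof (cases "b ^ (j - k0) dvd t")
      case True
      then obtain c where c: "t = b ^ (j - k0) * c" by blast
      have "rou t (b ^ j) ^ b ^ k0 = rou (t * b ^ k0) (b ^ j)" by (rule rou_power)
      also have "t * b ^ k0 = b ^ j * c" using assms(2) c by (simp add: mult_ac flip: power_add)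
      finally have "rou t (b ^ j) ^ b ^ k0 = 1" using bj by (simp add: rou_eq_1_iff)
      then show ?thesis by (simp add: power_add power_inverse)
    next
      case False
      then have "t > 0" by (cases t) auto
      then obtain a m where am: "t = b ^ a * m" "\<not> b dvd m" using upt_multiple_decomp b_ge_2 by blast
      have a: "a < j - k0" using False am(1) by (metis dvd_triv_left le_imp_power_dvd dvd_trans not_less)
      obtain k where k: "k \<ge> 1" "k \<le> k0" "esum D (rou m (b ^ k)) = 0" using zero[OF am(2)] by blast
      define i where "i = j - a - k"
      have ij: "i < j" "a + i + k = j" using a k assms(2) by (auto simp: i_def)
      have "k + (a + i) = j" using ij(2) by simp
      then have bj': "b ^ j = b ^ k * b ^ (a + i)" by (metis power_add)
      have "rou t (b ^ j) ^ b ^ i = rou (m * b ^ (a + i)) (b ^ k * b ^ (a + i))"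
        unfolding rou_power am(1) bj' by (simp add: power_add mult_ac)
      also have "\<dots> = rou m (b ^ k)" using b_pos by (simp add: rou_cancel)
      finally have "esum D (rou t (b ^ j) ^ b ^ i) = 0" using k(3) by simp
      then have "(\<Prod>i<j. esum D (rou t (b ^ j) ^ b ^ i)) = 0" using ij(1) by auto
      then show ?thesis by simp
    qed
    then have "of_nat (b ^ j) * of_nat (f (x + b ^ k0)) = (of_nat (b ^ j) * of_nat (f x) :: complex)"
      unfolding f_def digit_value_fourier[OF bj] by (simp only:)
    then show ?thesis using bj unfolding mult_cancel_left of_nat_eq_iff of_nat_eq_0_iff by linarith
  qed
  have "(\<lambda>i\<in>{..<j}. 0) \<in> {e \<in> PiE {..<j} (\<lambda>_. D). [digit_value j e = 0] (mod b ^ j)}"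
    using zero_D by (auto simp: digit_value_def)
  then have ne: "{e \<in> PiE {..<j} (\<lambda>_. D). [digit_value j e = 0] (mod b ^ j)} \<noteq> {}" by (metis empty_iff)
  have "finite {e \<in> PiE {..<j} (\<lambda>_. D). [digit_value j e = 0] (mod b ^ j)}" by (simp add: finite_PiE finite_D)
  with ne have "f 0 > 0" unfolding f_def by (simp only: card_gt_0_iff simp_thms)
  then have pos: "f (y * b ^ k0) \<noteq> 0" using periodic_mult[of f "b ^ k0" 0 y, OF shift] by simp
  have "{e \<in> PiE {..<j} (\<lambda>_. D). [digit_value j e = y * b ^ k0] (mod b ^ j)} \<noteq> {}"
  proof
    assume "{e \<in> PiE {..<j} (\<lambda>_. D). [digit_value j e = y * b ^ k0] (mod b ^ j)} = {}"
    then show False using pos unfolding f_def by (simp only: card.empty)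
  qed
  then obtain e where e: "e \<in> PiE {..<j} (\<lambda>_. D)" "[digit_value j e = y * b ^ k0] (mod b ^ j)"
    by blast
  then have "digit_value j e \<in> DK j" unfolding digit_value_def by (intro digit_sum_DK) auto
  then show ?thesis using e(2) unfolding mult.commute[of "b ^ k0" y] by (rule bexI[rotated])
qed

lemma interior_finite_Union_empty:
  fixes F :: "'a \<Rightarrow> real set"
  assumes "finite I" "\<And>i. i \<in> I \<Longrightarrow> closed (F i) \<and> interior (F i) = {}"
  shows "interior (\<Union>i\<in>I. F i) = {}"
  using assms
proof (induction I rule: finite_induct)
  case (insert x I)
  have "closed (\<Union>i\<in>I. F i)" using insert by (intro closed_UN) auto
  then have "interior ((\<Union>i\<in>I. F i) \<union> F x) = interior (\<Union>i\<in>I. F i)"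
    using insert by (intro interior_closed_Un_empty_interior) auto
  then show ?case using insert by (simp add: Un_commute)
qed simp

text \<open>If the closed attractor had empty interior, finitely many integer translates would leave
  a hole in (0, 1). Yet some y / b^i in the hole differs by an integer from a finite expansion,
  which lies in the attractor.\<close>

theorem interior_if_zeros:
  assumes zero: "\<And>m. \<not> b dvd m \<Longrightarrow> \<exists>k\<ge>1. k \<le> k0 \<and> esum D (rou m (b ^ k)) = 0"
  shows "interior tile \<noteq> {}"
proof
  assume empty: "interior tile = {}"
  \<comment> \<open>Points of the attractor lie in [0, maxD], so only these translates can meet (0,
    1).\<close>
  define I where "I = {- int maxD - 1..1}"
  define C where "C = (\<Union>n\<in>I. (+) (real_of_int n) ` tile)"
  have "interior C = {}" unfolding C_def
    by (rule interior_finite_Union_empty)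
      (use empty closed_tile in \<open>auto simp: I_def closed_translation interior_translation\<close>)
  have "closed C" unfolding C_def I_def by (intro closed_UN) (auto simp: closed_translation closed_tile)
  then have "open ({0<..<1} - C)" by (intro open_Diff) auto
  moreover have "{0<..<1} - C \<noteq> {}"
  proof
    assume "{0<..<1} - C = {}"
    then have "{0<..<1} \<subseteq> interior C" by (intro interior_maximal) auto
    then show False using \<open>interior C = {}\<close> by auto
  qed
  ultimately obtain u e where u: "e > 0" "ball u e \<subseteq> {0<..<1} - C" by (metis ex_in_conv open_contains_ball)
  have bpos: "real b > 0" using b_pos by simp
  obtain i where i: "(1 / real b) ^ i < e" using u(1) b_ge_2 real_arch_pow_inv[of e "1 / real b"] by auto
  \<comment> \<open>With this length, b^k0 y / b^j is y / b^i, so hitting multiples of b^k0 reaches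
    every fraction with denominator b^i modulo 1.\<close>
  define j where "j = k0 + i"
  define y where "y = nat \<lfloor>u * real b ^ i\<rfloor>"
  have u01: "0 < u" "u < 1" using u by (auto simp: subset_iff dest!: spec[of _ u])
  have "real y \<le> u * real b ^ i" "u * real b ^ i < real y + 1"
    using u01 bpos by (auto simp: y_def of_nat_nat)
  then have yu: "\<bar>u - real y / real b ^ i\<bar> < e"
  proof -
    assume a: "real y \<le> u * real b ^ i" "u * real b ^ i < real y + 1"
    have bi: "real b ^ i > 0" using bpos by simp
    have "real y / real b ^ i \<le> u" using a(1) bi by (simp add: pos_divide_le_eq)
    moreover have "u < real y / real b ^ i + 1 / real b ^ i"
      using a(2) bi by (simp add: pos_less_divide_eq flip: add_divide_distrib)
    ultimately show ?thesis using i by (simp add: power_divide)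
  qed
  obtain x where x: "x \<in> DK j" "[x = b ^ k0 * y] (mod b ^ j)"
    using DK_hits_multiples[OF zero, of j y] by (auto simp: j_def)
  have "[int x = int (b ^ k0 * y)] (mod int (b ^ j))" using x(2) by (simp only: cong_int_iff)
  then obtain n where n: "int (b ^ k0 * y) = int x + int (b ^ j) * n"
    unfolding cong_iff_lin by blast
  have "real y / real b ^ i = real (b ^ k0 * y) / real b ^ j"
    using bpos by (simp add: j_def power_add)
  also have "real (b ^ k0 * y) = real x + real b ^ j * real_of_int n"
  proof -
    have "real (b ^ k0 * y) = real_of_int (int (b ^ k0 * y))" by simp
    also have "\<dots> = real x + real b ^ j * real_of_int n" unfolding n by simp
    finally show ?thesis .
  qed
  also have "\<dots> / real b ^ j = real_of_int n + real x / real b ^ j"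
    using bpos by (simp add: field_simps)
  finally have eq: "real y / real b ^ i = real_of_int n + real x / real b ^ j" .
  have xt: "real x / real b ^ j \<in> tile" using DK_in_tile[OF x(1)] .
  have "real y / real b ^ i \<in> ball u e" using yu by (simp add: dist_real_def)
  then have *: "real y / real b ^ i \<in> {0<..<1}" "real y / real b ^ i \<notin> C" using u(2) by blast+
  have "n \<in> I"
    using *(1) tile_bounds[OF xt] unfolding eq I_def by (simp, linarith)
  then show False using *(2) xt unfolding eq C_def by blast
qed

end

section \<open>Tilings of the integers with two relevant primes\<close>

subsection \<open>Periodic tilings of the integers\<close>

text \<open>\<open>g\<close> is the indicator function of the tiling complement, taken with integer
  values so that polynomials can act on it by convolution.\<close>

definition tiles_with :: "nat set \<Rightarrow> (int \<Rightarrow> int) \<Rightarrow> bool" where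
  "tiles_with D g \<longleftrightarrow> (\<forall>x. g x \<in> {0, 1}) \<and> (\<forall>x. (\<Sum>d\<in>D. g (x - int d)) = 1)"

definition periodic :: "int \<Rightarrow> (int \<Rightarrow> 'a) \<Rightarrow> bool" where
  "periodic M g \<longleftrightarrow> (\<forall>x. g (x + M) = g x)"

lemma periodic_add_mult:
  assumes "periodic M g"
  shows "g (x + k * M) = g x"
proof (induction k rule: int_induct[where k = 0])
  case (step1 i)
  have "x + (i + 1) * M = (x + i * M) + M" by (simp add: algebra_simps)
  then show ?case using assms step1 unfolding periodic_def by metis
next
  case (step2 i)
  have "x + i * M = (x + (i - 1) * M) + M" by (simp add: algebra_simps)
  then show ?case using assms step2 unfolding periodic_def by metis
qed simp

lemma periodic_mod: "periodic M g \<Longrightarrow> g (x mod M) = g x"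
  using periodic_add_mult[of M g "x mod M" "x div M"] by simp

lemma periodic_cong: "periodic M g \<Longrightarrow> [x = y] (mod M) \<Longrightarrow> g x = g y"
  by (metis periodic_mod cong_def)

lemma sum_periodic_shift:
  fixes M :: int
  assumes "periodic M g" "M > 0"
  shows "(\<Sum>x\<in>{0..<M}. g (x + c)) = (\<Sum>x\<in>{0..<M}. g x)"
proof (rule sum.reindex_bij_witness[of _ "\<lambda>x. (x - c) mod M" "\<lambda>x. (x + c) mod M"])
  fix x assume x: "x \<in> {0..<M}"
  show "((x + c) mod M - c) mod M = x" using x by (simp add: mod_diff_left_eq)
  show "((x - c) mod M + c) mod M = x" using x by (simp add: mod_add_left_eq)
  show "g ((x + c) mod M) = g (x + c)" by (rule periodic_mod[OF assms(1)])
qed (use assms(2) in auto)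

context distinct_digit_system
begin

lemma DK_mono1: "x \<in> DK K \<Longrightarrow> x \<in> DK (Suc K)"
  using DK_addI[of x K 0 1] zero_DK[of 1] by simp

lemma window_tiling:
  "\<exists>S :: int set. (\<forall>x. \<forall>d\<in>D. \<forall>e\<in>D. x - int d \<in> S \<longrightarrow> x - int e \<in> S \<longrightarrow> d = e) \<and>
     (\<forall>x. 0 \<le> x \<and> x < int L \<longrightarrow> (\<exists>d\<in>D. x - int d \<in> S))"
proof -
  obtain K t where Kt: "\<And>w. w < L \<Longrightarrow> \<exists>a\<in>filler. \<exists>x\<in>DK K. w + t = a + x"
    using filler_window[of L] by blast
  \<comment> \<open>A translate of filler + b (DK K). Adding \<open>D\<close> gives filler + DK (K +
    1), whose sums are distinct and which covers the window.\<close>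
  define S where "S = {z. \<exists>a\<in>filler. \<exists>y\<in>DK K. z + int t = int (a + b * y)}"
  have uniq: "d = e" if "d \<in> D" "e \<in> D" "x - int d \<in> S" "x - int e \<in> S" for x d e
  proof -
    obtain a y where 1: "a \<in> filler" "y \<in> DK K" "x - int d + int t = int (a + b * y)"
      using \<open>x - int d \<in> S\<close> by (auto simp: S_def)
    obtain a' y' where 2: "a' \<in> filler" "y' \<in> DK K" "x - int e + int t = int (a' + b * y')"
      using \<open>x - int e \<in> S\<close> by (auto simp: S_def)
    have "int (a + b * y) + int d = int (a' + b * y') + int e"
      unfolding 1(3) [symmetric] 2(3) [symmetric] by simp
    then have e: "a + (d + b * y) = a' + (e + b * y')" by linarith
    have m: "d + b * y \<in> DK (Suc K)" "e + b * y' \<in> DK (Suc K)" using 1 2 that by auto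
    have "(a, d + b * y) = (a', e + b * y')"
      using e m 1(1) 2(1) by (intro inj_onD[OF inj_on_filler[of "Suc K"]]) (auto simp del: DK.simps)
    then have "d + b * y = e + b * y'" by simp
    then have "(d, y) = (e, y')"
      using inj_on_DK_add[of 1 K] 1(2) 2(2) that(1,2) unfolding DK_1
      by (intro inj_onD[of "\<lambda>(x, y). x + b ^ 1 * y" "D \<times> DK K"]) auto
    then show "d = e" by simp
  qed
  have "\<exists>d\<in>D. x - int d \<in> S" if x: "0 \<le> x" "x < int L" for x
  proof -
    have "nat x < L" using x by simp
    then obtain a y where ay: "a \<in> filler" "y \<in> DK K" "nat x + t = a + y" using Kt by blast
    obtain d z where d: "d \<in> D" "z \<in> DK K" "y = d + b * z" using DK_mono1[OF ay(2)] by auto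
    have "x - int d + int t = int (a + b * z)" using ay(3) d(3) x(1) by linarith
    then show ?thesis using ay(1) d by (auto simp: S_def)
  qed
  then show ?thesis using uniq by blast
qed

text \<open>Pigeonhole: among 2^h + 1 blocks of length h two carry the same pattern of the
  complement, and the stretch between them can be repeated.\<close>

theorem ex_periodic_tiling: "\<exists>M g. M > 0 \<and> periodic M g \<and> tiles_with D g"
proof -
  \<comment> \<open>Whether x is covered depends only on the complement between x - maxD and x, so a
    block of length maxD + 1 determines how the tiling can be continued across it.\<close>
  define h where "h = maxD + 1"
  define L where "L = (2 ^ h + 2) * h"
  obtain S :: "int set" where
    uniq: "\<And>x d e. d \<in> D \<Longrightarrow> e \<in> D \<Longrightarrow> x - int d \<in> S \<Longrightarrow> x - int e \<in> S \<Longrightarrow> d = e"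
    and ex: "\<And>x. 0 \<le> x \<Longrightarrow> x < int L \<Longrightarrow> \<exists>d\<in>D. x - int d \<in> S"
    using window_tiling[of L] by metis
  define P where "P = (\<lambda>i. {u. u < h \<and> int (i * h) + int u \<in> S})"
  have "\<not> inj_on P {..2 ^ h}"
  proof
    assume "inj_on P {..2 ^ h}"
    then have "card {..(2 :: nat) ^ h} \<le> card (Pow {..<h})"
      by (rule card_inj_on_le) (auto simp: P_def)
    then show False by (simp add: card_Pow)
  qed
  then obtain i j where ij: "i < j" "j \<le> 2 ^ h" "P i = P j"
    unfolding inj_on_def by (metis atMost_iff linorder_neqE_nat)
  define t1 t2 where "t1 = int (i * h)" and "t2 = int (j * h)"
  define M where "M = t2 - t1"
  have "h \<ge> 1" by (simp add: h_def)
  have "(i + 1) * h \<le> j * h" using ij(1) by (intro mult_le_mono1) simp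
  then have "int ((i + 1) * h) \<le> int (j * h)" by (simp only: of_nat_le_iff)
  then have Mh: "M \<ge> int h" by (simp add: M_def t1_def t2_def algebra_simps)
  then have M: "M > 0" using \<open>h \<ge> 1\<close> by linarith
  define g :: "int \<Rightarrow> int" where "g = (\<lambda>x. if t1 + (x - t1) mod M \<in> S then 1 else 0)"
  have per: "periodic M g"
  proof -
    have "(x + M - t1) mod M = (x - t1) mod M" for x
    proof -
      have "x + M - t1 = (x - t1) + M" by simp
      then show ?thesis by (simp only: mod_add_self2)
    qed
    then show ?thesis by (simp add: periodic_def g_def)
  qed
  have shift: "x + M \<in> S \<longleftrightarrow> x \<in> S" if "t1 \<le> x" "x < t1 + int h" for x
  proof -
    define u where "u = nat (x - t1)"
    have u: "u < h" "x = t1 + int u" using that by (auto simp: u_def)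
    have "u \<in> P i \<longleftrightarrow> u \<in> P j" using ij(3) by simp
    then show ?thesis using u by (simp add: P_def t1_def t2_def M_def add_ac)
  qed
  have gS: "g x = (if x \<in> S then 1 else 0)" if "t1 \<le> x" "x < t2 + int h" for x
  proof (cases "x < t2")
    case True
    then have "(x - t1) mod M = x - t1" using that(1) by (simp add: M_def)
    then show ?thesis by (simp add: g_def)
  next
    case False
    have "(x - t1) mod M = (x - t1 - M) mod M" by (rule minus_mod_self2 [symmetric])
    also have "\<dots> = x - t1 - M" using False that Mh by (intro mod_pos_pos_trivial) (auto simp: M_def)
    finally have "t1 + (x - t1) mod M = x - M" by simp
    moreover have "x - M + M \<in> S \<longleftrightarrow> x - M \<in> S"
      using False that by (intro shift) (auto simp: M_def)
    ultimately show ?thesis by (simp add: g_def)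
  qed
  have base: "(\<Sum>d\<in>D. g (x - int d)) = 1" if x: "t1 + int h \<le> x" "x < t2 + int h" for x
  proof -
    have "t1 \<le> x - int d \<and> x - int d < t2 + int h" if "d \<in> D" for d
      using le_maxD[OF that] x by (simp add: h_def)
    then have "(\<Sum>d\<in>D. g (x - int d)) = (\<Sum>d\<in>D. if x - int d \<in> S then 1 else 0)"
      using gS by (intro sum.cong) auto
    also have "\<dots> = 1"
    proof -
      have "0 \<le> t1" by (simp add: t1_def)
      then have "0 \<le> x" using x(1) by linarith
      moreover have "x < int L"
      proof -
        have "j * h + h \<le> L" unfolding L_def add_mult_distrib using mult_le_mono1[OF ij(2), of h] by linarith
        then have "int (j * h) + int h \<le> int L" by (simp only: of_nat_add [symmetric] of_nat_le_iff)
        then show ?thesis using x(2) unfolding t2_def by linarith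
      qed
      ultimately have "\<exists>d\<in>D. x - int d \<in> S" by (rule ex)
      then obtain d where d: "d \<in> D" "x - int d \<in> S" ..
      have "(\<Sum>e\<in>D. if x - int e \<in> S then 1 else 0 :: int) = (\<Sum>e\<in>D. if e = d then 1 else 0)"
      proof (rule sum.cong)
        fix e assume "e \<in> D"
        then have "x - int e \<in> S \<longleftrightarrow> e = d" using uniq[OF _ d(1) _ d(2)] d(2) by blast
        then show "(if x - int e \<in> S then 1 else 0 :: int) = (if e = d then 1 else 0)" by simp
      qed simp
      then show ?thesis using d(1) finite_D by simp
    qed
    finally show ?thesis .
  qed
  have "(\<Sum>d\<in>D. g (x - int d)) = 1" for x
  proof -
    define y where "y = t1 + int h + (x - t1 - int h) mod M"
    have "[y = x] (mod M)"
    proof -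
      have "[(x - t1 - int h) mod M + (t1 + int h) = (x - t1 - int h) + (t1 + int h)] (mod M)"
        by (intro cong_add) (simp_all add: cong_def)
      then show ?thesis by (simp add: y_def add.commute)
    qed
    then have "g (y - int d) = g (x - int d)" for d
      by (intro periodic_cong[OF per] cong_diff) auto
    moreover have "(\<Sum>d\<in>D. g (y - int d)) = 1"
    proof (rule base)
      have "0 \<le> (x - t1 - int h) mod M" "(x - t1 - int h) mod M < M" using M by simp_all
      then show "t1 + int h \<le> y" "y < t2 + int h" using M_def unfolding y_def by linarith+
    qed
    ultimately show ?thesis by simp
  qed
  then have "tiles_with D g" by (simp add: tiles_with_def g_def)
  then show ?thesis using per M by blast
qed

end

subsection \<open>Tijdeman's theorem\<close>

text \<open>The variable of the polynomial acts as the translation by 1; by \<open>conv_mult\<close>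
  powers of a polynomial become iterated convolutions.\<close>

definition conv :: "int poly \<Rightarrow> (int \<Rightarrow> int) \<Rightarrow> int \<Rightarrow> int" where
  "conv f g x = (\<Sum>i\<le>degree f. coeff f i * g (x - int i))"

lemma conv_eq_sum:
  assumes "degree f \<le> n"
  shows "conv f g x = (\<Sum>i\<le>n. coeff f i * g (x - int i))"
  unfolding conv_def using assms
  by (intro sum.mono_neutral_left) (auto simp: coeff_eq_0)

lemma conv_pCons: "conv (pCons a f) g x = a * g x + conv f g (x - 1)"
proof -
  have "conv (pCons a f) g x = (\<Sum>i\<le>Suc (degree f). coeff (pCons a f) i * g (x - int i))"
    by (intro conv_eq_sum) (auto simp: degree_pCons_le)
  also have "\<dots> = a * g x + (\<Sum>i\<le>degree f. coeff f i * g (x - int (Suc i)))"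
    by (subst sum.atMost_Suc_shift) simp
  also have "(\<Sum>i\<le>degree f. coeff f i * g (x - int (Suc i))) = conv f g (x - 1)"
    by (simp add: conv_def algebra_simps)
  finally show ?thesis .
qed

lemma conv_0 [simp]: "conv 0 g x = 0"
  by (simp add: conv_def)

lemma conv_add: "conv (f + h) g x = conv f g x + conv h g x"
  by (induction f h arbitrary: x rule: poly_induct2) (auto simp: conv_pCons algebra_simps)

lemma conv_smult: "conv (smult c f) g x = c * conv f g x"
  by (induction f arbitrary: x) (auto simp: conv_pCons algebra_simps)

lemma conv_mult: "conv (f * h) g x = conv f (conv h g) x"
  by (induction f arbitrary: x) (auto simp: conv_pCons conv_add conv_smult)

lemma conv_monom: "conv (monom c n) g x = c * g (x - int n)"
  by (induction n arbitrary: x) (auto simp: monom_0 monom_Suc conv_pCons algebra_simps)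

lemma conv_sum: "conv (\<Sum>a\<in>A. f a) g x = (\<Sum>a\<in>A. conv (f a) g x)"
  by (induction A rule: infinite_finite_induct) (auto simp: conv_add)

lemma pcompose_monom_monom: "pcompose (monom 1 d) (monom 1 r) = monom (1 :: int) (r * d)"
  by (induction d) (auto simp: monom_0 monom_Suc pcompose_pCons mult_monom)

lemma sum_shifted_period:
  fixes g :: "int \<Rightarrow> int" and k :: nat
  assumes "periodic M g" "M > 0"
  shows "(\<Sum>x\<in>{0..<M}. \<Sum>d\<in>D. g (x - int (k * d))) = int (card D) * (\<Sum>x\<in>{0..<M}. g x)"
proof -
  have "(\<Sum>x\<in>{0..<M}. \<Sum>d\<in>D. g (x - int (k * d))) = (\<Sum>d\<in>D. \<Sum>x\<in>{0..<M}. g (x + (- int (k * d))))"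
    by (subst sum.swap) simp
  also have "\<dots> = (\<Sum>d\<in>D. \<Sum>x\<in>{0..<M}. g x)" by (simp only: sum_periodic_shift[OF assms])
  finally show ?thesis by simp
qed

lemma tiles_with_count:
  assumes "periodic M g" "M > 0" "tiles_with D g"
  shows "int (card D) * (\<Sum>x\<in>{0..<M}. g x) = M"
  using sum_shifted_period[OF assms(1,2), where k = 1 and D = D] assms(2,3) by (simp add: tiles_with_def)

text \<open>Modulo r the r-th power of P(X) is P(X^r). Applied to \<open>g\<close> it gives (card
  D)^(r-1), which is 1 modulo r by Fermat. So the number of representations of each integer is
  congruent to 1, hence at least 1; its average over a period is 1, so it is always 1.\<close>

lemma tiles_with_prime_multiple:
  assumes "finite D" "periodic M g" "M > 0" "tiles_with D g" "prime r" "\<not> r dvd card D"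
  shows "tiles_with ((\<lambda>d. r * d) ` D) g"
proof -
  define P :: "int poly" where "P = (\<Sum>d\<in>D. monom 1 d)"
  have r0: "r > 0" using assms(5) prime_gt_0_nat by blast
  obtain G where G: "P ^ r = pcompose P (monom 1 r) + of_nat r * G" using frobenius_int_poly[OF assms(5)] by blast
  have convP: "conv P f x = (\<Sum>d\<in>D. f (x - int d))" for f x
    by (simp add: P_def conv_sum conv_monom)
  have pow: "conv (P ^ Suc n) g x = int (card D) ^ n" for n x
  proof (induction n arbitrary: x)
    case 0
    then show ?case using assms(4) by (simp add: convP tiles_with_def)
  next
    case (Suc n)
    have "conv (P ^ Suc (Suc n)) g x = conv P (conv (P ^ Suc n) g) x"
      by (simp add: conv_mult)
    then show ?case using Suc by (simp add: convP)
  qed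
  define s where "s = (\<lambda>x. \<Sum>d\<in>D. g (x - int (r * d)))"
  have s_eq: "int (card D) ^ (r - 1) = s x + int r * conv G g x" for x
  proof -
    have "int (card D) ^ (r - 1) = conv (P ^ r) g x" using pow[of "r - 1" x] r0 by simp
    also have "\<dots> = conv (pcompose P (monom 1 r)) g x + int r * conv G g x"
      unfolding G by (simp add: conv_add of_nat_poly conv_smult)
    also have "conv (pcompose P (monom 1 r)) g x = s x"
      by (simp add: P_def pcompose_sum pcompose_monom_monom conv_sum conv_monom s_def)
    finally show ?thesis .
  qed
  have fd: "int r dvd int (card D) ^ (r - 1) - 1"
  proof -
    have "int r dvd int (card D) ^ r - int (card D)" by (rule fermat_int[OF assms(5)])
    also have "int (card D) ^ r - int (card D) = int (card D) * (int (card D) ^ (r - 1) - 1)"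
      using r0 by (cases r) (auto simp: algebra_simps)
    finally show ?thesis using assms(5,6) by (metis int_dvd_int_iff prime_dvd_mult_iff prime_nat_int_transfer)
  qed
  have dv: "int r dvd s x - 1" for x
  proof -
    have "int r dvd (int (card D) ^ (r - 1) - 1) - int r * conv G g x"
      using dvd_diff[OF fd dvd_triv_left] .
    also have "(int (card D) ^ (r - 1) - 1) - int r * conv G g x = s x - 1" using s_eq[of x] by linarith
    finally show ?thesis .
  qed
  have g01: "g x \<ge> 0" for x
  proof -
    have "g x = 0 \<or> g x = 1" using assms(4) by (simp add: tiles_with_def)
    then show ?thesis by auto
  qed
  have s0: "s x \<ge> 1" for x
  proof (rule ccontr)
    assume "\<not> s x \<ge> 1"
    moreover have "s x \<ge> 0" unfolding s_def using g01 by (intro sum_nonneg) auto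
    ultimately have "s x = 0" by simp
    then have "int r dvd - 1" using dv[of x] by simp
    then show False using prime_gt_1_nat[OF assms(5)] by simp
  qed
  have per: "periodic M s"
  proof -
    have "g (x + M - int (r * d)) = g (x - int (r * d))" for x d
      using assms(2)[unfolded periodic_def, rule_format, of "x - int (r * d)"] by (simp add: algebra_simps)
    then show ?thesis unfolding s_def periodic_def by (simp only:) simp
  qed
  have "(\<Sum>x\<in>{0..<M}. s x) = M"
    unfolding s_def sum_shifted_period[OF assms(2,3)] by (rule tiles_with_count[OF assms(2,3,4)])
  then have "(\<Sum>x\<in>{0..<M}. s x - 1) = 0" using assms(3) by (simp add: sum_subtractf)
  moreover have "(\<Sum>x\<in>{0..<M}. s x - 1) = 0 \<longleftrightarrow> (\<forall>x\<in>{0..<M}. s x - 1 = 0)"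
  proof (rule sum_nonneg_eq_0_iff)
    show "0 \<le> s x - 1" for x using s0[of x] by linarith
  qed simp
  ultimately have z: "\<forall>x\<in>{0..<M}. s x - 1 = 0" by simp
  have s1: "s x = 1" for x
    using bspec[OF z, of "x mod M"] periodic_mod[OF per, of x] assms(3) by simp
  have inj: "inj_on (\<lambda>d. r * d) D" using r0 by (simp add: inj_on_def)
  then show ?thesis using s1 assms(4) unfolding tiles_with_def s_def by (simp add: sum.reindex)
qed

theorem tiles_with_coprime_multiple:
  assumes "finite D" "periodic M g" "M > 0" "tiles_with D g" "r > 0" "coprime r (card D)"
  shows "tiles_with ((\<lambda>d. r * d) ` D) g"
  using assms(5,6)
proof (induction r rule: less_induct)
  case (less r)
  show ?case
  proof (cases "r = 1")
    case True
    then show ?thesis using assms(4) by simp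
  next
    case False
    then obtain q where q: "prime q" "q dvd r" using prime_factor_nat by blast
    then obtain l where l: "r = q * l" by blast
    have "l > 0" "l < r" using less.prems l prime_gt_1_nat[OF q(1)] by auto
    have cop: "coprime q (card D)" "coprime l (card D)" using less.prems l by auto
    have IH: "tiles_with ((\<lambda>d. l * d) ` D) g" using less.IH \<open>l > 0\<close> \<open>l < r\<close> cop by blast
    have c: "card ((\<lambda>d. l * d) ` D) = card D" using \<open>l > 0\<close> by (intro card_image) (simp add: inj_on_def)
    have "\<not> q dvd card D" using cop(1) q(1) by (metis coprime_absorb_left not_prime_unit)
    then have "tiles_with ((\<lambda>d. q * d) ` (\<lambda>d. l * d) ` D) g"
      using assms IH q(1) c by (intro tiles_with_prime_multiple[of "(\<lambda>d. l * d) ` D" M g q]) auto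
    then show ?thesis by (simp add: image_image l mult.assoc)
  qed
qed

subsection \<open>Tilings with period divisible by two primes\<close>

text \<open>Differences within \<open>r * D\<close> are multiples of r, so the tiling restricts to
  the multiples of r, where dividing by r gives back \<open>D\<close>.\<close>

lemma tiles_with_rescale:
  assumes "finite D" "tiles_with ((\<lambda>d. r * d) ` D) g" "r > 0"
  shows "tiles_with D (\<lambda>y. g (int r * y))"
proof -
  have inj: "inj_on (\<lambda>d. r * d) D" using assms(3) by (simp add: inj_on_def)
  have "(\<Sum>d\<in>D. g (int r * (y - int d))) = 1" for y
    using assms(2) inj unfolding tiles_with_def
    by (simp add: sum.reindex right_diff_distrib)
  then show ?thesis using assms(2) by (simp add: tiles_with_def)
qed

text \<open>Comparing \<open>x1\<close> or \<open>x2\<close> with 0 fails only when q divides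
  \<open>x1\<close> and p divides \<open>x2\<close>, and then \<open>x1 - x2\<close> works.\<close>

lemma ex_diff_not_dvd:
  fixes X :: "int set"
  assumes "0 \<in> X" "x1 \<in> X" "\<not> p dvd x1" "x2 \<in> X" "\<not> q dvd x2"
  shows "\<exists>x\<in>X. \<exists>y\<in>X. \<not> p dvd x - y \<and> \<not> q dvd x - y"
proof -
  consider "\<not> q dvd x1" | "\<not> p dvd x2" | "q dvd x1" "p dvd x2" by blast
  then show ?thesis
  proof cases
    case 1
    then show ?thesis using assms by (intro bexI[of _ x1] bexI[of _ 0]) auto
  next
    case 2
    then show ?thesis using assms by (intro bexI[of _ x2] bexI[of _ 0]) auto
  next
    case 3
    have "\<not> p dvd x1 - x2" using assms(3) 3(2) by (metis dvd_add diff_add_cancel)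
    moreover have "\<not> q dvd x1 - x2" using assms(5) 3(1) by (metis dvd_diff diff_diff_eq2 add_diff_cancel_left')
    ultimately show ?thesis using assms by (intro bexI[of _ x1] bexI[of _ x2]) auto
  qed
qed

lemma ex_not_dvd_if_Gcd_1:
  assumes "Gcd D = (1 :: nat)" "prime p"
  shows "\<exists>d\<in>D. \<not> p dvd d"
proof (rule ccontr)
  assume "\<not> ?thesis"
  then have "p dvd Gcd D" by (intro Gcd_greatest) auto
  then show False using assms by simp
qed

text \<open>
  Two differences coprime to the period, one of \<open>D\<close> and one of the complement, can be matched by
  multiplying \<open>D\<close> with a unit, which preserves the tiling by Tijdeman's theorem.
\<close>

lemma tiles_with_no_common_unit:
  assumes D: "finite D" "tiles_with D g" "periodic (int M) g" "M > 0" "\<And>r. coprime r M \<Longrightarrow> coprime r (card D)"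
    and dd: "d \<in> D" "d' \<in> D" "coprime (int d' - int d) (int M)"
    and xy: "g x = 1" "g y = 1" "coprime (x - y) (int M)" and M1: "M > 1"
  shows False
proof -
  obtain s where s: "[(int d' - int d) * s = 1] (mod int M)"
    using cong_solve_coprime_int[OF dd(3)] by blast
  define r where "r = nat ((s * (x - y)) mod int M)"
  have r: "int r = (s * (x - y)) mod int M" using assms(4) by (simp add: r_def)
  have "[int r * (int d' - int d) = (s * (x - y)) * (int d' - int d)] (mod int M)"
    unfolding r by (intro cong_mult) (simp_all add: cong_def)
  also have "(s * (x - y)) * (int d' - int d) = ((int d' - int d) * s) * (x - y)" by (simp add: mult_ac)
  also have "[\<dots> = 1 * (x - y)] (mod int M)" using s by (intro cong_mult) simp_all
  finally have rv: "[int r * (int d' - int d) = x - y] (mod int M)" by simp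
  have "coprime (int r * (int d' - int d)) (int M)"
    using xy(3) cong_imp_coprime[OF cong_sym[OF rv]] by simp
  then have "coprime (int r) (int M)" by simp
  then have cr: "coprime r M" by simp
  have "r > 0" using cr M1 by (cases r) auto
  have "tiles_with ((\<lambda>d. r * d) ` D) g"
    using assms \<open>r > 0\<close> cr by (intro tiles_with_coprime_multiple[where M = "int M"]) auto
  then have "(\<Sum>e\<in>(\<lambda>d. r * d) ` D. g (x + int (r * d) - int e)) = 1" by (simp add: tiles_with_def)
  moreover have "inj_on (\<lambda>d. r * d) D" using \<open>r > 0\<close> by (simp add: inj_on_def)
  ultimately have sum: "(\<Sum>e\<in>D. g (x + int (r * d) - int (r * e))) = 1" by (simp add: sum.reindex)
  have ne: "d \<noteq> d'" using dd(3) M1 by auto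
  have "g (x + int (r * d) - int (r * d')) = 1"
  proof -
    have "[x + int (r * d) - int (r * d') = x - int r * (int d' - int d)] (mod int M)"
      by (simp add: algebra_simps)
    also have "[x - int r * (int d' - int d) = x - (x - y)] (mod int M)"
      using rv by (intro cong_diff) simp_all
    finally show ?thesis using periodic_cong[OF D(3)] xy(2) by simp
  qed
  then have "(\<Sum>e\<in>{d, d'}. g (x + int (r * d) - int (r * e))) = 2" using ne xy(1) by simp
  moreover have "(\<Sum>e\<in>{d, d'}. g (x + int (r * d) - int (r * e))) \<le> (\<Sum>e\<in>D. g (x + int (r * d) - int (r * e)))"
  proof (rule sum_mono2)
    fix e
    have "g (x + int (r * d) - int (r * e)) = 0 \<or> g (x + int (r * d) - int (r * e)) = 1"
      using D(2) by (simp add: tiles_with_def)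
    then show "0 \<le> g (x + int (r * d) - int (r * e))" by auto
  qed (use D dd in auto)
  ultimately show False using sum by simp
qed

text \<open>A form of Sands' theorem on factorizations when the period has only two prime divisors:
  one of the two factors lies in a proper subgroup. As \<open>D\<close> contains 0 and has gcd 1, it
  must be the complement.\<close>

theorem two_prime_tiling:
  assumes p: "prime p" and q: "prime q" and pq: "p \<noteq> q"
    and D: "finite D" "card D = p ^ 2 * q" "0 \<in> D" "Gcd D = 1"
    and ex: "\<exists>M g. M > 0 \<and> periodic M g \<and> tiles_with D g"
  shows "\<exists>a c g. periodic (int (p ^ a * q ^ c)) g \<and> tiles_with D g \<and>
     ((\<forall>y. g y = 1 \<longrightarrow> int p dvd y) \<or> (\<forall>y. g y = 1 \<longrightarrow> int q dvd y))"
proof -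
  obtain M0 :: int and g0 where M0: "M0 > 0" "periodic M0 g0" "tiles_with D g0" using ex by blast
  define M where "M = nat M0"
  have M: "M > 0" "periodic (int M) g0" using M0 by (simp_all add: M_def)
  define a where "a = multiplicity p M"
  define c where "c = multiplicity q M"
  obtain M1 where M1: "M = p ^ a * M1" "\<not> p dvd M1"
    using multiplicity_decompose'[of M p] p M(1) unfolding a_def by (metis not_prime_unit not_gr_zero)
  have "M1 > 0" using M1 M(1) by (cases M1) auto
  have "multiplicity q M = multiplicity q M1"
    unfolding M1(1) using p q pq \<open>M1 > 0\<close>
    by (subst prime_elem_multiplicity_mult_distrib) (auto simp: prime_multiplicity_other multiplicity_distinct_prime_power)
  then obtain r where r: "M1 = q ^ c * r" "\<not> q dvd r"
    using multiplicity_decompose'[of M1 q] q \<open>M1 > 0\<close> unfolding c_def by (metis not_prime_unit not_gr_zero)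
  have r0: "r > 0" using r \<open>M1 > 0\<close> by (cases r) auto
  have pr: "\<not> p dvd r" using M1(2) r(1) by auto
  define N where "N = p ^ a * q ^ c"
  have MN: "M = N * r" by (simp add: M1 r N_def mult.assoc)
  have N0: "N > 0" using M(1) MN by simp
  have cop: "coprime r (card D)"
    unfolding D(2) using pr r(2) p q by (simp add: coprime_commute prime_imp_coprime)
  \<comment> \<open>Multiplying \<open>D\<close> by the part \<open>r\<close> of the period that is
    coprime to p q, and then keeping only multiples of \<open>r\<close>, leaves the period
    N.\<close>
  have "tiles_with ((\<lambda>d. r * d) ` D) g0"
    using D(1) M M0 r0 cop by (intro tiles_with_coprime_multiple[where M = M0]) auto
  then have t1: "tiles_with D (\<lambda>y. g0 (int r * y))" by (rule tiles_with_rescale[OF D(1) _ r0])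
  have p1: "periodic (int N) (\<lambda>y. g0 (int r * y))"
    using M(2) unfolding periodic_def MN by (simp add: distrib_left mult.commute)
  have "\<exists>z. g0 (int r * z) = 1"
  proof (rule ccontr)
    assume "\<not> ?thesis"
    then have "g0 (int r * (0 - int d)) = 0" for d using t1 unfolding tiles_with_def by blast
    then have "(\<Sum>d\<in>D. g0 (int r * (0 - int d))) = 0" by (simp only: sum.neutral_const)
    moreover have "(\<Sum>d\<in>D. g0 (int r * (0 - int d))) = 1" using t1 unfolding tiles_with_def by blast
    ultimately show False by simp
  qed
  then obtain z where z: "g0 (int r * z) = 1" ..
  \<comment> \<open>Translated so that 0 belongs to the complement, as the argument with differences
    requires.\<close>
  define g where "g = (\<lambda>y. g0 (int r * (y + z)))"
  have gt: "tiles_with D g"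
    using t1 unfolding tiles_with_def g_def by (simp add: diff_add_eq)
  have gp: "periodic (int N) g" using p1 unfolding periodic_def g_def by (metis add.assoc add.commute)
  have g0: "g 0 = 1" using z by (simp add: g_def)
  have cardN: "card D dvd N"
  proof -
    have "int (card D) * (\<Sum>x\<in>{0..<int N}. g x) = int N" using N0 by (intro tiles_with_count gp gt) simp
    then show ?thesis by (metis dvd_triv_left int_dvd_int_iff)
  qed
  have pN: "p dvd N" "q dvd N" using cardN D(2) by (auto intro: dvd_trans[OF _ cardN])
  have unit: "coprime u (int N)" if "\<not> int p dvd u" "\<not> int q dvd u" for u
  proof -
    have "coprime (int p) u" "coprime (int q) u"
      using that p q by (auto intro!: prime_imp_coprime)
    then show ?thesis by (simp add: N_def coprime_commute[of u])
  qed
  have "\<exists>d\<in>int ` D. \<exists>d'\<in>int ` D. \<not> int p dvd d - d' \<and> \<not> int q dvd d - d'"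
  proof -
    obtain d1 d2 where "d1 \<in> D" "\<not> p dvd d1" "d2 \<in> D" "\<not> q dvd d2"
      using ex_not_dvd_if_Gcd_1[OF D(4)] p q by blast
    then show ?thesis using D(3) by (intro ex_diff_not_dvd[of _ "int d1" _ "int d2"]) auto
  qed
  then obtain d d' where d: "d \<in> D" "d' \<in> D" "coprime (int d' - int d) (int N)" using unit by blast
  have "(\<forall>y. g y = 1 \<longrightarrow> int p dvd y) \<or> (\<forall>y. g y = 1 \<longrightarrow> int q dvd y)"
  proof (rule ccontr)
    assume "\<not> ?thesis"
    then obtain y1 y2 where "g y1 = 1" "\<not> int p dvd y1" "g y2 = 1" "\<not> int q dvd y2" by blast
    then have "\<exists>x\<in>{y. g y = 1}. \<exists>y\<in>{y. g y = 1}. \<not> int p dvd x - y \<and> \<not> int q dvd x - y"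
      using g0 by (intro ex_diff_not_dvd[of _ y1 _ y2]) auto
    then obtain x y where xy: "g x = 1" "g y = 1" "coprime (x - y) (int N)" using unit by blast
    have "p \<le> N" using pN N0 by (simp add: dvd_imp_le)
    then have "N > 1" using prime_gt_1_nat[OF p] by linarith
    moreover have "coprime s (card D)" if "coprime s N" for s
      using coprime_divisors[OF dvd_refl cardN that] .
    ultimately show False
      using tiles_with_no_common_unit[OF D(1) gt gp N0 _ d xy] by blast
  qed
  then show ?thesis using gp gt unfolding N_def by blast
qed

subsection \<open>Consequences of the tiling for vanishing\<close>

lemma shift_invD:
  assumes "shift_inv A N h" "finite A" "N > 0" "s dvd N" "\<not> s dvd h"
  shows "vanishes A s"
  using shift_inv_iff[OF assms(2,3), of h] assms(1,4,5) by simp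

text \<open>Since the complement consists of multiples of r, the integers congruent to w are tiled
  by the class w of \<open>D\<close> alone. This is the transform of that tiling over one
  period.\<close>

lemma class_convolution:
  fixes z :: complex and g :: "int \<Rightarrow> int"
  assumes D: "finite D" "tiles_with D g" "periodic (int N) g" and N: "N > 0" "r dvd N" "w < r"
    and z: "z ^ N = 1" and supp: "\<And>y. g y = 1 \<Longrightarrow> int r dvd y"
  shows "(\<Sum>x\<in>{0..<int N}. if int r dvd x - int w then z powi x else 0) =
    esum (res_class D r w) z * (\<Sum>x\<in>{0..<int N}. of_int (g x) * z powi x)"
proof -
  have z0: "z \<noteq> 0" using z N(1) by (auto simp: power_0_left)
  have zN: "z powi (x + int N) = z powi x" for x
    using z0 z by (simp add: power_int_add)
  define G where "G = (\<lambda>x. of_int (g x) * z powi x)"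
  have perG: "periodic (int N) G"
    using D(3) zN by (simp add: periodic_def G_def)
  have shift: "(\<Sum>x\<in>{0..<int N}. of_int (g (x - int d)) * z powi x) = z ^ d * sum G {0..<int N}" for d
  proof -
    have "(\<Sum>x\<in>{0..<int N}. of_int (g (x - int d)) * z powi x) = (\<Sum>x\<in>{0..<int N}. z ^ d * G (x + - int d))"
    proof (rule sum.cong)
      fix x
      have "z powi x = z powi (int d + (x - int d))" by simp
      also have "\<dots> = z ^ d * z powi (x - int d)" using z0 by (subst power_int_add) auto
      finally show "of_int (g (x - int d)) * z powi x = z ^ d * G (x + - int d)"
        by (simp add: G_def)
    qed simp
    also have "\<dots> = z ^ d * (\<Sum>x\<in>{0..<int N}. G (x + - int d))" by (rule sum_distrib_left [symmetric])
    also have "(\<Sum>x\<in>{0..<int N}. G (x + - int d)) = sum G {0..<int N}"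
      using N(1) by (intro sum_periodic_shift[OF perG]) simp
    finally show ?thesis .
  qed
  have g01: "g y = 0 \<or> g y = 1" for y using D(2) by (simp add: tiles_with_def)
  have "(\<Sum>x\<in>{0..<int N}. if int r dvd x - int w then z powi x else 0) =
      (\<Sum>x\<in>{0..<int N}. \<Sum>d\<in>D. if int r dvd x - int w then of_int (g (x - int d)) * z powi x else 0)"
  proof (rule sum.cong)
    fix x
    have "(\<Sum>d\<in>D. of_int (g (x - int d)) * z powi x) = of_int (\<Sum>d\<in>D. g (x - int d)) * z powi x"
      by (simp add: sum_distrib_right)
    also have "\<dots> = z powi x" using D(2) by (simp add: tiles_with_def)
    finally show "(if int r dvd x - int w then z powi x else 0) =
        (\<Sum>d\<in>D. if int r dvd x - int w then of_int (g (x - int d)) * z powi x else 0)" by simp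
  qed simp
  also have "\<dots> = (\<Sum>d\<in>D. \<Sum>x\<in>{0..<int N}. if int r dvd x - int w then of_int (g (x - int d)) * z powi x else 0)"
    by (rule sum.swap)
  also have "\<dots> = (\<Sum>d\<in>D. if d mod r = w then z ^ d * sum G {0..<int N} else 0)"
  proof (rule sum.cong)
    fix d
    have iff: "int r dvd x - int w \<longleftrightarrow> d mod r = w" if "g (x - int d) = 1" for x
    proof -
      have "int r dvd x - int d" using supp[OF that] .
      then have "int r dvd (x - int d) + (int d - int w) \<longleftrightarrow> int r dvd int d - int w"
        by (rule dvd_add_right_iff)
      then have "int r dvd x - int w \<longleftrightarrow> int r dvd int d - int w" by simp
      also have "int r dvd int d - int w \<longleftrightarrow> d mod r = w"
        using N(3) by (simp add: cong_iff_dvd_diff [symmetric] cong_int_iff) (simp add: cong_def)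
      finally show ?thesis .
    qed
    have "(if int r dvd x - int w then of_int (g (x - int d)) * z powi x else 0) =
        (if d mod r = w then of_int (g (x - int d)) * z powi x else 0)" for x
      using g01[of "x - int d"] iff[of x] by auto
    then have "(\<Sum>x\<in>{0..<int N}. if int r dvd x - int w then of_int (g (x - int d)) * z powi x else 0) =
        (if d mod r = w then (\<Sum>x\<in>{0..<int N}. of_int (g (x - int d)) * z powi x) else 0)" by simp
    then show "(\<Sum>x\<in>{0..<int N}. if int r dvd x - int w then of_int (g (x - int d)) * z powi x else 0) =
        (if d mod r = w then z ^ d * sum G {0..<int N} else 0)" by (simp only: shift)
  qed simp
  also have "\<dots> = (\<Sum>d\<in>res_class D r w. z ^ d * sum G {0..<int N})"
    unfolding res_class_def by (rule sum.inter_filter [symmetric]) (rule D(1))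
  also have "\<dots> = esum (res_class D r w) z * sum G {0..<int N}"
    by (simp add: esum_def sum_distrib_right)
  finally show ?thesis by (simp add: G_def)
qed

lemma card_period_set:
  assumes "tiles_with D g" "N > 0"
  shows "(\<Sum>x\<in>{0..<int N}. of_int (g x) * z powi x) = esum {y. y < N \<and> g (int y) = 1} (z :: complex)"
proof -
  have g01: "g y = 0 \<or> g y = 1" for y using assms(1) by (simp add: tiles_with_def)
  have "(\<Sum>x\<in>{0..<int N}. of_int (g x) * z powi x) = (\<Sum>y\<in>{..<N}. of_int (g (int y)) * z ^ y)"
    by (rule sum.reindex_bij_witness[of _ int nat]) (auto simp: power_int_def)
  also have "\<dots> = (\<Sum>y\<in>{..<N}. if g (int y) = 1 then z ^ y else 0)"
  proof (rule sum.cong)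
    fix y show "of_int (g (int y)) * z ^ y = (if g (int y) = 1 then z ^ y else 0)"
      using g01[of "int y"] by auto
  qed simp
  also have "\<dots> = (\<Sum>y\<in>{y \<in> {..<N}. g (int y) = 1}. z ^ y)"
    by (rule sum.inter_filter [symmetric]) simp
  finally show ?thesis by (simp add: esum_def)
qed

lemma sum_class_shift:
  fixes z :: complex
  assumes "N > 0" "r dvd N" "z ^ N = 1"
  shows "z ^ c * (\<Sum>x\<in>{0..<int N}. if int r dvd x - u then z powi x else 0) =
    (\<Sum>x\<in>{0..<int N}. if int r dvd x - (u + int c) then z powi x else 0)"
proof -
  have z0: "z \<noteq> 0" using assms by (auto simp: power_0_left)
  define f where "f = (\<lambda>x. if int r dvd x - (u + int c) then z powi x else 0)"
  have per: "periodic (int N) f"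
  proof -
    have "int r dvd x + int N - (u + int c) \<longleftrightarrow> int r dvd x - (u + int c)" for x
    proof -
      have "int r dvd (x - (u + int c)) + int N \<longleftrightarrow> int r dvd x - (u + int c)"
        using assms(2) by (intro dvd_add_left_iff) simp
      moreover have "x + int N - (u + int c) = (x - (u + int c)) + int N" by simp
      ultimately show ?thesis by (simp only:)
    qed
    then show ?thesis using z0 assms(3) by (simp add: periodic_def f_def power_int_add)
  qed
  have "(\<Sum>x\<in>{0..<int N}. f x) = (\<Sum>x\<in>{0..<int N}. f (x + int c))"
    using assms(1) by (intro sum_periodic_shift[OF per, symmetric]) simp
  also have "\<dots> = (\<Sum>x\<in>{0..<int N}. z ^ c * (if int r dvd x - u then z powi x else 0))"
    using z0 by (intro sum.cong) (auto simp: f_def power_int_add)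
  finally show ?thesis by (simp add: f_def sum_distrib_left)
qed

text \<open>At z = 1 the convolution identity shows that every class of \<open>D\<close> modulo r,
  combined with the same complement, covers equally many integers; so the classes have equal
  size.\<close>

lemma vanishes_if_support_multiple:
  assumes "finite D" "tiles_with D g" "periodic (int N) g" "N > 0" "r dvd N" "prime r"
    and "\<And>y. g y = 1 \<Longrightarrow> int r dvd y" "D \<noteq> {}"
  shows "vanishes D r"
proof -
  define G :: complex where "G = (\<Sum>x\<in>{0..<int N}. of_int (g x) * 1 powi x)"
  define L :: "int \<Rightarrow> complex" where "L = (\<lambda>u. \<Sum>x\<in>{0..<int N}. if int r dvd x - u then 1 powi x else 0)"
  have r0: "r > 0" using assms(6) prime_gt_0_nat by blast
  have L1: "L u = L (u + int c)" for u c
    unfolding L_def using sum_class_shift[OF assms(4,5), of 1 c u] by simp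
  have L: "L (int w) = of_nat (cnt D r w) * G" if "w < r" for w
    using class_convolution[OF assms(1-5) that, of 1] assms(7) card_res_class[OF that, of D]
    by (simp add: L_def G_def esum_def)
  have G0: "G \<noteq> 0"
  proof -
    have "int (card D) * (\<Sum>x\<in>{0..<int N}. g x) = int N"
      using assms(2,3,4) by (intro tiles_with_count) auto
    then have "(\<Sum>x\<in>{0..<int N}. g x) \<noteq> 0" using assms(4) by auto
    then have "(of_int (\<Sum>x\<in>{0..<int N}. g x) :: complex) \<noteq> 0" by (subst of_int_eq_0_iff)
    moreover have "G = of_int (\<Sum>x\<in>{0..<int N}. g x)" by (simp add: G_def)
    ultimately show ?thesis by metis
  qed
  have const: "cnt D r w = cnt D r 0" if "w < r" for w
  proof -
    have "of_nat (cnt D r w) * G = of_nat (cnt D r 0) * G"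
      using L[OF that] L[OF r0] L1[of 0 w] by simp
    then show ?thesis using G0 by simp
  qed
  have "cnt D r x = cnt D r 0" for x using const[of "x mod r"] r0 by (simp add: cnt_mod)
  then have "shift_inv D r 1" unfolding shift_inv_def by metis
  moreover have "\<not> r dvd 1" using assms(6) by auto
  ultimately show ?thesis using assms(1) r0 by (intro shift_invD[of D r 1 r]) auto
qed

lemma class_or_complement_vanishes:
  assumes "finite D" "tiles_with D g" "periodic (int N) g" "N > 0" "q dvd N" "prime q" "w < q"
    and "\<And>y. g y = 1 \<Longrightarrow> int q dvd y" "prime p" "p \<noteq> q" "p ^ i dvd N" "i \<ge> 1"
  shows "vanishes (res_class D q w) (p ^ i) \<or> vanishes {y. y < N \<and> g (int y) = 1} (p ^ i)"
proof (rule ccontr)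
  assume nv: "\<not> ?thesis"
  then obtain z where z: "prim_root (p ^ i) z" "esum {y. y < N \<and> g (int y) = 1} z \<noteq> 0"
    by (auto simp: vanishes_def)
  have zN: "z ^ N = 1" using z(1) assms(11) by (simp add: prim_root_power_eq_1)
  define L where "L = (\<lambda>u. \<Sum>x\<in>{0..<int N}. if int q dvd x - u then z powi x else 0)"
  have "z ^ q * L (int w) = L (int w + int q)"
    unfolding L_def by (rule sum_class_shift[OF assms(4,5) zN])
  also have "\<dots> = L (int w)"
  proof -
    have "int q dvd x - (int w + int q) \<longleftrightarrow> int q dvd x - int w" for x
    proof -
      have "int q dvd (x - int w) - int q \<longleftrightarrow> int q dvd x - int w"
        by (intro dvd_diff_left_iff) simp
      moreover have "x - (int w + int q) = (x - int w) - int q" by simp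
      ultimately show ?thesis by (simp only:)
    qed
    then show ?thesis by (simp add: L_def)
  qed
  finally have "z ^ q * L (int w) = L (int w)" .
  \<comment> \<open>A residue class modulo q is invariant under translation by q, which multiplies
    its transform by \<open>z ^ q\<close>. This factor is not 1 since z has order a power of p, so
    the transform is 0.\<close>
  moreover have "z ^ q \<noteq> 1"
  proof
    assume "z ^ q = 1"
    then have "p ^ i dvd q" using z(1) by (simp add: prim_root_power_eq_1)
    then have "p dvd q" using assms(12) by (metis dvd_power dvd_trans less_eq_Suc_le One_nat_def)
    then show False using assms(6,9,10) primes_dvd_imp_eq by blast
  qed
  ultimately have "L (int w) = 0" by simp
  then have "esum (res_class D q w) z * esum {y. y < N \<and> g (int y) = 1} z = 0"
    using class_convolution[OF assms(1-5,7) zN assms(8)] card_period_set[OF assms(2,4), of z]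
    by (simp add: L_def)
  then have "esum (res_class D q w) z = 0" using z(2) by simp
  then have "vanishes (res_class D q w) (p ^ i)" by (rule vanishes_if_root[OF z(1)])
  then show False using nv by blast
qed

text \<open>Suppose the complement consists of multiples of q, with period p^a q^c. Its part
  \<open>B\<close> in one period has cardinality with exactly a - 2 factors p, so \<open>B\<close>
  vanishes for at most a - 2 of p, ..., p^a. At the other two or more exponents every class of
  \<open>D\<close> modulo q vanishes, and \<open>e\<close>, \<open>e'\<close> are the only
  candidates.\<close>

theorem tile_prime_alternative:
  assumes p: "prime p" and q: "prime q" and pq: "p \<noteq> q"
    and D: "finite D" "card D = p ^ 2 * q" "0 \<in> D" "Gcd D = 1"
    and ex: "\<exists>M g. M > 0 \<and> periodic M g \<and> tiles_with D g"
    and E: "\<And>i. i \<ge> 1 \<Longrightarrow> vanishes D (p ^ i) \<Longrightarrow> i = e \<or> i = e'"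
  shows "vanishes D p \<or> (vanishes D q \<and>
    (\<forall>w<q. vanishes (res_class D q w) (p ^ e) \<and> vanishes (res_class D q w) (p ^ e')))"
proof -
  obtain a c g where g: "periodic (int (p ^ a * q ^ c)) g" "tiles_with D g"
    "(\<forall>y. g y = 1 \<longrightarrow> int p dvd y) \<or> (\<forall>y. g y = 1 \<longrightarrow> int q dvd y)"
    using two_prime_tiling[OF p q pq D ex] by (elim exE conjE) (rule that)
  define N where "N = p ^ a * q ^ c"
  have p0: "p > 0" and q0: "q > 0" using p q prime_gt_0_nat by auto
  have N0: "N > 0" using p0 q0 by (simp add: N_def)
  have gp: "periodic (int N) g" using g(1) by (simp add: N_def)
  define G where "G = (\<Sum>x\<in>{0..<int N}. g x)"
  have cG: "int (card D) * G = int N" unfolding G_def using N0 by (intro tiles_with_count gp g(2)) simp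
  have cN: "card D dvd N" using cG by (metis dvd_triv_left int_dvd_int_iff)
  have dvdN: "p dvd N" "q dvd N" using cN D(2) by (auto intro: dvd_trans[OF _ cN])
  have ne: "D \<noteq> {}" using D(3) by auto
  show ?thesis
  proof (cases "\<forall>y. g y = 1 \<longrightarrow> int p dvd y")
    case True
    then show ?thesis
      using vanishes_if_support_multiple[OF D(1) g(2) gp N0 dvdN(1) p _ ne] by blast
  next
    case False
    then have sq: "\<And>y. g y = 1 \<Longrightarrow> int q dvd y" using g(3) by blast
    have vq: "vanishes D q" by (rule vanishes_if_support_multiple[OF D(1) g(2) gp N0 dvdN(2) q sq ne])
    define B where "B = {y. y < N \<and> g (int y) = 1}"
    have cB: "card D * card B = N"
    proof -
      have "of_int G = (\<Sum>x\<in>{0..<int N}. of_int (g x) * (1 :: complex) powi x)" by (simp add: G_def)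
      also have "\<dots> = of_nat (card B)" unfolding card_period_set[OF g(2) N0] by (simp add: esum_def B_def)
      finally have "(of_int G :: complex) = of_int (int (card B))" by simp
      then have "G = int (card B)" by (simp only: of_int_eq_iff)
      then show ?thesis using cG by (metis of_nat_eq_iff of_nat_mult)
    qed
    define S where "S = {i \<in> {1..a}. vanishes B (p ^ i)}"
    have "p ^ card S dvd card B"
      by (rule prime_power_vanishes_dvd_card[OF _ p]) (auto simp: S_def B_def)
    then have "p ^ 2 * p ^ card S dvd card D * card B" unfolding D(2) by (intro mult_dvd_mono) auto
    then have "p ^ (2 + card S) dvd p ^ a * q ^ c" unfolding cB N_def power_add .
    moreover have "coprime (p ^ (2 + card S)) (q ^ c)" using p q pq by (simp add: primes_coprime)
    ultimately have "p ^ (2 + card S) dvd p ^ a" by (simp add: coprime_dvd_mult_left_iff)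
    then have cS: "2 + card S \<le> a" using prime_gt_1_nat[OF p] by (simp add: power_dvd_imp_le)
    define R where "R = {1..a} - S"
    have "card R = a - card S" unfolding R_def by (subst card_Diff_subset) (auto simp: S_def)
    then have cR: "card R \<ge> 2" using cS by simp
    have R: "vanishes (res_class D q w) (p ^ i)" if "i \<in> R" "w < q" for i w
    proof -
      have i: "1 \<le> i" "i \<le> a" "\<not> vanishes B (p ^ i)" using that by (auto simp: R_def S_def)
      have pi: "p ^ i dvd N" unfolding N_def by (intro dvd_mult2 le_imp_power_dvd i(2))
      have "vanishes (res_class D q w) (p ^ i) \<or> vanishes B (p ^ i)"
        unfolding B_def by (rule class_or_complement_vanishes[OF D(1) g(2) gp N0 dvdN(2) q that(2) sq p pq pi i(1)])
      then show ?thesis using i(3) by simp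
    qed
    have "R \<subseteq> {e, e'}"
    proof
      fix i assume i: "i \<in> R"
      have "vanishes D (p ^ i)" by (rule vanishes_if_res_class[OF D(1) q0 R[OF i]])
      moreover have "i \<ge> 1" using i by (simp add: R_def)
      ultimately show "i \<in> {e, e'}" using E[of i] by blast
    qed
    moreover have "card {e, e'} \<le> 2" by (simp add: card_insert_if)
    moreover have "card R \<le> card {e, e'}" using calculation(1) by (intro card_mono) auto
    ultimately have "R = {e, e'}" using cR by (intro card_subset_eq) auto
    then show ?thesis using R vq by blast
  qed
qed

section \<open>The shape of the set of zeros for p^2 q digits\<close>

subsection \<open>The spectrum of a tile digit set\<close>

context digit_system
begin

lemma finite_vanishing: "finite {s. s \<ge> 1 \<and> vanishes D s}"
proof -
  have "poly (set_poly D) 1 \<noteq> 0" using card_D b_pos by (simp add: poly_set_poly esum_def)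
  then have "set_poly D \<noteq> 0" by auto
  then have fin: "finite {z. poly (set_poly D) z = 0}" by (rule poly_roots_finite)
  have "rou 1 ` {s. s \<ge> 1 \<and> vanishes D s} \<subseteq> {z. poly (set_poly D) z = 0}"
    using prim_root_rou_1 by (auto simp: vanishes_def poly_set_poly)
  then have "finite (rou 1 ` {s. s \<ge> 1 \<and> vanishes D s})" using fin by (rule finite_subset)
  moreover have "inj_on (rou 1) {s. s \<ge> 1 \<and> vanishes D s}"
  proof (rule inj_onI)
    fix s t assume st: "s \<in> {s. s \<ge> 1 \<and> vanishes D s}" "t \<in> {s. s \<ge> 1 \<and> vanishes D s}" "rou 1 s = rou 1 t"
    then have "prim_root s (rou 1 s)" "prim_root t (rou 1 s)" using prim_root_rou_1[of s] prim_root_rou_1[of t] by auto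
    then show "s = t" by (rule prim_root_unique)
  qed
  ultimately show ?thesis by (rule finite_imageD)
qed

end

lemma coprime_prime_powers:
  fixes p q :: nat
  assumes "prime p" "prime q" "p \<noteq> q"
  shows "coprime (p ^ i) (q ^ j)"
  using primes_coprime[OF assms] by simp

lemma coprime_clipped:
  fixes p q :: nat
  assumes "prime p" "prime q" "p \<noteq> q" "i = 0 \<or> i' = 0" "j = 0 \<or> j' = 0"
  shows "coprime (p ^ i * q ^ j) (p ^ i' * q ^ j')"
  using assms coprime_prime_powers[OF assms(1-3)] coprime_prime_powers[OF assms(2,1)]
  by (auto simp: coprime_commute)

text \<open>\<open>Kenyon_zero\<close> at m = p^\<alpha> q^\<beta>. Truncated subtraction is the
  cancellation of common factors in m / b^k, so it gives the exact order of the root.\<close>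

lemma (in distinct_digit_system) vanishing_on_lines:
  assumes p: "prime p" and q: "prime q" and pq: "p \<noteq> q" and b: "b = p ^ 2 * q"
  shows "\<exists>k\<ge>1. vanishes D (p ^ (2 * k - \<alpha>) * q ^ (k - \<beta>))"
proof -
  have p0: "p > 0" and q0: "q > 0" using p q prime_gt_0_nat by auto
  define m where "m = p ^ \<alpha> * q ^ \<beta>"
  have "m > 0" using p0 q0 by (simp add: m_def)
  then obtain k where k: "k \<ge> 1" "esum D (rou m (b ^ k)) = 0" using Kenyon_zero by blast
  define c where "c = p ^ min \<alpha> (2 * k) * q ^ min \<beta> k"
  have c0: "c > 0" using p0 q0 by (simp add: c_def)
  have split: "x ^ s = x ^ (s - t) * x ^ min s t" for x s t :: nat
    by (simp add: min_def flip: power_add)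
  have m: "m = (p ^ (\<alpha> - 2 * k) * q ^ (\<beta> - k)) * c"
    unfolding m_def c_def split[of p \<alpha> "2 * k"] split[of q \<beta> k] by (simp only: mult_ac)
  have "p ^ (2 * k) * q ^ k = (p ^ (2 * k - \<alpha>) * q ^ (k - \<beta>)) * c"
    unfolding c_def split[of p "2 * k" \<alpha>] split[of q k \<beta>] min.commute[of "2 * k" \<alpha>] min.commute[of k \<beta>]
    by (simp only: mult_ac)
  then have n: "b ^ k = (p ^ (2 * k - \<alpha>) * q ^ (k - \<beta>)) * c"
    by (simp add: b power_mult_distrib power_mult)
  have "rou m (b ^ k) = rou (p ^ (\<alpha> - 2 * k) * q ^ (\<beta> - k)) (p ^ (2 * k - \<alpha>) * q ^ (k - \<beta>))"
    unfolding m n by (rule rou_cancel[OF c0])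
  moreover have "coprime (p ^ (\<alpha> - 2 * k) * q ^ (\<beta> - k)) (p ^ (2 * k - \<alpha>) * q ^ (k - \<beta>))"
    by (rule coprime_clipped[OF p q pq]) auto
  ultimately have "prim_root (p ^ (2 * k - \<alpha>) * q ^ (k - \<beta>)) (rou m (b ^ k))"
    using p0 q0 prim_root_rou_coprime by simp
  then show ?thesis using vanishes_if_root k by blast
qed

text \<open>Along the axes the exponents \<open>i\<close> of \<open>p\<close> keep their parity, whence one odd and one even exponent.\<close>

theorem (in distinct_digit_system) spectrum:
  assumes p: "prime p" and q: "prime q" and pq: "p \<noteq> q" and b: "b = p ^ 2 * q"
  obtains m n l where "m \<ge> 1" "l \<ge> 1" "vanishes D (p ^ (2 * n + 1))" "vanishes D (p ^ (2 * m))" "vanishes D (q ^ l)"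
    "\<And>i. i \<ge> 1 \<Longrightarrow> vanishes D (p ^ i) \<Longrightarrow> i = 2 * n + 1 \<or> i = 2 * m"
    "\<And>j. j \<ge> 1 \<Longrightarrow> vanishes D (q ^ j) \<Longrightarrow> j = l"
proof -
  have p1: "p > 1" and q1: "q > 1" using p q prime_gt_1_nat by auto
  obtain B where B: "\<And>s. s \<ge> 1 \<Longrightarrow> vanishes D s \<Longrightarrow> s \<le> B"
    using finite_vanishing by (metis (mono_tags, lifting) finite_nat_set_iff_bounded_le mem_Collect_eq)
  have exp_lt: "k < r ^ k" if "r > 1" for r k :: nat
    by (rule less_le_trans[OF less_exp power_mono]) (use that in auto)
  have line: "\<exists>k\<ge>1. vanishes D (p ^ (2 * k - \<alpha>) * q ^ (k - \<beta>))" for \<alpha> \<beta>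
    by (rule vanishing_on_lines[OF p q pq b])
  have even_odd: "\<exists>k\<ge>1. vanishes D (p ^ (2 * k - \<alpha>))" if "\<alpha> \<le> 1" for \<alpha>
  proof -
    \<comment> \<open>\<open>B\<close> bounds every vanishing order. The estimate below yields k <
      B, so the exponent of q is clipped to 0 while \<alpha> prescribes the parity of the exponent
      of p.\<close>
    obtain k where k: "k \<ge> 1" "vanishes D (p ^ (2 * k - \<alpha>) * q ^ (k - B))" using line[of \<alpha> B] by blast
    have "k < p ^ k" using exp_lt p1 by blast
    also have "\<dots> \<le> p ^ (2 * k - \<alpha>)" using p1 k(1) that by (intro power_increasing) auto
    also have "\<dots> \<le> p ^ (2 * k - \<alpha>) * q ^ (k - B)" using q1 by simp
    also have "\<dots> \<le> B" using k(2) p1 q1 by (intro B) (auto simp: Suc_le_eq)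
    finally show ?thesis using k by auto
  qed
  obtain m where m: "m \<ge> 1" "vanishes D (p ^ (2 * m))" using even_odd[of 0] by auto
  obtain k where k: "k \<ge> 1" "vanishes D (p ^ (2 * k - 1))" using even_odd[of 1] by auto
  define n where "n = k - 1"
  have n: "vanishes D (p ^ (2 * n + 1))" using k by (cases k) (auto simp: n_def)
  obtain l where l: "l \<ge> 1" "vanishes D (q ^ l)"
  proof -
    \<comment> \<open>The same clipping with the axes exchanged: l < B makes the exponent of p
      zero.\<close>
    obtain l where l: "l \<ge> 1" "vanishes D (p ^ (2 * l - 2 * B) * q ^ (l - 0))" using line[of "2 * B" 0] by blast
    have "l < q ^ l" using exp_lt q1 by blast
    also have "\<dots> \<le> p ^ (2 * l - 2 * B) * q ^ (l - 0)" using p1 by simp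
    also have "\<dots> \<le> B" using l(2) p1 q1 by (intro B) (auto simp: Suc_le_eq)
    finally show ?thesis using l that by auto
  qed
  have cp: "coprime (p ^ i) q" for i using primes_coprime[OF p q pq] by simp
  have pu: "i = 2 * n + 1 \<or> i = 2 * m" if i: "i \<ge> 1" "vanishes D (p ^ i)" for i
  proof (rule ccontr)
    assume ni: "\<not> ?thesis"
    have "2 * n + 1 \<noteq> 2 * m" by presburger
    then have c: "card {i, 2 * n + 1, 2 * m} = 3" using ni by (simp add: card_insert_if)
    have "p ^ card {i, 2 * n + 1, 2 * m} dvd card D"
      by (rule prime_power_vanishes_dvd_card[OF finite_D p]) (use i m n in auto)
    then have "p ^ 3 dvd p ^ 2 * q" unfolding c card_D b .
    then have "p ^ 3 dvd p ^ 2" using coprime_dvd_mult_left_iff[OF cp[of 3]] by simp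
    then show False using p1 by (auto dest: power_dvd_imp_le)
  qed
  have qu: "j = l" if j: "j \<ge> 1" "vanishes D (q ^ j)" for j
  proof (rule ccontr)
    assume nj: "j \<noteq> l"
    then have c: "card {j, l} = 2" by simp
    have "q ^ card {j, l} dvd card D"
      by (rule prime_power_vanishes_dvd_card[OF finite_D q]) (use j l in auto)
    then have "q * q dvd p ^ 2 * q" unfolding c card_D b power2_eq_square .
    then have "q dvd p ^ 2" using q1 by simp
    then have "q dvd p" by (rule prime_dvd_power[OF q])
    then show False using primes_dvd_imp_eq[OF q p] pq by simp
  qed
  show thesis by (rule that[OF m(1) l(1) n m(2) l(2) pu qu])
qed

subsection \<open>Cycles modulo a product of two prime powers\<close>

lemma dvd_two_prime_powers:
  fixes p q :: nat
  assumes "prime p" "prime q" "s dvd p ^ i * q ^ j"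
  obtains a c where "a \<le> i" "c \<le> j" "s = p ^ a * q ^ c"
proof -
  obtain s1 s2 where "s = s1 * s2" "s1 dvd p ^ i" "s2 dvd q ^ j"
    using division_decomp[OF assms(3)] by blast
  then show ?thesis using that assms(1,2) by (auto simp: divides_primepow_nat)
qed

lemma two_prime_powers_dvd_iff:
  fixes p q :: nat
  assumes "prime p" "prime q" "p \<noteq> q"
  shows "p ^ a * q ^ c dvd p ^ i * q ^ j \<longleftrightarrow> a \<le> i \<and> c \<le> j"
proof
  assume d: "p ^ a * q ^ c dvd p ^ i * q ^ j"
  have "p ^ a dvd p ^ i * q ^ j" "q ^ c dvd p ^ i * q ^ j"
    using d dvd_mult_left dvd_mult_right by blast+
  then have "p ^ a dvd p ^ i" "q ^ c dvd q ^ j"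
    using coprime_prime_powers[OF assms, of a j] coprime_prime_powers[OF assms(2,1) assms(3)[symmetric], of c i]
    by (simp_all add: coprime_dvd_mult_left_iff coprime_dvd_mult_right_iff)
  then show "a \<le> i \<and> c \<le> j"
    using prime_gt_1_nat[OF assms(1)] prime_gt_1_nat[OF assms(2)] by (auto dest: power_dvd_imp_le)
qed (auto intro: mult_dvd_mono le_imp_power_dvd)

locale two_primes =
  fixes p q :: nat
  assumes p: "prime p" and q: "prime q" and pq: "p \<noteq> q"
begin

lemma p_pos: "p > 0" and q_pos: "q > 0" and p_gt_1: "p > 1" and q_gt_1: "q > 1"
  using p q prime_gt_0_nat prime_gt_1_nat by auto

lemma coprime_pq: "coprime p q"
  using primes_coprime[OF p q pq] .

lemma swap: "two_primes q p"
  using p q pq by unfold_locales auto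

lemma N_pos: "p ^ i * q ^ j > 0"
  using p_pos q_pos by simp

abbreviation V :: "nat set \<Rightarrow> nat \<Rightarrow> nat \<Rightarrow> bool" where
  "V A i j \<equiv> vanishes A (p ^ i * q ^ j)"

text \<open>The divisors of p^(i+1) q^j that do not divide p^i q^j are exactly the points of column
  i + 1 up to height j, so a full column segment means cycles of length p.\<close>

lemma p_cycles_iff:
  assumes "finite A"
  shows "shift_inv A (p ^ Suc i * q ^ j) (p ^ i * q ^ j) \<longleftrightarrow> (\<forall>j'\<le>j. V A (Suc i) j')"
proof -
  have "shift_inv A (p ^ Suc i * q ^ j) (p ^ i * q ^ j) \<longleftrightarrow>
      (\<forall>s. s dvd p ^ Suc i * q ^ j \<longrightarrow> \<not> s dvd p ^ i * q ^ j \<longrightarrow> vanishes A s)"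
    by (rule shift_inv_iff[OF assms N_pos])
  also have "\<dots> \<longleftrightarrow> (\<forall>j'\<le>j. V A (Suc i) j')"
  proof safe
    fix j' assume *: "\<forall>s. s dvd p ^ Suc i * q ^ j \<longrightarrow> \<not> s dvd p ^ i * q ^ j \<longrightarrow> vanishes A s" "j' \<le> j"
    have "p ^ Suc i * q ^ j' dvd p ^ Suc i * q ^ j" "\<not> p ^ Suc i * q ^ j' dvd p ^ i * q ^ j"
      unfolding two_prime_powers_dvd_iff[OF p q pq] using *(2) by simp_all
    then show "V A (Suc i) j'" using *(1) by simp
  next
    fix s assume *: "\<forall>j'\<le>j. V A (Suc i) j'" "s dvd p ^ Suc i * q ^ j" "\<not> s dvd p ^ i * q ^ j"
    from p q *(2) obtain a c where ac: "a \<le> Suc i" "c \<le> j" "s = p ^ a * q ^ c"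
      by (rule dvd_two_prime_powers) (rule that)
    have "\<not> (a \<le> i \<and> c \<le> j)" using *(3) unfolding ac(3) two_prime_powers_dvd_iff[OF p q pq] .
    then have "a = Suc i" using ac by simp
    then show "vanishes A s" using *(1) ac by simp
  qed
  finally show ?thesis .
qed

lemma q_cycles_iff:
  assumes "finite A"
  shows "shift_inv A (p ^ i * q ^ Suc j) (p ^ i * q ^ j) \<longleftrightarrow> (\<forall>i'\<le>i. V A i' (Suc j))"
  using two_primes.p_cycles_iff[OF swap assms, of j i] by (simp only: mult.commute)

text \<open>Cycles of length p stay within one class of any modulus dividing the step, so they fill
  such a class by multiples of p.\<close>

lemma p_cycles_dvd:
  assumes "finite A" "shift_inv A (p ^ Suc i * q ^ j) (p ^ i * q ^ j)" "M dvd p ^ i * q ^ j"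
  shows "p dvd cnt A M x"
proof -
  have M: "M > 0" using assms(3) N_pos[of i j] by (metis dvd_pos_nat)
  have "shift_inv A (p ^ i * q ^ j * p) (p ^ i * q ^ j)" using assms(2) by (simp only: power_Suc mult_ac)
  then have "cnt A (p ^ i * q ^ j) z = p * cnt A (p ^ i * q ^ j * p) z" for z
    by (rule cnt_shift_collapse[OF assms(1) N_pos p_pos])
  then have "p dvd cnt A (p ^ i * q ^ j) z" for z by (simp only: dvd_triv_left)
  then show ?thesis by (rule cnt_coarse_dvd[OF assms(1) M assms(3) N_pos])
qed

lemma q_cycles_dvd:
  assumes "finite A" "shift_inv A (p ^ i * q ^ Suc j) (p ^ i * q ^ j)" "M dvd p ^ i * q ^ j"
  shows "q dvd cnt A M x"
  using two_primes.p_cycles_dvd[OF swap assms(1), of j i M x] assms(2,3) by (simp only: mult.commute)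

lemma four_point_if_V:
  assumes "finite A" "V A (Suc i) (Suc j)"
  shows "four_point A (p ^ Suc i * q ^ Suc j) (p ^ i * q ^ Suc j) (p ^ Suc i * q ^ j)"
proof (rule four_point_if_vanishes[OF assms(1) N_pos assms(2)])
  fix s assume s: "s dvd p ^ Suc i * q ^ Suc j" "s \<noteq> p ^ Suc i * q ^ Suc j"
  from p q s(1) obtain a c where ac: "a \<le> Suc i" "c \<le> Suc j" "s = p ^ a * q ^ c"
    by (rule dvd_two_prime_powers) (rule that)
  then have "a \<le> i \<or> c \<le> j" using s(2) by (metis le_SucE)
  then show "s dvd p ^ i * q ^ Suc j \<or> s dvd p ^ Suc i * q ^ j"
    unfolding ac(3) two_prime_powers_dvd_iff[OF p q pq] using ac by auto
qed

lemma two_vanishing_dvd: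
  assumes "finite A" "V A i 0" "V A i' 0" "i \<ge> 1" "i' \<ge> 1" "i \<noteq> i'"
  shows "p ^ 2 dvd card A"
proof -
  have "p ^ card {i, i'} dvd card A"
    by (rule prime_power_vanishes_dvd_card[OF assms(1) p]) (use assms in auto)
  moreover have "card {i, i'} = 2" using assms(6) by simp
  ultimately show ?thesis by (simp only:)
qed

lemma not_square_dvd_pq: "\<not> p ^ 2 dvd p * q" "\<not> q ^ 2 dvd p * q"
proof -
  have "\<not> p dvd q" "\<not> q dvd p" using p q pq primes_dvd_imp_eq by blast+
  then show "\<not> p ^ 2 dvd p * q" "\<not> q ^ 2 dvd p * q"
    using p_pos q_pos by (simp_all add: power2_eq_square mult.commute)
qed

lemma card_class_if_vanishes:
  assumes "finite D" "vanishes D p" "u < p"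
  shows "p * card (res_class D p u) = card D"
proof -
  have "shift_inv D (1 * p) 1"
    using shift_inv_if_vanishes_prime_power[OF assms(1) p, of 0] assms(2) by simp
  then have "cnt D 1 u = p * cnt D (1 * p) u"
    using assms(1) p_pos by (intro cnt_shift_collapse) auto
  then show ?thesis using card_res_class[OF assms(3), of D] by simp
qed

lemma dvd_p_power: "i \<ge> 1 \<Longrightarrow> p dvd p ^ i * c"
  by (metis One_nat_def Suc_le_lessD dvd_mult2 dvd_power_same dvd_refl dvd_power)

subsection \<open>First case: equidistribution modulo \<open>p\<close>\<close>

text \<open>Each class modulo p has p q elements, so the dichotomy applies; \<open>i >= 2\<close>
  keeps the shifts inside the class. Cycles of length p would make column \<open>i\<close> vanish at
  height 0 besides column \<open>M\<close>, and p^2 would divide p q.\<close>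

lemma q_cycles_if_not_even_exponent:
  assumes D: "finite D" "card D = p ^ 2 * q" "vanishes D p"
    and m: "V D M 0" "M \<ge> 2" and V: "V D i j" "i \<ge> 2" "j \<ge> 1" "i \<noteq> M"
  shows "\<forall>i'\<le>i. V D i' j"
proof -
  obtain i1 where i1: "i = Suc i1" "i1 \<ge> 1" using V(2) by (cases i) auto
  obtain j1 where j1: "j = Suc j1" using V(3) by (cases j) auto
  obtain M1 where M1: "M = Suc M1" "M1 \<ge> 1" using m(2) by (cases M) auto
  define N where "N = p ^ Suc i1 * q ^ Suc j1"
  have fp: "four_point D N (p ^ i1 * q ^ Suc j1) (p ^ Suc i1 * q ^ j1)"
    unfolding N_def using V(1) D(1) by (intro four_point_if_V) (simp_all only: i1 j1)
  have dv: "p dvd N" "p dvd p ^ i1 * q ^ Suc j1" "p dvd p ^ Suc i1 * q ^ j1"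
    unfolding N_def using i1(2) by (auto intro: dvd_p_power)
  have "shift_inv D (p ^ Suc M1 * q ^ 0) (p ^ M1 * q ^ 0)"
    unfolding p_cycles_iff[OF D(1)] using m(1) M1 by simp
  then have sM: "shift_inv (res_class D p u) (p ^ Suc M1 * q ^ 0) (p ^ M1 * q ^ 0)" for u
    using M1(2) by (intro shift_inv_res_class dvd_p_power) auto
  have "shift_inv D N (p ^ Suc i1 * q ^ j1)"
  proof (rule shift_inv_if_res_class[OF p_pos dv(1) dv(3)])
    fix u assume u: "u < p"
    let ?A = "res_class D p u"
    have fin: "finite ?A" using D(1) by simp
    have "p * card ?A = p * (p * q)"
      using card_class_if_vanishes[OF D(1,3) u] D(2) by (simp only: power2_eq_square mult.assoc)
    then have card: "card ?A = p * q" using p_pos by simp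
    have "shift_inv ?A N (p ^ i1 * q ^ Suc j1) \<or> shift_inv ?A N (p ^ Suc i1 * q ^ j1)"
      by (rule four_point_dichotomy[OF fin coprime_pq p_pos q_pos _ _ _ four_point_res_class[OF dv fp] card])
        (simp_all add: N_def p_pos q_pos)
    moreover have "\<not> shift_inv ?A N (p ^ i1 * q ^ Suc j1)"
    proof
      assume "shift_inv ?A N (p ^ i1 * q ^ Suc j1)"
      then have "\<forall>j'\<le>Suc j1. V ?A (Suc i1) j'" unfolding N_def p_cycles_iff[OF fin] .
      from this[rule_format, OF le0] have "V ?A (Suc i1) 0" .
      moreover have "V ?A (Suc M1) 0" using sM[of u] unfolding p_cycles_iff[OF fin] by simp
      ultimately have "p ^ 2 dvd card ?A"
        using V(4) i1 M1 by (intro two_vanishing_dvd[OF fin, of "Suc i1" "Suc M1"]) auto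
      then show False unfolding card using not_square_dvd_pq by simp
    qed
    ultimately show "shift_inv ?A N (p ^ Suc i1 * q ^ j1)" by blast
  qed
  then show ?thesis unfolding N_def q_cycles_iff[OF D(1)] i1(1) j1 .
qed

text \<open>In a class modulo p, of p q elements, the column forces p and the row forces q to divide
  the number of elements in each residue class modulo q. A nonempty such class therefore contains
  all p q elements.\<close>

lemma constant_classes:
  assumes D: "finite D" "card D = p ^ 2 * q" "vanishes D p"
    and M: "\<forall>j\<le>1. V D M j" "M \<ge> 2" and n: "\<forall>i\<le>1. V D i n" "n \<ge> 2"
    and xy: "x \<in> D" "y \<in> D" "[x = y] (mod p)"
  shows "[x = y] (mod q)"
proof -
  define u where "u = x mod p"
  let ?A = "res_class D p u"
  have u: "u < p" using p_pos by (simp add: u_def)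
  have fin: "finite ?A" using D(1) by simp
  have "p * card ?A = p * (p * q)"
    using card_class_if_vanishes[OF D(1,3) u] D(2) by (simp only: power2_eq_square mult.assoc)
  then have card: "card ?A = p * q" using p_pos by simp
  obtain M1 where M1: "M = Suc M1" "M1 \<ge> 1" using M(2) by (cases M) auto
  obtain n1 where n1: "n = Suc n1" "n1 \<ge> 1" using n(2) by (cases n) auto
  have "shift_inv D (p ^ Suc M1 * q ^ 1) (p ^ M1 * q ^ 1)"
    unfolding p_cycles_iff[OF D(1)] using M(1) M1 by simp
  then have s1: "shift_inv ?A (p ^ Suc M1 * q ^ 1) (p ^ M1 * q ^ 1)"
    using M1(2) by (intro shift_inv_res_class dvd_p_power) auto
  have "shift_inv D (p ^ 1 * q ^ Suc n1) (p ^ 1 * q ^ n1)"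
    unfolding q_cycles_iff[OF D(1)] using n(1) n1 by simp
  then have s2: "shift_inv ?A (p ^ 1 * q ^ Suc n1) (p ^ 1 * q ^ n1)"
    by (intro shift_inv_res_class dvd_p_power) auto
  have "q dvd p ^ M1 * q ^ 1" "q dvd p ^ 1 * q ^ n1" using n1(2) by simp_all
  then have d1: "p dvd cnt ?A q x" and d2: "q dvd cnt ?A q x"
    using p_cycles_dvd[OF fin s1] q_cycles_dvd[OF fin s2] by simp_all
  have "p * q dvd cnt ?A q x" by (rule divides_mult[OF d1 d2 coprime_pq])
  moreover have xA: "x \<in> ?A" and yA: "y \<in> ?A" using xy by (auto simp: res_class_def u_def cong_def)
  ultimately have "cnt ?A q x = card ?A"
    using cnt_pos[OF fin xA, of q] cnt_le_card[OF fin, of q x] card by (metis dvd_imp_le le_antisym)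
  then have "{a \<in> ?A. [a = x] (mod q)} = ?A" using fin unfolding cnt_def by (intro card_subset_eq) auto
  then have "[y = x] (mod q)" using yA by blast
  then show ?thesis by (rule cong_sym)
qed

lemma cong_solve_multiple:
  fixes a n d :: nat
  assumes "coprime a n"
  shows "\<exists>x. [x * a = d] (mod n)"
proof -
  obtain y where "[a * y = 1] (mod n)" using cong_solve_coprime_nat[OF assms] by auto
  then have "[a * y * d = 1 * d] (mod n)" by (rule cong_scalar_right)
  then show ?thesis by (intro exI[of _ "y * d"]) (simp add: mult_ac)
qed

text \<open>By \<open>constant_classes\<close> residues modulo q depend only on residues modulo p.
  For d in \<open>D\<close> prime to q, the pairs of residues (d, 0) and (0, d) modulo (p, q) are
  therefore not attained, and the four-point relation leaves no room for the element 0.\<close>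

lemma not_V_1_1:
  assumes D: "finite D" "card D = p ^ 2 * q" "vanishes D p" "0 \<in> D" "Gcd D = 1"
    and M: "\<forall>j\<le>1. V D M j" "M \<ge> 2" and n: "\<forall>i\<le>1. V D i n" "n \<ge> 2"
  shows "\<not> V D 1 1"
proof
  assume "V D 1 1"
  then have fp: "four_point D (p * q) q p"
    using four_point_if_V[OF D(1), of 0 0] by (simp add: mult.commute)
  have const: "[x = y] (mod q)" if "x \<in> D" "y \<in> D" "[x = y] (mod p)" for x y
    by (rule constant_classes[OF D(1,2,3) M n that])
  obtain d where d: "d \<in> D" "\<not> q dvd d" using ex_not_dvd_if_Gcd_1[OF D(5) q] by blast
  have "coprime q p" using coprime_pq by (simp only: coprime_commute)
  then obtain u where u: "[u * q = d] (mod p)" using cong_solve_multiple[of q p d] by auto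
  obtain v where v: "[v * p = d] (mod q)" using cong_solve_multiple[OF coprime_pq, of d] by auto
  have "cnt D (p * q) 0 + cnt D (p * q) (0 + u * q + v * p) = cnt D (p * q) (0 + u * q) + cnt D (p * q) (0 + v * p)"
    using fp unfolding four_point_def by blast
  moreover have "cnt D (p * q) 0 > 0" by (rule cnt_pos[OF D(1,4)])
  moreover have "cnt D (p * q) (0 + u * q) = 0"
  proof (rule ccontr)
    assume "cnt D (p * q) (0 + u * q) \<noteq> 0"
    then have "{a \<in> D. [a = 0 + u * q] (mod (p * q))} \<noteq> {}" unfolding cnt_def by (metis card.empty)
    then obtain a where a: "a \<in> D" "[a = u * q] (mod (p * q))" by auto
    have "[a = u * q] (mod p)" by (rule cong_dvd_modulus_nat[OF a(2)]) simp
    then have "[a = d] (mod p)" using u by (rule cong_trans)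
    then have "[a = d] (mod q)" by (rule const[OF a(1) d(1)])
    moreover have "[a = u * q] (mod q)" by (rule cong_dvd_modulus_nat[OF a(2)]) simp
    ultimately have "[d = 0] (mod q)" by (simp add: cong_def)
    then show False using d(2) by (simp add: cong_0_iff)
  qed
  moreover have "cnt D (p * q) (0 + v * p) = 0"
  proof (rule ccontr)
    assume "cnt D (p * q) (0 + v * p) \<noteq> 0"
    then have "{a \<in> D. [a = 0 + v * p] (mod (p * q))} \<noteq> {}" unfolding cnt_def by (metis card.empty)
    then obtain a where a: "a \<in> D" "[a = v * p] (mod (p * q))" by auto
    have "[a = v * p] (mod p)" by (rule cong_dvd_modulus_nat[OF a(2)]) simp
    then have "[a = 0] (mod p)" by (simp add: cong_def)
    then have "[a = 0] (mod q)" by (rule const[OF a(1) D(4)])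
    moreover have "[a = v * p] (mod q)" by (rule cong_dvd_modulus_nat[OF a(2)]) simp
    ultimately have "[d = 0] (mod q)" using v by (simp add: cong_def)
    then show False using d(2) by (simp add: cong_0_iff)
  qed
  ultimately show False by simp
qed

theorem structure_p:
  assumes D: "finite D" "card D = p ^ 2 * q" "vanishes D p" "0 \<in> D" "Gcd D = 1"
    and m: "m \<ge> 1" "V D (2 * m) 0" and n: "n \<ge> 1" "V D 0 n"
    and pu: "\<And>i. i \<ge> 1 \<Longrightarrow> V D i 0 \<Longrightarrow> i = 1 \<or> i = 2 * m"
    and qu: "\<And>j. j \<ge> 1 \<Longrightarrow> V D 0 j \<Longrightarrow> j = n"
    and lines: "\<And>\<alpha> \<beta>. \<exists>k\<ge>1. V D (2 * k - \<alpha>) (k - \<beta>)"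
  shows "((\<forall>j\<le>m. V D (2 * m) j) \<and> (\<forall>i\<le>2 * n - 1. V D i n)) \<or>
    (\<exists>t<m. (\<forall>j\<le>m - 1 - t. V D (2 * m) j) \<and> (\<forall>i\<le>2 * (n + t). V D i n))"
proof -
  \<comment> \<open>Off column 2 m, a zero to the right of column 1 and above the p-axis carries its
    whole row with it, down to the q-axis, where only height n is possible.\<close>
  have key: "j = n \<and> (\<forall>i'\<le>i. V D i' n)" if "V D i j" "i \<ge> 2" "j \<ge> 1" "i \<noteq> 2 * m" for i j
  proof -
    have *: "\<forall>i'\<le>i. V D i' j"
      using m that by (intro q_cycles_if_not_even_exponent[OF D(1-3), of "2 * m"]) auto
    then have "V D 0 j" by blast
    then have "j = n" using that(3) by (intro qu)
    then show ?thesis using * by simp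
  qed
  \<comment> \<open>The line through (1, n). Points with k < n are clipped to the q-axis at a wrong
    height; those with k > n lie in odd columns beyond 1, where \<open>key\<close> confines them to
    row n.\<close>
  have V1n: "V D 1 n"
  proof -
    obtain k where k: "k \<ge> 1" "V D (2 * k - (2 * n - 1)) (k - 0)" using lines[of "2 * n - 1" 0] by blast
    consider "k < n" | "k = n" | "k > n" by linarith
    then show ?thesis
    proof cases
      case 1
      then have e: "2 * k - (2 * n - 1) = 0" by simp
      have "V D 0 k" using k(2) unfolding e by simp
      then have "k = n" by (rule qu[OF k(1)])
      then show ?thesis using 1 by simp
    next
      case 2
      then have e: "2 * k - (2 * n - 1) = 1" using n(1) by simp
      show ?thesis using k(2) 2 unfolding e by simp
    next
      case 3
      define i where "i = 2 * k - (2 * n - 1)"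
      have "i = 2 * (k - n) + 1" using 3 n(1) by (simp add: i_def)
      then have "i \<ge> 2" "i \<noteq> 2 * m" using 3 by (simp, presburger)
      moreover have "V D i k" using k(2) by (simp add: i_def)
      ultimately have "k = n" using key k(1) by blast
      then show ?thesis using 3 by simp
    qed
  qed
  show ?thesis
  proof (cases "\<forall>j\<le>m. V D (2 * m) j")
    case True
    have "\<forall>i\<le>2 * n - 1. V D i n"
    proof (cases "n = 1")
      case True
      have "V D i n" if "i \<le> 2 * n - 1" for i
      proof -
        have "i = 0 \<or> i = 1" using that True by auto
        then show ?thesis using n(2) V1n by auto
      qed
      then show ?thesis by blast
    next
      case False
      have "i = 0 \<or> i = 1" if "i \<le> 1" for i :: nat using that by auto
      then have "\<forall>i\<le>1. V D i n" using n(2) V1n by metis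
      moreover have "\<forall>j\<le>1. V D (2 * m) j" using True m(1) by auto
      ultimately have n11: "\<not> V D 1 1"
        using not_V_1_1[OF D, of "2 * m" n] m(1) n(1) False by auto
      \<comment> \<open>The points (2 k - 1, k) lie in odd columns. As (1, 1) is excluded,
        \<open>key\<close> places the zero at k = n and fills row n up to 2 n - 1.\<close>
      obtain k where k: "k \<ge> 1" "V D (2 * k - 1) (k - 0)" using lines[of 1 0] by blast
      have "k \<noteq> 1" using k(2) n11 by auto
      then have k2: "k \<ge> 2" using k(1) by simp
      then have "2 * k - 1 \<ge> 2" by simp
      moreover have "2 * k - 1 \<noteq> 2 * m" using k2 by presburger
      moreover have "V D (2 * k - 1) k" using k(2) by simp
      ultimately have "k = n \<and> (\<forall>i'\<le>2 * k - 1. V D i' n)" using k(1) by (intro key)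
      then show ?thesis by auto
    qed
    then show ?thesis using True by blast
  next
    case False
    define j where "j = (LEAST j. \<not> V D (2 * m) j)"
    obtain j0 where j0: "j0 \<le> m" "\<not> V D (2 * m) j0" using False by blast
    have nj: "\<not> V D (2 * m) j" unfolding j_def by (rule LeastI[of _ j0]) (rule j0(2))
    have jm: "j \<le> m" using j0 Least_le[of "\<lambda>j. \<not> V D (2 * m) j" j0] by (simp add: j_def)
    have less: "V D (2 * m) j'" if "j' < j" for j'
      using not_less_Least[of j' "\<lambda>j. \<not> V D (2 * m) j"] that by (auto simp: j_def)
    have j1: "j \<ge> 1" using nj m(2) by (cases j) auto
    \<comment> \<open>The line through the lowest gap (2 m, j). For k at most m - j the zero would
      lie on the p-axis, and k = m is the gap itself; every other point must be in row n, which
      fixes k = n + (m - j).\<close>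
    obtain k where k: "k \<ge> 1" "V D (2 * k - 0) (k - (m - j))" using lines[of 0 "m - j"] by blast
    have "k > m - j"
    proof (rule ccontr)
      assume a: "\<not> k > m - j"
      then have "V D (2 * k) 0" using k(2) by simp
      then have "2 * k = 1 \<or> 2 * k = 2 * m" using k(1) by (intro pu) auto
      then have "k = m" by presburger
      then show False using a j1 jm m(1) by simp
    qed
    moreover have "k \<noteq> m"
    proof
      assume "k = m"
      then have "V D (2 * m) j" using k(2) jm by simp
      then show False using nj by simp
    qed
    ultimately have "k - (m - j) = n \<and> (\<forall>i'\<le>2 * k. V D i' n)"
      using k by (intro key) auto
    then have kn: "k = n + (m - j)" and Q: "\<forall>i'\<le>2 * k. V D i' n" using \<open>k > m - j\<close> by auto
    define t where "t = m - j"
    have "t < m" using j1 jm m(1) by (simp add: t_def)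
    moreover have "\<forall>j'\<le>m - 1 - t. V D (2 * m) j'"
      using less jm j1 by (auto simp: t_def)
    moreover have "\<forall>i\<le>2 * (n + t). V D i n" using Q kn by (simp add: t_def)
    ultimately show ?thesis by blast
  qed
qed

subsection \<open>Second case: equidistribution modulo \<open>q\<close>\<close>

text \<open>The residues of \<open>A\<close> modulo powers of p form a tree. Two vanishing levels
  split every occupied node into p equal parts, and with p^2 elements this uses up all
  branching.\<close>

lemma tree_counts:
  assumes A: "finite A" "card A = p ^ 2" "V A lo 0" "V A hi 0" and lh: "1 \<le> lo" "lo < hi" and x: "x \<in> A"
  shows "cnt A (p ^ k) x = (if k < lo then p ^ 2 else if k < hi then p else 1)"
proof -
  obtain l where l: "lo = Suc l" using lh by (cases lo) auto
  obtain h where h: "hi = Suc h" using lh by (cases hi) auto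
  have mono: "cnt A (p ^ k) x \<le> cnt A (p ^ k') x" if "k' \<le> k" for k k'
    using that by (intro cnt_coarse_le A(1) le_imp_power_dvd)
  have pos: "cnt A (p ^ k) x \<ge> 1" for k using cnt_pos[OF A(1) x, of "p ^ k"] by simp
  have step: "cnt A (p ^ i) x = p * cnt A (p ^ Suc i) x" if "V A (Suc i) 0" for i
  proof -
    have "shift_inv A (p ^ i * p) (p ^ i)"
      using shift_inv_if_vanishes_prime_power[OF A(1) p, of i] that by (simp add: mult.commute)
    then show ?thesis using cnt_shift_collapse[OF A(1), of "p ^ i" p x] p_pos by (simp add: mult.commute)
  qed
  have sl: "cnt A (p ^ l) x = p * cnt A (p ^ lo) x" and sh: "cnt A (p ^ h) x = p * cnt A (p ^ hi) x"
    using step A(3,4) l h by auto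
  have "l \<le> h" "lo \<le> h" using lh l h by auto
  have "cnt A (p ^ l) x \<le> p ^ 2" using cnt_le_card[OF A(1)] A(2) by simp
  then have "p * cnt A (p ^ lo) x \<le> p * p" using sl by (simp add: power2_eq_square)
  then have lo_le: "cnt A (p ^ lo) x \<le> p" using p_pos by simp
  have "p * cnt A (p ^ hi) x \<le> p * 1" using sh mono[OF \<open>lo \<le> h\<close>] lo_le by linarith
  then have "cnt A (p ^ hi) x \<le> 1" by (simp only: nat_mult_le_cancel1[OF p_pos])
  then have hi1: "cnt A (p ^ hi) x = 1" using pos[of hi] by simp
  then have hp: "cnt A (p ^ h) x = p" using sh by simp
  then have lop: "cnt A (p ^ lo) x = p" using mono[OF \<open>lo \<le> h\<close>] lo_le by simp
  then have lp: "cnt A (p ^ l) x = p ^ 2" using sl by (simp add: power2_eq_square)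
  consider "k \<le> l" | "lo \<le> k" "k \<le> h" | "hi \<le> k" using l h by linarith
  then show ?thesis
  proof cases
    case 1
    then show ?thesis using mono[OF 1] lp cnt_le_card[OF A(1), of "p ^ k" x] A(2) l by simp
  next
    case 2
    then show ?thesis using mono[OF 2(1)] mono[OF 2(2)] lop hp h by simp
  next
    case 3
    then show ?thesis using mono[OF 3] hi1 pos[of k] lh by simp
  qed
qed

lemma cnt_eq_imp_cong:
  assumes "finite A" "cnt A M x = cnt A N x" "M dvd N" "a \<in> A" "[a = x] (mod M)"
  shows "[a = x] (mod N)"
proof -
  have "{a \<in> A. [a = x] (mod N)} \<subseteq> {a \<in> A. [a = x] (mod M)}"
    using assms(3) by (auto intro: cong_dvd_modulus_nat)
  then have "{a \<in> A. [a = x] (mod N)} = {a \<in> A. [a = x] (mod M)}"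
    using assms(1,2) unfolding cnt_def by (intro card_subset_eq) auto
  then show ?thesis using assms(4,5) by blast
qed

text \<open>At a level without branching, residues modulo p^i determine those modulo p^(i+1), so a
  shift by \<open>h\<close>, which changes only the latter, leads to empty classes. The four-point
  relation then becomes invariance under \<open>k\<close>, making q divide p^2.\<close>

lemma exponent_lo_hi:
  assumes A: "finite A" "card A = p ^ 2" "V A lo 0" "V A hi 0" and lh: "1 \<le> lo" "lo < hi"
    and fp: "four_point A (p ^ Suc i * q ^ Suc j) (p ^ i * q ^ Suc j) (p ^ Suc i * q ^ j)"
  shows "Suc i = lo \<or> Suc i = hi"
proof (rule ccontr)
  assume ni: "\<not> ?thesis"
  define N h k where "N = p ^ Suc i * q ^ Suc j" and "h = p ^ i * q ^ Suc j" and "k = p ^ Suc i * q ^ j"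
  have stay: "[a = x] (mod p ^ Suc i)" if "a \<in> A" "x \<in> A" "[a = x] (mod p ^ i)" for a x
  proof (rule cnt_eq_imp_cong[OF A(1) _ _ that(1,3)])
    show "cnt A (p ^ i) x = cnt A (p ^ Suc i) x"
      using tree_counts[OF A lh that(2), of i] tree_counts[OF A lh that(2), of "Suc i"] ni by auto
  qed simp
  have zero: "cnt A N (y + h) = 0" if "x \<in> A" "[x = y] (mod p ^ Suc i)" for x y
  proof (rule ccontr)
    assume "cnt A N (y + h) \<noteq> 0"
    then have "{a \<in> A. [a = y + h] (mod N)} \<noteq> {}" unfolding cnt_def by (metis card.empty)
    then obtain a where a: "a \<in> A" "[a = y + h] (mod N)" by blast
    have a1: "[a = y + h] (mod p ^ Suc i)" using a(2) unfolding N_def by (rule cong_modulus_mult_nat)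
    then have "[a = y + h] (mod p ^ i)" by (rule cong_dvd_modulus_nat) simp
    also have "[y + h = y] (mod p ^ i)" by (simp add: h_def cong_def)
    also have "[y = x] (mod p ^ i)" using that(2) by (rule cong_sym[OF cong_dvd_modulus_nat]) simp
    finally have "[a = x] (mod p ^ Suc i)" using a(1) that(1) by (intro stay)
    then have "[y + h = x] (mod p ^ Suc i)" by (rule cong_trans[OF cong_sym[OF a1]])
    then have "[y + h = y] (mod p ^ Suc i)" using that(2) by (rule cong_trans)
    then have "[h = 0] (mod p ^ Suc i)" by (simp only: cong_add_lcancel_0_nat)
    then have "p ^ Suc i * q ^ 0 dvd p ^ i * q ^ Suc j" by (simp add: cong_0_iff h_def)
    then show False unfolding two_prime_powers_dvd_iff[OF p q pq] by simp
  qed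
  have "cnt A N (y + k) = cnt A N y" for y
  proof (cases "\<exists>x\<in>A. [x = y] (mod p ^ Suc i)")
    case True
    then obtain x where x: "x \<in> A" "[x = y] (mod p ^ Suc i)" by blast
    have "[x = y + k] (mod p ^ Suc i)" using x(2) by (simp add: k_def cong_def)
    then have "cnt A N (y + k + h) = 0" by (rule zero[OF x(1)])
    moreover have "cnt A N (y + h) = 0" by (rule zero[OF x])
    moreover have "cnt A N y + cnt A N (y + 1 * h + 1 * k) = cnt A N (y + 1 * h) + cnt A N (y + 1 * k)"
      using fp unfolding four_point_def N_def h_def k_def by blast
    ultimately show ?thesis by (simp add: add_ac)
  next
    case False
    have "cnt A N z = 0" if z: "[z = y] (mod p ^ Suc i)" for z
    proof -
      have "{a \<in> A. [a = z] (mod N)} = {}"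
      proof (rule ccontr)
        assume "\<not> ?thesis"
        then obtain a where "a \<in> A" "[a = z] (mod N)" by blast
        then have "[a = z] (mod p ^ Suc i)" unfolding N_def by (metis cong_modulus_mult_nat)
        then have "[a = y] (mod p ^ Suc i)" using z by (rule cong_trans)
        then show False using False \<open>a \<in> A\<close> by blast
      qed
      then show ?thesis unfolding cnt_def by (simp only: card.empty)
    qed
    moreover have "[y + k = y] (mod p ^ Suc i)" by (simp add: k_def cong_def)
    moreover have "[y = y] (mod p ^ Suc i)" by (rule cong_refl)
    ultimately show ?thesis by presburger
  qed
  then have "shift_inv A (p ^ Suc i * q ^ Suc j) (p ^ Suc i * q ^ j)"
    unfolding shift_inv_def N_def k_def by blast
  then have "q dvd cnt A 1 0" by (rule q_cycles_dvd[OF A(1)]) simp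
  then have "q dvd p ^ 2" using A(2) by simp
  then have "q dvd p" by (rule prime_dvd_power[OF q])
  then show False using primes_dvd_imp_eq[OF q p] pq by simp
qed

text \<open>An occupied class modulo N holds exactly \<mu> elements and exhausts its class modulo M.
  As M divides \<open>k\<close>, the class of x + k is then empty, and the four-point relation
  forces x + h to be occupied.\<close>

lemma pure_cycles:
  assumes A: "finite A" and fp: "four_point A N h k" and N: "N = p * h" "M dvd N" "M dvd k" "\<not> N dvd k" "N > 0"
    and mu: "\<mu> > 0" "\<And>x. \<mu> dvd cnt A N x" "\<And>x. cnt A M x \<le> \<mu>"
  shows "shift_inv A N h"
proof -
  have le: "cnt A N x \<le> \<mu>" for x using cnt_coarse_le[OF A N(2), of x] mu(3)[of x] by simp
  have eq: "cnt A N x = \<mu>" if "cnt A N x > 0" for x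
    using that mu(2)[of x] le[of x] by (simp add: dvd_imp_le antisym)
  have step: "cnt A N (x + h) = \<mu>" if "cnt A N x > 0" for x
  proof -
    have "cnt A N (x + k) = 0"
    proof (rule ccontr)
      assume "cnt A N (x + k) \<noteq> 0"
      then have c: "cnt A N (x + k) = \<mu>" using eq by simp
      have "{a \<in> A. [a = x] (mod N)} \<inter> {a \<in> A. [a = x + k] (mod N)} = {}"
      proof (rule ccontr)
        assume "\<not> ?thesis"
        then obtain a where a: "[a = x] (mod N)" "[a = x + k] (mod N)" by blast
        have "[x + k = x] (mod N)" by (rule cong_trans[OF cong_sym[OF a(2)] a(1)])
        then have "[k = 0] (mod N)" by (simp only: cong_add_lcancel_0_nat)
        then show False using N(4) by (simp add: cong_0_iff)
      qed
      then have "card ({a \<in> A. [a = x] (mod N)} \<union> {a \<in> A. [a = x + k] (mod N)}) = \<mu> + \<mu>"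
        using A c eq[OF that] unfolding cnt_def by (subst card_Un_disjoint) auto
      moreover have "{a \<in> A. [a = x] (mod N)} \<union> {a \<in> A. [a = x + k] (mod N)} \<subseteq> {a \<in> A. [a = x] (mod M)}"
      proof (intro subsetI)
        fix a assume "a \<in> {a \<in> A. [a = x] (mod N)} \<union> {a \<in> A. [a = x + k] (mod N)}"
        then have a: "a \<in> A" "[a = x] (mod M) \<or> [a = x + k] (mod M)"
          using cong_dvd_modulus_nat[OF _ N(2)] by auto
        have "[x + k = x] (mod M)" using N(3) by (simp add: cong_add_lcancel_0_nat cong_0_iff)
        then have "[a = x] (mod M)" using a(2) by (auto simp: cong_def)
        then show "a \<in> {a \<in> A. [a = x] (mod M)}" using a(1) by simp
      qed
      then have "card ({a \<in> A. [a = x] (mod N)} \<union> {a \<in> A. [a = x + k] (mod N)}) \<le> cnt A M x"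
        unfolding cnt_def using A by (intro card_mono) auto
      ultimately show False using mu(1) mu(3)[of x] by simp
    qed
    moreover have "cnt A N x + cnt A N (x + 1 * h + 1 * k) = cnt A N (x + 1 * h) + cnt A N (x + 1 * k)"
      using fp unfolding four_point_def by blast
    ultimately have "cnt A N (x + h) > 0" using that by simp
    then show ?thesis by (rule eq)
  qed
  have multi: "cnt A N (x + n * h) = \<mu>" if "cnt A N x > 0" for x n
  proof (induction n)
    case 0
    then show ?case using eq[OF that] by simp
  next
    case (Suc n)
    have "x + Suc n * h = (x + n * h) + h" by simp
    then show ?case using step[of "x + n * h"] Suc mu(1) by metis
  qed
  have "cnt A N (x + h) = cnt A N x" for x
  proof (cases "cnt A N x > 0")
    case True
    then show ?thesis using step eq by simp
  next
    case False
    have "cnt A N (x + h) = 0"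
    proof (rule ccontr)
      assume "cnt A N (x + h) \<noteq> 0"
      then have "cnt A N (x + h + (p - 1) * h) = \<mu>" by (intro multi) simp
      moreover have "x + h + (p - 1) * h = x + N" using p_pos N(1) by (cases p) (auto simp: algebra_simps)
      ultimately have "cnt A N (x + N) = \<mu>" by (simp only:)
      then show False using False mu(1) by simp
    qed
    then show ?thesis using False by simp
  qed
  then show ?thesis by (simp add: shift_inv_def)
qed

text \<open>\<mu> is the size of an occupied class modulo p^i given by \<open>tree_counts\<close>: p
  at the lower and 1 at the upper level.\<close>

lemma p_cycles_if_V:
  assumes D: "finite D" and cls: "\<And>w. w < q \<Longrightarrow> card (res_class D q w) = p ^ 2 \<and>
      V (res_class D q w) lo 0 \<and> V (res_class D q w) hi 0"
    and lh: "1 \<le> lo" "lo < hi" and i: "(i = lo \<and> \<mu> = p) \<or> (i = hi \<and> \<mu> = 1)"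
    and V: "V D i j" "V D i 0"
    and mu: "\<And>w x. w < q \<Longrightarrow> \<mu> dvd cnt (res_class D q w) (p ^ i * q ^ j) x"
  shows "\<forall>j'\<le>j. V D i j'"
proof (cases "j \<le> 1")
  case True
  have "V D i j'" if "j' \<le> j" for j'
  proof -
    have "j' = 0 \<or> j' = j" using that True by linarith
    then show ?thesis using V by metis
  qed
  then show ?thesis by blast
next
  case False
  then obtain j1 where j1: "j = Suc j1" "j1 \<ge> 1" by (cases j) auto
  have "i \<ge> 1" using i lh by auto
  then obtain i1 where i1: "i = Suc i1" by (cases i) auto
  define N where "N = p ^ Suc i1 * q ^ Suc j1"
  have fp: "four_point D N (p ^ i1 * q ^ Suc j1) (p ^ Suc i1 * q ^ j1)"
    unfolding N_def using V(1) D by (intro four_point_if_V) (simp_all only: i1 j1)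
  have dv: "q dvd N" "q dvd p ^ i1 * q ^ Suc j1" "q dvd p ^ Suc i1 * q ^ j1"
    unfolding N_def using j1(2) by simp_all
  have "shift_inv D N (p ^ i1 * q ^ Suc j1)"
  proof (rule shift_inv_if_res_class[OF q_pos dv(1,2)])
    fix w assume w: "w < q"
    let ?A = "res_class D q w"
    have fin: "finite ?A" using D by simp
    have le: "cnt ?A (p ^ Suc i1) x \<le> \<mu>" for x
    proof (cases "{a \<in> ?A. [a = x] (mod p ^ Suc i1)} = {}")
      case True
      then show ?thesis unfolding cnt_def by (simp only: card.empty le0)
    next
      case False
      then obtain a where a: "a \<in> ?A" "[a = x] (mod p ^ Suc i1)" by blast
      have "cnt ?A (p ^ Suc i1) x = cnt ?A (p ^ Suc i1) a" by (rule cnt_cong[OF cong_sym[OF a(2)]])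
      then show ?thesis using tree_counts[OF fin _ _ _ lh a(1), of "Suc i1"] cls[OF w] i i1 lh by auto
    qed
    show "shift_inv ?A N (p ^ i1 * q ^ Suc j1)"
    proof (rule pure_cycles[OF fin four_point_res_class[OF dv fp]])
      show "N = p * (p ^ i1 * q ^ Suc j1)" by (simp add: N_def)
      show "p ^ Suc i1 dvd N" "p ^ Suc i1 dvd p ^ Suc i1 * q ^ j1" by (simp_all only: N_def dvd_triv_left)
      show "\<not> N dvd p ^ Suc i1 * q ^ j1" unfolding N_def two_prime_powers_dvd_iff[OF p q pq] by simp
      show "N > 0" unfolding N_def by (rule N_pos)
      show "\<mu> > 0" using i p_pos by auto
      show "\<mu> dvd cnt ?A N x" for x using mu[OF w, of x] by (simp only: N_def i1 j1)
      show "cnt ?A (p ^ Suc i1) x \<le> \<mu>" for x by (rule le)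
    qed
  qed
  then show ?thesis unfolding N_def p_cycles_iff[OF D] i1 j1(1) .
qed

theorem structure_q:
  assumes D: "finite D" "card D = p ^ 2 * q" "vanishes D q" "0 \<in> D" "Gcd D = 1"
    and mn: "m \<ge> 1" "n \<ge> 1" "V D (2 * m) 0" "V D (2 * n + 1) 0"
    and cls: "\<And>w. w < q \<Longrightarrow> V (res_class D q w) (2 * m) 0 \<and> V (res_class D q w) (2 * n + 1) 0"
    and lines: "\<And>\<alpha> \<beta>. \<exists>k\<ge>1. V D (2 * k - \<alpha>) (k - \<beta>)"
  shows "(\<forall>j\<le>m. V D (2 * m) j) \<and> (\<forall>j\<le>n + 1. V D (2 * n + 1) j)"
proof -
  define lo hi where "lo = min (2 * m) (2 * n + 1)" and "hi = max (2 * m) (2 * n + 1)"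
  have "2 * m \<noteq> 2 * n + 1" by presburger
  then have lh: "lo < hi" "lo \<ge> 2" and
    lohi: "(lo = 2 * m \<and> hi = 2 * n + 1) \<or> (lo = 2 * n + 1 \<and> hi = 2 * m)"
    using mn by (auto simp: lo_def hi_def min_def max_def)
  have lo1: "1 \<le> lo" using lh by simp
  have cls': "card (res_class D q w) = p ^ 2 \<and> V (res_class D q w) lo 0 \<and> V (res_class D q w) hi 0"
    if w: "w < q" for w
  proof -
    have "q * card (res_class D q w) = q * p ^ 2"
      using two_primes.card_class_if_vanishes[OF swap D(1,3) w] D(2) by (simp only: mult.commute)
    then have "card (res_class D q w) = p ^ 2" using q_pos by simp
    then show ?thesis using cls[OF w] lohi by metis
  qed
  have fin: "finite (res_class D q w)" for w using D(1) by simp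
  have counts: "cnt (res_class D q w) (p ^ k) x = (if k < lo then p ^ 2 else if k < hi then p else 1)"
    if "w < q" "x \<in> res_class D q w" for w x k
    using tree_counts[OF fin _ _ _ lo1 lh(1) that(2)] cls'[OF that(1)] by blast
  have A: "i = lo \<or> i = hi" if V: "V D i j" "i \<ge> 1" "j \<ge> 2" for i j
  proof -
    obtain i1 where i1: "i = Suc i1" using V(2) by (cases i) auto
    obtain j1 where j1: "j = Suc j1" "j1 \<ge> 1" using V(3) by (cases j) auto
    have fp: "four_point D (p ^ Suc i1 * q ^ Suc j1) (p ^ i1 * q ^ Suc j1) (p ^ Suc i1 * q ^ j1)"
      using V(1) D(1) by (intro four_point_if_V) (simp_all only: i1 j1)
    have dv: "q dvd p ^ Suc i1 * q ^ Suc j1" "q dvd p ^ i1 * q ^ Suc j1" "q dvd p ^ Suc i1 * q ^ j1"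
      using j1(2) by simp_all
    have "Suc i1 = lo \<or> Suc i1 = hi"
      using cls'[OF q_pos] by (intro exponent_lo_hi[OF fin _ _ _ lo1 lh(1) four_point_res_class[OF dv fp]]) auto
    then show ?thesis using i1 by simp
  qed
  \<comment> \<open>Below \<open>lo\<close>, elements congruent modulo q are congruent modulo p^i. A
    zero at height 1 would then make all of \<open>D\<close> divisible by p^i, against gcd
    1.\<close>
  have B: "\<not> V D i 1" if i: "i \<ge> 1" "i < lo" for i
  proof
    assume V: "V D i 1"
    obtain i1 where i1: "i = Suc i1" using i(1) by (cases i) auto
    define N where "N = p ^ Suc i1 * q ^ Suc 0"
    have fp: "four_point D N (p ^ i1 * q ^ Suc 0) (p ^ Suc i1 * q ^ 0)"
      unfolding N_def using V D(1) by (intro four_point_if_V) (simp_all add: i1)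
    have const: "[x = y] (mod p ^ i)" if xy: "x \<in> D" "y \<in> D" "[x = y] (mod q)" for x y
    proof -
      define w where "w = y mod q"
      have w: "w < q" using q_pos by (simp add: w_def)
      have m: "x \<in> res_class D q w" "y \<in> res_class D q w" using xy by (auto simp: res_class_def w_def cong_def)
      have "cnt (res_class D q w) (p ^ i) y = card (res_class D q w)"
        using counts[OF w m(2), of i] cls'[OF w] i(2) by simp
      then have "{a \<in> res_class D q w. [a = y] (mod p ^ i)} = res_class D q w"
        using fin unfolding cnt_def by (intro card_subset_eq) auto
      then show ?thesis using m(1) by blast
    qed
    have all0: "[d = 0] (mod p ^ i)" if d: "d \<in> D" for d
    proof -
      have "coprime (p ^ i) q" using coprime_pq by simp
      then obtain v where v: "[v * p ^ i = d] (mod q)" using cong_solve_multiple[of "p ^ i" q d] by auto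
      have "cnt D N 0 + cnt D N (0 + 1 * (p ^ i1 * q ^ Suc 0) + v * (p ^ Suc i1 * q ^ 0)) =
          cnt D N (0 + 1 * (p ^ i1 * q ^ Suc 0)) + cnt D N (0 + v * (p ^ Suc i1 * q ^ 0))"
        using fp unfolding four_point_def by blast
      moreover have "cnt D N 0 > 0" by (rule cnt_pos[OF D(1,4)])
      moreover have "cnt D N (0 + 1 * (p ^ i1 * q ^ Suc 0)) = 0"
      proof (rule ccontr)
        assume "cnt D N (0 + 1 * (p ^ i1 * q ^ Suc 0)) \<noteq> 0"
        then have "{a \<in> D. [a = 0 + 1 * (p ^ i1 * q ^ Suc 0)] (mod N)} \<noteq> {}" unfolding cnt_def by (metis card.empty)
        then obtain a where a: "a \<in> D" "[a = p ^ i1 * q] (mod N)" by auto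
        have "[a = p ^ i1 * q] (mod q)" by (rule cong_dvd_modulus_nat[OF a(2)]) (simp add: N_def)
        then have "[a = 0] (mod q)" by (simp add: cong_def)
        then have "[a = 0] (mod p ^ i)" by (rule const[OF a(1) D(4)])
        moreover have "[a = p ^ i1 * q] (mod p ^ i)" by (rule cong_dvd_modulus_nat[OF a(2)]) (simp add: N_def i1)
        ultimately have "p ^ Suc i1 * q ^ 0 dvd p ^ i1 * q ^ 1" by (simp add: cong_def i1 mod_eq_0_iff_dvd)
        then show False unfolding two_prime_powers_dvd_iff[OF p q pq] by simp
      qed
      ultimately have "cnt D N (0 + v * (p ^ Suc i1 * q ^ 0)) \<noteq> 0" by simp
      then have "{a \<in> D. [a = 0 + v * (p ^ Suc i1 * q ^ 0)] (mod N)} \<noteq> {}" unfolding cnt_def by (metis card.empty)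
      then obtain e where e: "e \<in> D" "[e = v * p ^ i] (mod N)" by (auto simp: i1)
      have "[e = v * p ^ i] (mod q)" by (rule cong_dvd_modulus_nat[OF e(2)]) (simp add: N_def)
      then have "[e = d] (mod q)" using v by (rule cong_trans)
      then have ed: "[e = d] (mod p ^ i)" by (rule const[OF e(1) d])
      have "[e = v * p ^ i] (mod p ^ i)" by (rule cong_dvd_modulus_nat[OF e(2)]) (simp add: N_def i1)
      then show ?thesis using ed by (simp add: cong_def)
    qed
    obtain d where d: "d \<in> D" "\<not> p dvd d" using ex_not_dvd_if_Gcd_1[OF D(5) p] by blast
    have "p ^ i dvd d" using all0[OF d(1)] by (simp add: cong_0_iff)
    moreover have "p dvd p ^ i" using dvd_p_power[OF i(1), of 1] by simp
    ultimately show False using d(2) dvd_trans by blast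
  qed
  \<comment> \<open>The diagonal (2 k, k): for k >= 2 the column must be \<open>lo\<close> or
    \<open>hi\<close>, and parity selects 2 m. The point (2, 1) is possible only if m = 1.\<close>
  have Vm: "V D (2 * m) m"
  proof -
    obtain k where k: "k \<ge> 1" "V D (2 * k) k" using lines[of 0 0] by auto
    show ?thesis
    proof (cases "k = 1")
      case True
      then have "V D 2 1" using k(2) by simp
      then have "\<not> 2 < lo" using B[of 2] by auto
      then have "lo = 2" using lh by simp
      then have "m = 1" using lohi by presburger
      then show ?thesis using k(2) True by simp
    next
      case False
      then have "2 * k = lo \<or> 2 * k = hi" using k by (intro A[of "2 * k" k]) auto
      then have "k = m" using lohi by presburger
      then show ?thesis using k(2) by simp
    qed
  qed
  \<comment> \<open>The line (2 k - 1, k) meets only odd columns, and (1, 1) is excluded by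
    \<open>B\<close>.\<close>
  have Vn: "V D (2 * n + 1) (n + 1)"
  proof -
    obtain k where k: "k \<ge> 1" "V D (2 * k - 1) k" using lines[of 1 0] by auto
    have "k \<noteq> 1"
    proof
      assume "k = 1"
      then have "V D 1 1" using k(2) by simp
      then show False using B[of 1] lh by simp
    qed
    then have "2 * k - 1 = lo \<or> 2 * k - 1 = hi" using k by (intro A[of "2 * k - 1" k]) auto
    then have kn: "k = n + 1" using lohi k(1) by presburger
    then have "2 * k - 1 = 2 * n + 1" by simp
    then show ?thesis using k(2) kn by simp
  qed
  define yl yh where "yl = (if lo = 2 * m then m else n + 1)" and "yh = (if hi = 2 * m then m else n + 1)"
  have yle: "yl \<le> yh" using lohi lh(1) unfolding yl_def yh_def by (auto split: if_splits)
  have Vlo: "V D lo yl" "V D lo 0" and Vhi: "V D hi yh" "V D hi 0"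
    using lohi Vm Vn mn(3,4) \<open>2 * m \<noteq> 2 * n + 1\<close> unfolding yl_def yh_def by auto
  \<comment> \<open>The upper column comes first because there \<mu> = 1 divides everything. Its
    cycles then supply the divisibility by p that the lower column needs.\<close>
  have H: "\<forall>j'\<le>yh. V D hi j'"
    by (rule p_cycles_if_V[OF D(1) cls' lo1 lh(1) _ Vhi, of 1]) auto
  obtain h1 where h1: "hi = Suc h1" using lh by (cases hi) auto
  have L: "\<forall>j'\<le>yl. V D lo j'"
  proof (cases "yl = 0 \<or> yl = 1")
    case True
    have "V D lo j'" if "j' \<le> yl" for j'
    proof -
      have "j' = 0 \<or> j' = yl" using that True by linarith
      then show ?thesis using Vlo by metis
    qed
    then show ?thesis by blast
  next
    case False
    have "yh \<ge> 1" using False yle by linarith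
    have inv: "shift_inv D (p ^ Suc h1 * q ^ yh) (p ^ h1 * q ^ yh)"
      unfolding p_cycles_iff[OF D(1)] using H h1 by simp
    have dv: "q dvd p ^ Suc h1 * q ^ yh" "q dvd p ^ h1 * q ^ yh" using \<open>yh \<ge> 1\<close> by simp_all
    have "p ^ lo * q ^ yl dvd p ^ h1 * q ^ yh"
      unfolding two_prime_powers_dvd_iff[OF p q pq] using lh(1) h1 yle by simp
    then have "p dvd cnt (res_class D q w) (p ^ lo * q ^ yl) x" for w x
      by (rule p_cycles_dvd[OF fin shift_inv_res_class[OF dv inv]])
    then show ?thesis
      by (intro p_cycles_if_V[OF D(1) cls' lo1 lh(1) _ Vlo, of p]) auto
  qed
  show ?thesis
  proof (cases "lo = 2 * m")
    case True
    then have "hi = 2 * n + 1" "yl = m" "yh = n + 1" using lohi \<open>2 * m \<noteq> 2 * n + 1\<close> by (auto simp: yl_def yh_def)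
    then show ?thesis using H L True by simp
  next
    case False
    then have "hi = 2 * m" "lo = 2 * n + 1" "yl = n + 1" "yh = m" using lohi by (auto simp: yl_def yh_def)
    then show ?thesis using H L by simp
  qed
qed

end

section \<open>Building modulo product-forms from column and row segments\<close>

subsection \<open>Peeling off cycles\<close>

lemma set_cong_if_cnt:
  assumes X: "finite X" and Y: "finite Y" and N: "N > 0" and eq: "\<And>x. x < N \<Longrightarrow> cnt X N x = cnt Y N x"
  shows "set_cong N X Y"
proof -
  let ?X = "\<lambda>x. {a \<in> X. a mod N = x}" and ?Y = "\<lambda>x. {a \<in> Y. a mod N = x}"
  have "\<exists>f. bij_betw f (?X x) (?Y x)" if "x < N" for x
  proof (rule finite_same_card_bij)
    show "card (?X x) = card (?Y x)" using eq[OF that] that by (simp add: cnt_def cong_def)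
  qed (use X Y in auto)
  then have "\<exists>F. \<forall>x<N. bij_betw (F x) (?X x) (?Y x)" by metis
  then obtain F where F: "\<And>x. x < N \<Longrightarrow> bij_betw (F x) (?X x) (?Y x)" by blast
  define f where "f = (\<lambda>a. F (a mod N) a)"
  have f: "f a \<in> Y \<and> f a mod N = a mod N" if "a \<in> X" for a
  proof -
    have "F (a mod N) a \<in> ?Y (a mod N)"
      using bij_betwE[OF F[of "a mod N"]] N that by simp
    then show ?thesis by (simp add: f_def)
  qed
  have "inj_on f X"
  proof (rule inj_onI)
    fix a c assume ac: "a \<in> X" "c \<in> X" "f a = f c"
    have "f a mod N = a mod N" "f c mod N = c mod N" using f ac(1,2) by auto
    then have m: "a mod N = c mod N" using ac(3) by simp
    have "inj_on (F (a mod N)) (?X (a mod N))" using F[of "a mod N"] N by (simp add: bij_betw_def)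
    moreover have "F (a mod N) a = F (a mod N) c" using ac(3) unfolding f_def m .
    moreover have "a \<in> ?X (a mod N)" "c \<in> ?X (a mod N)" using ac(1,2) m[symmetric] by blast+
    ultimately show "a = c" by (rule inj_onD)
  qed
  moreover have "f ` X = Y"
  proof (intro equalityI subsetI)
    fix y assume y: "y \<in> Y"
    have "F (y mod N) ` ?X (y mod N) = ?Y (y mod N)" using F[of "y mod N"] N by (simp add: bij_betw_def)
    then have "y \<in> F (y mod N) ` ?X (y mod N)" using y by simp
    then obtain a where "a \<in> X" "a mod N = y mod N" "y = F (y mod N) a" by auto
    then show "y \<in> f ` X" by (intro image_eqI[of _ _ a]) (simp_all add: f_def)
  qed (use f in auto)
  ultimately have "bij_betw f X Y" by (simp add: bij_betw_def)
  moreover have "\<forall>a\<in>X. [a = f a] (mod N)" using f by (simp add: cong_def)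
  ultimately show ?thesis unfolding set_cong_def by blast
qed

definition ap :: "nat \<Rightarrow> nat \<Rightarrow> nat set" where
  "ap g r = (\<lambda>v. g * v) ` {..<r}"

lemma finite_ap [simp]: "finite (ap g r)"
  by (simp add: ap_def)

text \<open>The representatives are multiplied by \<open>N + 1\<close> to make the sums distinct as natural numbers.\<close>

lemma peel_cycles:
  assumes A: "finite A" and pos: "h > 0" "r > 0" and inv: "shift_inv A (h * r) h"
  obtains R where "finite R" "cong_direct_sum (h * r) A R (ap h r)"
    "\<forall>M x. M dvd h \<longrightarrow> cnt A M x = r * cnt R M x"
proof -
  define N where "N = h * r"
  have N: "N > 0" using pos by (simp add: N_def)
  \<comment> \<open>One residue from every cycle: exactly one of x, x + h, ..., x + (r - 1) h is
    less than \<open>h\<close> modulo N.\<close>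
  define R0 where "R0 = {a \<in> A. a mod N < h}"
  define R where "R = (\<lambda>a. a * (N + 1)) ` R0"
  have finR0: "finite R0" using A by (simp add: R0_def)
  have finR: "finite R" using finR0 by (simp add: R_def)
  have injm: "inj_on (\<lambda>a. a * (N + 1)) X" for X
    by (rule inj_onI) (simp only: mult_cancel2, simp)
  have cR: "cnt R M x = cnt R0 M x" if "M dvd N" for M x
  proof -
    obtain c where "N = M * c" using \<open>M dvd N\<close> by blast
    then have "a * (N + 1) = a + M * (a * c)" for a by (simp add: algebra_simps)
    then have "(a * (N + 1)) mod M = a mod M" for a by (simp only: mod_mult_self2)
    then have e: "[a * (N + 1) = x] (mod M) \<longleftrightarrow> [a = x] (mod M)" for a by (simp only: cong_def)
    have "{c \<in> R. [c = x] (mod M)} = (\<lambda>a. a * (N + 1)) ` {a \<in> R0. [a = x] (mod M)}"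
      unfolding R_def using e by auto
    then show ?thesis unfolding cnt_def using card_image[OF injm] by simp
  qed
  have R0N: "cnt R0 N x = cnt A N x" if "x < h" for x
  proof -
    have "{a \<in> R0. [a = x] (mod N)} = {a \<in> A. [a = x] (mod N)}"
    proof -
      have "h \<le> N" using pos by (simp add: N_def)
      then have "x mod N = x" using that by simp
      then show ?thesis using that by (auto simp: R0_def cong_def)
    qed
    then show ?thesis by (simp add: cnt_def)
  qed
  have Rh: "cnt A h x = r * cnt R h x" for x
  proof -
    define y where "y = x mod h"
    have y: "y < h" using pos by (simp add: y_def)
    have "cnt R0 h y = cnt A N y"
    proof -
      have "a mod N < h \<and> a mod h = y \<longleftrightarrow> a mod N = y" for a
      proof -
        have "a mod N mod h = a mod h" by (rule mod_mod_cancel) (simp add: N_def)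
        then show ?thesis using y by (metis mod_less)
      qed
      moreover have "h \<le> N" using pos by (simp add: N_def)
      ultimately have "{a \<in> R0. [a = y] (mod h)} = {a \<in> A. [a = y] (mod N)}"
        unfolding R0_def cong_def using y by auto
      then show ?thesis by (simp add: cnt_def)
    qed
    moreover have "cnt A h y = r * cnt A N y"
      using cnt_shift_collapse[OF A pos inv] by (simp add: N_def)
    moreover have "cnt R h y = cnt R0 h y" by (rule cR) (simp add: N_def)
    ultimately have "cnt A h y = r * cnt R h y" by simp
    then show ?thesis by (simp add: y_def cnt_mod)
  qed
  have clause: "cnt A M x = r * cnt R M x" if "M dvd h" for M x
  proof -
    obtain c where c: "h = M * c" using \<open>M dvd h\<close> by blast
    then have "M > 0" "c > 0" using pos by auto
    then show ?thesis
      using cnt_refine[OF A, of M c x] cnt_refine[OF finR, of M c x] Rh c by (simp add: sum_distrib_left)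
  qed
  define Z where "Z = (\<lambda>(x, y). x + y) ` (R \<times> ap h r)"
  have apN: "y < N" if "y \<in> ap h r" for y
    using that pos by (auto simp: ap_def N_def)
  have inj: "inj_on (\<lambda>(x, y). x + y) (R \<times> ap h r)"
  proof -
    have *: "a = c" if le: "a \<le> c" and eq: "a * (N + 1) + y = c * (N + 1) + z" and y: "y < N" for a c y z :: nat
    proof (rule ccontr)
      assume "a \<noteq> c"
      then have "(a + 1) * (N + 1) \<le> c * (N + 1)" using le by (intro mult_le_mono1) simp
      then show False using eq y by (simp add: algebra_simps)
    qed
    have "(x, y) = (x', y')" if m: "x \<in> R" "x' \<in> R" "y \<in> ap h r" "y' \<in> ap h r" "x + y = x' + y'" for x y x' y'
    proof -
      obtain a c where ac: "x = a * (N + 1)" "x' = c * (N + 1)" using m by (auto simp: R_def)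
      have "a = c"
      proof (cases "a \<le> c")
        case True
        then show ?thesis using m(5) apN[OF m(3)] unfolding ac by (rule *)
      next
        case False
        then have "c = a" using m(5)[symmetric] apN[OF m(4)] unfolding ac by (intro *[of c a y' y]) auto
        then show ?thesis by simp
      qed
      then show ?thesis using m(5) ac by simp
    qed
    then show ?thesis unfolding inj_on_def by auto
  qed
  have "set_cong N A Z"
  proof (rule set_cong_if_cnt[OF A _ N])
    show "finite Z" using finR by (simp add: Z_def)
    fix x assume x: "x < N"
    define x0 v0 where "x0 = x mod h" and "v0 = x div h"
    have x0: "x0 < h" using pos by (simp add: x0_def)
    have v0: "v0 < r" using x by (simp add: v0_def N_def less_mult_imp_div_less mult.commute)
    have xe: "x = x0 + v0 * h" by (simp add: x0_def v0_def)
    have key: "[a * (N + 1) + h * v = x] (mod N) \<longleftrightarrow> [a * (N + 1) = x0] (mod N) \<and> v = v0"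
      if a: "a \<in> R0" and v: "v < r" for a v
    proof -
      have aN: "(a * (N + 1)) mod N = a mod N" by (simp add: algebra_simps)
      have lt: "a mod N < h" using a by (simp add: R0_def)
      have "(v + 1) * h \<le> r * h" using v by (intro mult_le_mono1) simp
      then have "a mod N + h * v < N" using lt by (simp add: N_def algebra_simps)
      then have "(a * (N + 1) + h * v) mod N = a mod N + h * v"
        using aN by (metis mod_add_left_eq mod_less)
      then have "[a * (N + 1) + h * v = x] (mod N) \<longleftrightarrow> a mod N + h * v = x0 + h * v0"
        using x xe by (simp add: cong_def mult.commute)
      also have "\<dots> \<longleftrightarrow> a mod N = x0 \<and> v = v0"
      proof
        assume e: "a mod N + h * v = x0 + h * v0"
        then have "(a mod N + h * v) mod h = (x0 + h * v0) mod h" by simp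
        then have "a mod N = x0" using lt x0 by simp
        then show "a mod N = x0 \<and> v = v0" using e pos by simp
      qed simp
      also have "\<dots> \<longleftrightarrow> [a * (N + 1) = x0] (mod N) \<and> v = v0"
      proof -
        have "h \<le> N" using pos by (simp add: N_def)
        then have "x0 mod N = x0" using x0 by simp
        then show ?thesis unfolding cong_def aN by simp
      qed
      finally show ?thesis .
    qed
    have "{z \<in> Z. [z = x] (mod N)} = (\<lambda>c. c + h * v0) ` {c \<in> R. [c = x0] (mod N)}"
    proof (intro equalityI subsetI)
      fix z assume z: "z \<in> {z \<in> Z. [z = x] (mod N)}"
      then obtain a v where av: "a \<in> R0" "v < r" "z = a * (N + 1) + h * v"
        by (auto simp: Z_def R_def ap_def)
      then have "[a * (N + 1) = x0] (mod N) \<and> v = v0" using z key[OF av(1,2)] by simp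
      then show "z \<in> (\<lambda>c. c + h * v0) ` {c \<in> R. [c = x0] (mod N)}"
        using av by (intro image_eqI[of _ _ "a * (N + 1)"]) (auto simp: R_def)
    next
      fix z assume "z \<in> (\<lambda>c. c + h * v0) ` {c \<in> R. [c = x0] (mod N)}"
      then obtain a where a: "a \<in> R0" "[a * (N + 1) = x0] (mod N)" "z = a * (N + 1) + h * v0"
        by (auto simp: R_def)
      then have "[z = x] (mod N)" using key[OF a(1) v0] by simp
      moreover have "z \<in> Z" unfolding Z_def
        by (rule image_eqI[of _ _ "(a * (N + 1), h * v0)"]) (use a v0 in \<open>auto simp: R_def ap_def\<close>)
      ultimately show "z \<in> {z \<in> Z. [z = x] (mod N)}" by simp
    qed
    then have "cnt Z N x = cnt R N x0"
      unfolding cnt_def by (simp add: card_image)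
    also have "\<dots> = cnt R0 N x0" by (rule cR) simp
    also have "\<dots> = cnt A N x0" by (rule R0N[OF x0])
    also have "\<dots> = cnt A N x" unfolding xe using cnt_shift_mult[OF inv, of x0 v0] by (simp add: N_def)
    finally show "cnt A N x = cnt Z N x" by simp
  qed
  moreover have "bij_betw (\<lambda>(x, y). x + y) (R \<times> ap h r) Z"
    using inj by (simp add: bij_betw_def Z_def)
  ultimately have "cong_direct_sum (h * r) A R (ap h r)"
    unfolding cong_direct_sum_def N_def by blast
  then show thesis using finR clause by (intro that) blast+
qed

lemma shift_inv_quotient:
  assumes "\<forall>M x. M dvd h \<longrightarrow> cnt A M x = r * cnt R M x" "r > 0" "N dvd h" "shift_inv A N k"
  shows "shift_inv R N k"
  using assms unfolding shift_inv_def by auto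

text \<open>The progression with the largest modulus is removed first, since the other invariances
  live modulo divisors of its step and pass to the quotient. What finally remains has
  \<open>r0\<close> elements, equidistributed modulo \<open>r0\<close>.\<close>

lemma peel_chain:
  assumes A: "finite A" "card A = r0 * r1 * r2" and pos: "r0 > 0" "h1 > 0" "r1 > 0" "h2 > 0" "r2 > 0"
    and inv: "shift_inv A r0 1" "shift_inv A (h1 * r1) h1" "shift_inv A (h2 * r2) h2"
    and dvd: "r0 dvd h1" "h1 * r1 dvd h2"
  obtains R0 R1 where "set_cong r0 R0 (ap 1 r0)" "cong_direct_sum (h1 * r1) R1 R0 (ap h1 r1)"
    "cong_direct_sum (h2 * r2) A R1 (ap h2 r2)"
proof -
  have d0: "r0 dvd h2" using dvd by (meson dvd_mult_left dvd_trans)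
  obtain R1 where R1: "finite R1"
    "cong_direct_sum (h2 * r2) A R1 (ap h2 r2)" and c1: "\<forall>M x. M dvd h2 \<longrightarrow> cnt A M x = r2 * cnt R1 M x"
    by (rule peel_cycles[OF A(1) pos(4,5) inv(3)]) (rule that)
  have i1: "shift_inv R1 (h1 * r1) h1" "shift_inv R1 r0 1"
    using shift_inv_quotient[OF c1 pos(5)] dvd(2) d0 inv by auto
  obtain R0 where R0: "finite R0"
    "cong_direct_sum (h1 * r1) R1 R0 (ap h1 r1)" and c0: "\<forall>M x. M dvd h1 \<longrightarrow> cnt R1 M x = r1 * cnt R0 M x"
    by (rule peel_cycles[OF R1(1) pos(2,3) i1(1)]) (rule that)
  have i0: "shift_inv R0 (1 * r0) 1"
    using shift_inv_quotient[OF c0 pos(3)] dvd(1) i1(2) by simp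
  have "card A = r2 * (r1 * card R0)" using c1[rule_format, of 1 0] c0[rule_format, of 1 0] by simp
  then have "r1 * r2 * card R0 = r1 * r2 * r0" using A(2) by (simp only: mult_ac)
  then have cR0: "card R0 = r0" using pos by simp
  have one: "cnt R0 r0 x = 1" for x
    using cnt_shift_collapse[OF R0(1) _ pos(1) i0, of x] cR0 pos(1) by simp
  have "set_cong r0 R0 (ap 1 r0)"
  proof (rule set_cong_if_cnt[OF R0(1) finite_ap pos(1)])
    fix x assume x: "x < r0"
    have "{a \<in> ap 1 r0. [a = x] (mod r0)} = {x}" using x by (auto simp: ap_def cong_def)
    then show "cnt R0 r0 x = cnt (ap 1 r0) r0 x" unfolding one by (simp add: cnt_def)
  qed
  then show thesis using R0(2) R1(2) by (rule that)
qed

subsection \<open>Kernel polynomials\<close>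

lemma set_cong_dvd: "set_cong N X Y \<Longrightarrow> M dvd N \<Longrightarrow> set_cong M X Y"
  unfolding set_cong_def by (meson cong_dvd_modulus_nat)

lemma cong_direct_sum_dvd: "cong_direct_sum N W X Y \<Longrightarrow> M dvd N \<Longrightarrow> cong_direct_sum M W X Y"
  unfolding cong_direct_sum_def by (meson set_cong_dvd)

lemma poly_kernel_eq_0D:
  assumes "poly (kernel_poly b l S i) z = 0" "\<And>j s. j \<le> i \<Longrightarrow> s \<in> S j \<Longrightarrow> s \<ge> 1"
  shows "\<exists>j\<le>i. \<exists>s\<in>S j. prim_root s (z ^ b ^ l j)"
proof -
  have "(\<Prod>j\<le>i. \<Prod>s\<in>S j. poly (cyclotomic s) (z ^ b ^ l j)) = 0"
    using assms(1) by (simp add: kernel_poly_def poly_prod poly_pcompose poly_monom)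
  then obtain j where j: "j \<le> i" "(\<Prod>s\<in>S j. poly (cyclotomic s) (z ^ b ^ l j)) = 0" by auto
  \<comment> \<open>A product over an infinite index set is 1, so a zero product shows that the
    index set is finite.\<close>
  then have "finite (S j)" by (metis prod.infinite zero_neq_one)
  then obtain s where s: "s \<in> S j" "poly (cyclotomic s) (z ^ b ^ l j) = 0" using j(2) by auto
  have "s > 0" using assms(2)[OF j(1) s(1)] by simp
  then show ?thesis using j s poly_cyclotomic_eq_0_iff by blast
qed

text \<open>A multiple of the modulus is all that matters, because a congruence modulo a multiple
  implies the required one.\<close>

lemma kernel_modulus_dvd:
  assumes "\<And>j s. j \<le> i \<Longrightarrow> s \<in> S j \<Longrightarrow> s \<ge> 1 \<and> b ^ l j * s dvd N"
  shows "kernel_modulus (kernel_poly b l S i) dvd N"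
  unfolding kernel_modulus_def
proof (rule Lcm_least)
  fix t assume t: "t \<in> {s. 1 \<le> s \<and> cyclotomic s dvd kernel_poly b l S i}"
  then have pr: "prim_root t (rou 1 t)" by (intro prim_root_rou_1) simp
  have "poly (kernel_poly b l S i) (rou 1 t) = 0"
    using t pr cyclotomic_dvd_iff[of t "kernel_poly b l S i"] by simp
  then obtain j s where js: "j \<le> i" "s \<in> S j" "prim_root s (rou 1 t ^ b ^ l j)"
    using poly_kernel_eq_0D assms by blast
  have "rou 1 t ^ (b ^ l j * s) = 1" using prim_root_power_eq_1[OF js(3), of s] by (simp add: power_mult)
  then have "t dvd b ^ l j * s" using pr by (simp add: prim_root_power_eq_1)
  then show "t dvd N" using assms[OF js(1,2)] dvd_trans by blast
qed

subsection \<open>Mixed radix systems\<close>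

lemma esum_ap: "g > 0 \<Longrightarrow> esum (ap g r) z = (\<Sum>v<r. (z ^ g) ^ v)"
  unfolding esum_def ap_def by (subst sum.reindex) (auto simp: inj_on_def power_mult)

lemma vanishes_ap_dvd:
  assumes "vanishes (ap g r) s" "g > 0" "s \<ge> 1"
  shows "s dvd g * r"
proof -
  have pr: "prim_root s (rou 1 s)" using assms(3) by (intro prim_root_rou_1) simp
  define w where "w = rou 1 s ^ g"
  have "(\<Sum>v<r. w ^ v) = 0" using assms(1,2) pr by (simp add: vanishes_def esum_ap w_def)
  then have "w ^ r - 1 = 0" using power_diff_1_eq[of w r] by simp
  then have "rou 1 s ^ (g * r) = 1" by (simp add: w_def power_mult)
  then show ?thesis using pr by (simp add: prim_root_power_eq_1)
qed

lemma vanishes_ap: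
  assumes "g > 0" "s dvd g * r" "\<not> s dvd g"
  shows "vanishes (ap g r) s"
  unfolding vanishes_def
proof (intro allI impI)
  fix z assume z: "prim_root s z"
  have "z ^ g \<noteq> 1" "(z ^ g) ^ r = 1" using z assms by (simp_all add: prim_root_power_eq_1 flip: power_mult)
  then show "esum (ap g r) z = 0" using assms(1) by (simp add: esum_ap geometric_sum)
qed

definition radix_factors :: "nat \<Rightarrow> nat \<Rightarrow> nat \<Rightarrow> nat \<Rightarrow> nat \<Rightarrow> nat \<Rightarrow> nat set" where
  "radix_factors r0 g1 r1 g2 r2 i = (if i = 0 then ap 1 r0 else if i = 1 then ap g1 r1 else ap g2 r2)"

definition radix_set :: "nat \<Rightarrow> nat \<Rightarrow> nat \<Rightarrow> nat \<Rightarrow> nat \<Rightarrow> nat set" where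
  "radix_set r0 g1 r1 g2 r2 = (\<lambda>(a, c, d). a + c + d) ` (ap 1 r0 \<times> ap g1 r1 \<times> ap g2 r2)"

text \<open>The final disjunction leaves open which of the two upper progressions is coarser: the
  shifts by powers of \<open>b\<close> may reverse their order.\<close>

definition radix_ok :: "nat \<Rightarrow> nat \<Rightarrow> nat \<Rightarrow> nat \<Rightarrow> nat \<Rightarrow> bool" where
  "radix_ok r0 g1 r1 g2 r2 \<longleftrightarrow> 0 < r0 \<and> 0 < g1 \<and> 0 < r1 \<and> 0 < g2 \<and> 0 < r2 \<and>
     r0 dvd g1 \<and> r0 dvd g2 \<and> (g1 * r1 dvd g2 \<or> g2 * r2 dvd g1)"

text \<open>The digits are read off successively: the lowest modulo \<open>r0\<close>, the next
  modulo \<open>r\<close> after division by \<open>u\<close>.\<close>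

lemma radix_unique:
  fixes u v w x :: nat
  assumes "r0 dvd u" "u * r dvd w" "u > 0" "w > 0" "a < r0" "a' < r0" "v < r" "v' < r"
    and eq: "a + u * v + w * x = a' + u * v' + w * x'"
  shows "a = a' \<and> v = v' \<and> x = x'"
proof -
  have rw: "r0 dvd w" using assms(1,2) by (meson dvd_mult_left dvd_trans)
  have "(a + u * v + w * x) mod r0 = a" if "a < r0" for a v x
  proof -
    have "r0 dvd u * v + w * x" using assms(1) rw by (intro dvd_add dvd_mult2)
    then obtain c where "u * v + w * x = r0 * c" by blast
    then show ?thesis using that by (simp add: add.assoc)
  qed
  then have a: "a = a'" using eq assms(5,6) by metis
  then have e: "u * v + w * x = u * v' + w * x'" using eq by simp
  obtain c where c: "w = u * r * c" using assms(2) by blast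
  have "u * (v + r * (c * x)) = u * (v' + r * (c * x'))" using e by (simp add: c algebra_simps)
  then have e2: "v + r * (c * x) = v' + r * (c * x')" using assms(3) by simp
  then have "(v + r * (c * x)) mod r = (v' + r * (c * x')) mod r" by simp
  then have v: "v = v'" using assms(7,8) by simp
  then have "w * x = w * x'" using e by simp
  then show ?thesis using a v assms(4) by simp
qed

lemma radix_inj:
  assumes ok: "radix_ok r0 g1 r1 g2 r2"
    and "a \<in> ap 1 r0" "a' \<in> ap 1 r0" "c \<in> ap g1 r1" "c' \<in> ap g1 r1" "d \<in> ap g2 r2" "d' \<in> ap g2 r2"
    and "a + c + d = a' + c' + d'"
  shows "a = a' \<and> c = c' \<and> d = d'"
proof -
  obtain v v' where v: "c = g1 * v" "c' = g1 * v'" "v < r1" "v' < r1" using assms by (auto simp: ap_def)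
  obtain x x' where x: "d = g2 * x" "d' = g2 * x'" "x < r2" "x' < r2" using assms by (auto simp: ap_def)
  have a: "a < r0" "a' < r0" using assms by (auto simp: ap_def)
  from ok consider "g1 * r1 dvd g2" | "g2 * r2 dvd g1" by (auto simp: radix_ok_def)
  then show ?thesis
  proof cases
    case 1
    then have "a = a' \<and> v = v' \<and> x = x'"
      using ok a v x assms(8) by (intro radix_unique[of r0 g1 r1 g2]) (auto simp: radix_ok_def)
    then show ?thesis using v x by simp
  next
    case 2
    have "a + g2 * x + g1 * v = a' + g2 * x' + g1 * v'" using assms(8) v x by simp
    then have "a = a' \<and> x = x' \<and> v = v'"
      using ok a v x 2 by (intro radix_unique[of r0 g2 r2 g1]) (auto simp: radix_ok_def)
    then show ?thesis using v x by simp
  qed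
qed

lemma atMost_2: "{..2 :: nat} = {0, 1, 2}"
  by auto

lemma is_direct_sum_radix:
  assumes ok: "radix_ok r0 g1 r1 g2 r2"
  shows "is_direct_sum (radix_set r0 g1 r1 g2 r2) 2 (radix_factors r0 g1 r1 g2 r2)"
proof -
  let ?F = "radix_factors r0 g1 r1 g2 r2"
  have sum: "(\<Sum>i\<le>2. e i) = e 0 + e 1 + e 2" for e :: "nat \<Rightarrow> nat" by (simp add: atMost_2)
  have mem: "e 0 \<in> ap 1 r0 \<and> e 1 \<in> ap g1 r1 \<and> e 2 \<in> ap g2 r2" if "e \<in> PiE {..2} ?F" for e
    using PiE_mem[OF that, of 0] PiE_mem[OF that, of 1] PiE_mem[OF that, of 2] by (simp add: radix_factors_def)
  have "inj_on (\<lambda>e. \<Sum>i\<le>2. e i) (PiE {..2} ?F)"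
  proof (rule inj_onI)
    fix e e' assume e: "e \<in> PiE {..2} ?F" "e' \<in> PiE {..2} ?F" "(\<Sum>i\<le>2. e i) = (\<Sum>i\<le>2. e' i)"
    then have "e 0 = e' 0 \<and> e 1 = e' 1 \<and> e 2 = e' 2"
      using mem[OF e(1)] mem[OF e(2)] unfolding sum by (intro radix_inj[OF ok]) auto
    then show "e = e'" using e by (intro PiE_ext[OF e(1,2)]) (auto simp: atMost_2)
  qed
  moreover have "(\<lambda>e. \<Sum>i\<le>2. e i) ` PiE {..2} ?F = radix_set r0 g1 r1 g2 r2"
  proof (intro equalityI subsetI)
    fix x assume "x \<in> (\<lambda>e. \<Sum>i\<le>2. e i) ` PiE {..2} ?F"
    then obtain e where e: "e \<in> PiE {..2} ?F" "x = e 0 + e 1 + e 2" unfolding sum by blast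
    then show "x \<in> radix_set r0 g1 r1 g2 r2" unfolding radix_set_def
      using mem[OF e(1)] by (intro image_eqI[of _ _ "(e 0, e 1, e 2)"]) auto
  next
    fix x assume "x \<in> radix_set r0 g1 r1 g2 r2"
    then obtain a c d where acd: "a \<in> ap 1 r0" "c \<in> ap g1 r1" "d \<in> ap g2 r2" "x = a + c + d"
      by (auto simp: radix_set_def)
    define e where "e = (\<lambda>i :: nat. if i = 0 then a else if i = 1 then c else if i = 2 then d else undefined)"
    have "e \<in> PiE {..2} ?F" using acd unfolding PiE_iff
      by (auto simp: e_def radix_factors_def atMost_2 extensional_def)
    moreover have "x = (\<Sum>i\<le>2. e i)" unfolding sum using acd(4) by (simp add: e_def)
    ultimately show "x \<in> (\<lambda>e. \<Sum>i\<le>2. e i) ` PiE {..2} ?F" by blast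
  qed
  ultimately show ?thesis by (simp add: is_direct_sum_def bij_betw_def)
qed

lemma radix_set_swap: "radix_set r0 g1 r1 g2 r2 = radix_set r0 g2 r2 g1 r1"
proof -
  have "radix_set r0 g r g' r' \<subseteq> radix_set r0 g' r' g r" for g r g' r'
  proof
    fix x assume "x \<in> radix_set r0 g r g' r'"
    then obtain a c d where "a \<in> ap 1 r0" "c \<in> ap g r" "d \<in> ap g' r'" "x = a + c + d"
      unfolding radix_set_def by auto
    then show "x \<in> radix_set r0 g' r' g r"
      unfolding radix_set_def by (intro image_eqI[of _ _ "(a, d, c)"]) auto
  qed
  then show ?thesis by blast
qed

lemma card_ap: "g > 0 \<Longrightarrow> card (ap g r) = r"
  unfolding ap_def by (subst card_image) (auto simp: inj_on_def)

lemma finite_radix_set: "finite (radix_set r0 g1 r1 g2 r2)"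
  by (simp add: radix_set_def)

lemma inj_on_radix:
  assumes ok: "radix_ok r0 g1 r1 g2 r2"
  shows "inj_on (\<lambda>(a, c, d). a + c + d) (ap 1 r0 \<times> ap g1 r1 \<times> ap g2 r2)"
  using radix_inj[OF ok] unfolding inj_on_def by auto

lemma card_radix_set:
  assumes ok: "radix_ok r0 g1 r1 g2 r2"
  shows "card (radix_set r0 g1 r1 g2 r2) = r0 * r1 * r2"
  unfolding radix_set_def using card_image[OF inj_on_radix[OF ok]] ok
  by (simp add: card_cartesian_product card_ap radix_ok_def)

lemma esum_radix_set:
  assumes ok: "radix_ok r0 g1 r1 g2 r2"
  shows "esum (radix_set r0 g1 r1 g2 r2) z = esum (ap 1 r0) z * esum (ap g1 r1) z * esum (ap g2 r2) z"
proof -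
  have "esum (radix_set r0 g1 r1 g2 r2) z = (\<Sum>(a, c, d)\<in>ap 1 r0 \<times> ap g1 r1 \<times> ap g2 r2. z ^ a * (z ^ c * z ^ d))"
    unfolding esum_def radix_set_def
    by (subst sum.reindex[OF inj_on_radix[OF ok]]) (auto intro!: sum.cong simp: power_add mult.assoc)
  also have "\<dots> = esum (ap 1 r0) z * (esum (ap g1 r1) z * esum (ap g2 r2) z)"
    by (simp add: esum_def sum_product sum.cartesian_product case_prod_unfold)
  finally show ?thesis by (simp add: mult.assoc)
qed

lemma radix_set_full:
  assumes "r0 > 0" "r > 0" "r' > 0"
  shows "radix_set r0 r0 r (r0 * r) r' = {0..<r0 * r * r'}"
proof (rule card_subset_eq)
  have ok: "radix_ok r0 r0 r (r0 * r) r'" using assms by (simp add: radix_ok_def)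
  show "card (radix_set r0 r0 r (r0 * r) r') = card {0..<r0 * r * r'}" using card_radix_set[OF ok] by simp
  show "radix_set r0 r0 r (r0 * r) r' \<subseteq> {0..<r0 * r * r'}"
  proof
    fix y assume "y \<in> radix_set r0 r0 r (r0 * r) r'"
    then obtain a v x where y: "a < r0" "v < r" "x < r'" "y = a + r0 * v + r0 * r * x"
      by (auto simp: radix_set_def ap_def)
    have "r0 * (v + 1) \<le> r0 * r" using y(2) by (intro mult_le_mono2) simp
    moreover have "r0 * r * (x + 1) \<le> r0 * r * r'" using y(3) by (intro mult_le_mono2) simp
    ultimately show "y \<in> {0..<r0 * r * r'}" using y(1,4) by (simp add: algebra_simps)
  qed
qed simp

lemma set_cong_refl: "set_cong n X X"
  unfolding set_cong_def by (intro exI[of _ id]) simp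

subsection \<open>Raising the order\<close>

text \<open>The cycles of \<open>A\<close> are those of the progressions of \<open>G\<close>, moved
  by powers of \<open>b\<close>, so peeling them off retraces the construction of a modulo
  product-form. The value \<open>k = 0\<close> stands for a complete residue system, so first and
  higher order are covered together.\<close>

lemma order_step:
  assumes base: "(k = 0 \<and> set_cong b G {0..<b}) \<or> modulo_product_form b k G"
    and G: "G = radix_set r0 g1 r1 g2 r2" and ok: "radix_ok r0 g1 r1 g2 r2" and l: "l1 \<le> l2" and b: "b > 0"
    and A: "finite A" "card A = r0 * r1 * r2"
    and h: "h1 = b ^ l1 * g1" "h2 = b ^ l2 * g2"
    and inv: "shift_inv A r0 1" "shift_inv A (h1 * r1) h1" "shift_inv A (h2 * r2) h2"
    and dvd: "r0 dvd h1" "h1 * r1 dvd h2"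
  shows "modulo_product_form b (Suc k) A"
proof -
  define F where "F = radix_factors r0 g1 r1 g2 r2"
  define l where "l = (\<lambda>i :: nat. if i = 0 then 0 else if i = 1 then l1 else l2)"
  have pos: "r0 > 0" "h1 > 0" "r1 > 0" "h2 > 0" "r2 > 0" "g1 > 0" "g2 > 0"
    using ok b h by (auto simp: radix_ok_def)
  have sum: "is_direct_sum G 2 F" unfolding G F_def by (rule is_direct_sum_radix[OF ok])
  obtain R0 R1 where R: "set_cong r0 R0 (ap 1 r0)" "cong_direct_sum (h1 * r1) R1 R0 (ap h1 r1)"
    "cong_direct_sum (h2 * r2) A R1 (ap h2 r2)"
    by (rule peel_chain[OF A pos(1-5) inv dvd]) (rule that)
  define E where "E = (\<lambda>i :: nat. if i = 0 then R0 else if i = 1 then R1 else A)"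
  have imgap: "(\<lambda>x. c * x) ` ap g r = ap (c * g) r" for c g r
    unfolding ap_def by (simp add: image_image mult.assoc)
  have Fdvd: "s dvd r0 \<and> j = 0 \<or> s dvd g1 * r1 \<and> j = 1 \<or> s dvd g2 * r2 \<and> j \<ge> 2"
    if "vanishes (F j) s" "s \<ge> 1" for j s
  proof -
    consider "j = 0" | "j = 1" | "j \<ge> 2" by linarith
    then show ?thesis
      using that pos vanishes_ap_dvd[of 1 r0 s] vanishes_ap_dvd[of g1 r1 s] vanishes_ap_dvd[of g2 r2 s]
      by cases (auto simp: F_def radix_factors_def)
  qed
  \<comment> \<open>The index sets enter only through the orders at which the factors vanish, and
    these always divide the radix moduli. Hence one chain serves both definitions of
    \<open>S\<close>.\<close>
  have chain: "modulo_chain b 2 F l S E"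
    if S: "\<And>j s. s \<in> S j \<Longrightarrow> s \<ge> 1 \<and> vanishes (F j) s" for S
  proof -
    have d2: "s dvd r0 \<Longrightarrow> s dvd h2 * r2" "s dvd r0 \<Longrightarrow> s dvd h1 * r1" for s
      using dvd by (meson dvd_mult2 dvd_mult_left dvd_trans)+
    have d3: "s dvd h1 * r1 \<Longrightarrow> s dvd h2 * r2" for s using dvd(2) by (meson dvd_mult2 dvd_trans)
    have b1: "s dvd g1 * r1 \<Longrightarrow> b ^ l1 * s dvd h1 * r1" for s
      unfolding h(1) mult.assoc by (rule mult_dvd_mono) auto
    have b2: "s dvd g2 * r2 \<Longrightarrow> b ^ l2 * s dvd h2 * r2" for s
      unfolding h(2) mult.assoc by (rule mult_dvd_mono) auto
    have n0: "kernel_modulus (kernel_poly b l S 0) dvd r0"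
      proof (rule kernel_modulus_dvd)
      fix j s assume js: "j \<le> 0" "s \<in> S j"
      have "s \<ge> 1" "vanishes (F j) s" using S[OF js(2)] by auto
      then show "s \<ge> 1 \<and> b ^ l j * s dvd r0"
        using Fdvd[of j s] js(1) by (auto simp: l_def)
    qed
    have n1: "kernel_modulus (kernel_poly b l S 1) dvd h1 * r1"
    proof (rule kernel_modulus_dvd)
      fix j s assume js: "j \<le> 1" "s \<in> S j"
      have "s \<ge> 1" "vanishes (F j) s" using S[OF js(2)] by auto
      then show "s \<ge> 1 \<and> b ^ l j * s dvd h1 * r1"
        using Fdvd[of j s] js(1) d2(2)[of s] b1[of s] by (auto simp: l_def)
    qed
    have n2: "kernel_modulus (kernel_poly b l S 2) dvd h2 * r2"
    proof (rule kernel_modulus_dvd)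
      fix j s assume js: "j \<le> 2" "s \<in> S j"
      have "s \<ge> 1" "vanishes (F j) s" using S[OF js(2)] by auto
      then show "s \<ge> 1 \<and> b ^ l j * s dvd h2 * r2"
        using Fdvd[of j s] js(1) d2(1)[of s] d3[OF b1, of s] b2[of s] by (auto simp: l_def)
    qed
    have c0: "set_cong (kernel_modulus (kernel_poly b l S 0)) (E 0) (F 0)"
      using set_cong_dvd[OF R(1) n0] by (simp add: E_def F_def radix_factors_def)
    have c1: "cong_direct_sum (kernel_modulus (kernel_poly b l S 1)) (E 1) (E 0) ((\<lambda>x. b ^ l 1 * x) ` F 1)"
      using cong_direct_sum_dvd[OF R(2) n1] by (simp add: E_def F_def radix_factors_def imgap l_def h)
    have c2: "cong_direct_sum (kernel_modulus (kernel_poly b l S 2)) (E 2) (E 1) ((\<lambda>x. b ^ l 2 * x) ` F 2)"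
      using cong_direct_sum_dvd[OF R(3) n2] by (simp add: E_def F_def radix_factors_def imgap l_def h)
    have two: "i = 0 \<or> i = 1" if "i < 2" for i :: nat using that by auto
    show ?thesis unfolding modulo_chain_def
    proof (intro conjI allI impI)
      show "l 0 = 0" by (simp add: l_def)
      show "l i \<le> l (Suc i)" if "i < 2" for i using two[OF that] \<open>l1 \<le> l2\<close> by (auto simp: l_def)
      show "set_cong (kernel_modulus (kernel_poly b l S 0)) (E 0) (F 0)" by (rule c0)
      show "cong_direct_sum (kernel_modulus (kernel_poly b l S (Suc i))) (E (Suc i)) (E i)
          ((\<lambda>x. b ^ l (Suc i) * x) ` F (Suc i))" if "i < 2" for i
        using two[OF that] c1 c2 by (auto simp: numeral_2_eq_2)
    qed
  qed
  have E2: "E 2 = A" by (simp add: E_def)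
  from base show ?thesis
  proof
    assume k: "k = 0 \<and> set_cong b G {0..<b}"
    define S where "S = (\<lambda>i. {d. d > 1 \<and> d dvd b \<and> cyclotomic d dvd set_poly (F i)})"
    have "modulo_chain b 2 F l S E"
      by (rule chain) (auto simp: S_def cyclotomic_dvd_set_poly_iff)
    then have "modulo_product_form_assoc b 1 (E 2) (kernel_poly b l S 2)"
      by (rule modulo_product_form_assoc.first_order[OF conjunct2[OF k] sum S_def])
    then show ?thesis unfolding modulo_product_form_def E2 using k by auto
  next
    assume "modulo_product_form b k G"
    then obtain K where K: "modulo_product_form_assoc b k G K" by (auto simp: modulo_product_form_def)
    define S where "S = (\<lambda>i. {s. s \<ge> 1 \<and> cyclotomic s dvd set_poly (F i) \<and> cyclotomic s dvd K})"
    have "modulo_chain b 2 F l S E"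
      by (rule chain) (auto simp: S_def cyclotomic_dvd_set_poly_iff)
    then have "modulo_product_form_assoc b (Suc k) (E 2) (kernel_poly b l S 2)"
      by (rule modulo_product_form_assoc.higher_order[OF K sum S_def])
    then show ?thesis unfolding modulo_product_form_def E2 by (rule exI)
  qed
qed

lemma order_step_sym:
  assumes base: "(k = 0 \<and> set_cong b G {0..<b}) \<or> modulo_product_form b k G"
    and G: "G = radix_set r0 g1 r1 g2 r2" and ok: "radix_ok r0 g1 r1 g2 r2" and b: "b > 0"
    and A: "finite A" "card A = r0 * r1 * r2"
    and h: "h1 = b ^ l1 * g1" "h2 = b ^ l2 * g2"
    and inv: "shift_inv A r0 1" "shift_inv A (h1 * r1) h1" "shift_inv A (h2 * r2) h2"
    and ord: "(l1 \<le> l2 \<and> h1 * r1 dvd h2) \<or> (l2 \<le> l1 \<and> h2 * r2 dvd h1)"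
  shows "modulo_product_form b (Suc k) A"
proof -
  have d: "r0 dvd h1" "r0 dvd h2" using ok unfolding h by (auto simp: radix_ok_def)
  from ord show ?thesis
  proof
    assume "l1 \<le> l2 \<and> h1 * r1 dvd h2"
    then show ?thesis using order_step[OF base G ok _ b A h inv d(1)] by blast
  next
    assume *: "l2 \<le> l1 \<and> h2 * r2 dvd h1"
    have G': "G = radix_set r0 g2 r2 g1 r1" unfolding G by (rule radix_set_swap)
    have ok': "radix_ok r0 g2 r2 g1 r1" using ok by (auto simp: radix_ok_def)
    have cA: "card A = r0 * r2 * r1" using A(2) by (simp only: mult_ac)
    show ?thesis using order_step[OF base G' ok' _ b A(1) cA h(2,1) inv(1,3,2) d(2)] * by blast
  qed
qed

lemma vanishes_radix_set:
  assumes "radix_ok r0 g1 r1 g2 r2"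
    and "vanishes (ap 1 r0) s \<or> vanishes (ap g1 r1) s \<or> vanishes (ap g2 r2) s"
  shows "vanishes (radix_set r0 g1 r1 g2 r2) s"
  using assms(2) by (auto simp: vanishes_def esum_radix_set[OF assms(1)])

context two_primes
begin

lemma base_power: "(p ^ 2 * q) ^ l * (p ^ i * q ^ j) = p ^ (2 * l + i) * q ^ (l + j)"
  by (simp add: power_mult_distrib power_add mult_ac flip: power_mult)

lemma dvd_pq: "a \<le> i \<Longrightarrow> c \<le> j \<Longrightarrow> p ^ a * q ^ c dvd p ^ i * q ^ j"
  by (simp add: two_prime_powers_dvd_iff[OF p q pq])

text \<open>Designed to match a gap at height m - t in the smallest case n = 1, m = t + 1: column 2t
  + 2 vanishes at height 0 and row 1 vanishes up to column 2t + 2.\<close>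

definition tower :: "nat \<Rightarrow> nat set" where
  "tower t = radix_set p (p ^ (2 * t + 1)) p (p ^ (2 * t + 2)) q"

lemma radix_ok_tower: "radix_ok p (p ^ (2 * t + 1)) p (p ^ (2 * t + 2)) q"
  using p_pos q_pos by (simp add: radix_ok_def)

lemma p_adic_order_step:
  assumes base: "(k = 0 \<and> set_cong (p ^ 2 * q) (tower t) {0..<p ^ 2 * q}) \<or>
      modulo_product_form (p ^ 2 * q) k (tower t)"
    and A: "finite A" "card A = p ^ 2 * q" "vanishes A p"
    and P: "\<forall>j\<le>J. V A (2 * t + 2 + 2 * J) j" and Q: "\<forall>i\<le>2 * (n + t). V A i n" and n: "n \<ge> 1"
  shows "modulo_product_form (p ^ 2 * q) (Suc k) A"
proof -
  \<comment> \<open>These are b^J p^(2t+1) and b^(n-1) p^(2t+2), the steps of the two upper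
    progressions of \<open>tower t\<close> after shifting.\<close>
  define h1 h2 where "h1 = p ^ (2 * J + (2 * t + 1)) * q ^ J" and "h2 = p ^ (2 * (n + t)) * q ^ (n - 1)"
  have e: "2 * (n - 1) + (2 * t + 2) = 2 * (n + t)" "Suc (n - 1) = n" "Suc (2 * J + (2 * t + 1)) = 2 * t + 2 + 2 * J"
    using n by simp_all
  have h1r: "h1 * p = p ^ Suc (2 * J + (2 * t + 1)) * q ^ J" by (simp add: h1_def mult_ac)
  have h2r: "h2 * q = p ^ (2 * (n + t)) * q ^ Suc (n - 1)" by (simp add: h2_def mult_ac)
  show ?thesis
  proof (rule order_step_sym[OF base tower_def radix_ok_tower _ A(1), where ?h1.0 = h1 and ?h2.0 = h2])
    show "p ^ 2 * q > 0" using p_pos q_pos by simp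
    show "card A = p * p * q" using A(2) by (simp only: power2_eq_square)
    show "h1 = (p ^ 2 * q) ^ J * p ^ (2 * t + 1)"
      using base_power[of J "2 * t + 1" 0] by (simp only: h1_def power_0 mult_1_right add_0_right)
    show "h2 = (p ^ 2 * q) ^ (n - 1) * p ^ (2 * t + 2)"
      using base_power[of "n - 1" "2 * t + 2" 0] by (simp only: h2_def e power_0 mult_1_right add_0_right)
    show "shift_inv A p 1" using p_cycles_iff[OF A(1), of 0 0] A(3) by simp
    show "shift_inv A (h1 * p) h1" unfolding h1r unfolding h1_def p_cycles_iff[OF A(1)] unfolding e by (rule P)
    show "shift_inv A (h2 * q) h2" unfolding h2r unfolding h2_def q_cycles_iff[OF A(1)] unfolding e by (rule Q)
    show "J \<le> n - 1 \<and> h1 * p dvd h2 \<or> n - 1 \<le> J \<and> h2 * q dvd h1"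
    proof (cases "J \<le> n - 1")
      case True
      have "h1 * p dvd h2" unfolding h1r unfolding h2_def by (rule dvd_pq) (use True n in simp_all)
      then show ?thesis using True by simp
    next
      case False
      have "h2 * q dvd h1" unfolding h2r unfolding h1_def by (rule dvd_pq) (use False n in simp_all)
      then show ?thesis using False by simp
    qed
  qed
qed

lemma tower_order:
  "(t = 0 \<and> set_cong (p ^ 2 * q) (tower t) {0..<p ^ 2 * q}) \<or> modulo_product_form (p ^ 2 * q) t (tower t)"
proof (induction t)
  case 0
  have "tower 0 = {0..<p * p * q}"
    using radix_set_full[OF p_pos p_pos q_pos] by (simp add: tower_def power2_eq_square)
  then have "tower 0 = {0..<p ^ 2 * q}" by (simp only: power2_eq_square)
  then show ?case using set_cong_refl by simp
next
  case (Suc t)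
  let ?A = "tower (Suc t)"
  have ok: "radix_ok p (p ^ (2 * Suc t + 1)) p (p ^ (2 * Suc t + 2)) q" by (rule radix_ok_tower)
  note van = vanishes_radix_set[OF ok, folded tower_def]
  note dvd_iff = two_prime_powers_dvd_iff[OF p q pq]
  have v1: "vanishes ?A p" using p_gt_1 by (intro van[OF disjI1[OF vanishes_ap]]) auto
  have vq: "V ?A i 1" if "i \<le> 2 * t + 4" for i
  proof (rule van[OF disjI2[OF disjI2[OF vanishes_ap]]])
    show "p ^ (2 * Suc t + 2) > 0" using p_pos by simp
    show "p ^ i * q ^ 1 dvd p ^ (2 * Suc t + 2) * q" using dvd_pq[of i "2 * Suc t + 2" 1 1] that by simp
    show "\<not> p ^ i * q ^ 1 dvd p ^ (2 * Suc t + 2)" using dvd_iff[of i 1 "2 * Suc t + 2" 0] by simp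
  qed
  have vp: "V ?A (2 * t + 4) 0"
  proof (rule van[OF disjI2[OF disjI1[OF vanishes_ap]]])
    show "p ^ (2 * Suc t + 1) > 0" using p_pos by simp
    show "p ^ (2 * t + 4) * q ^ 0 dvd p ^ (2 * Suc t + 1) * p"
      using dvd_pq[of "2 * t + 4" "Suc (2 * Suc t + 1)" 0 0] by (simp add: mult.commute)
    show "\<not> p ^ (2 * t + 4) * q ^ 0 dvd p ^ (2 * Suc t + 1)"
      using dvd_iff[of "2 * t + 4" 0 "2 * Suc t + 1" 0] by simp
  qed
  have "modulo_product_form (p ^ 2 * q) (Suc t) ?A"
  \<comment> \<open>\<open>J = 1\<close> and \<open>n = 1\<close> shift the upper progression of
    length p by a single factor \<open>b\<close> and leave the one of length q in place, so each
    level of the tower costs one order.\<close>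
  proof (rule p_adic_order_step[OF Suc.IH _ _ v1, where J = 1 and n = 1])
    show "finite ?A" unfolding tower_def by (rule finite_radix_set)
    show "card ?A = p ^ 2 * q" unfolding tower_def card_radix_set[OF ok] by (simp only: power2_eq_square)
    show "\<forall>j\<le>1. V ?A (2 * t + 2 + 2 * 1) j"
    proof (intro allI impI)
      fix j :: nat assume "j \<le> 1"
      then consider "j = 0" | "j = 1" by linarith
      moreover have "2 * t + 2 + 2 * 1 = 2 * t + 4" by simp
      ultimately show "V ?A (2 * t + 2 + 2 * 1) j" using vp vq[of "2 * t + 4"] by (metis order_refl)
    qed
    show "\<forall>i\<le>2 * (1 + t). V ?A i 1" using vq by auto
  qed simp
  then show ?case by blast
qed

text \<open>The base is {0..<b} with radices p, q, p. With q in the middle, its progression starts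
  at step p, so the row is needed only up to 2n - 1 while the column reaches the full height
  m.\<close>

lemma order_1_p:
  assumes A: "finite A" "card A = p ^ 2 * q" "vanishes A p" and mn: "m \<ge> 1" "n \<ge> 1"
    and P: "\<forall>j\<le>m. V A (2 * m) j" and Q: "\<forall>i\<le>2 * n - 1. V A i n"
  shows "modulo_product_form (p ^ 2 * q) 1 A"
proof -
  define h1 h2 where "h1 = p ^ (2 * m - 1) * q ^ m" and "h2 = p ^ (2 * n - 1) * q ^ (n - 1)"
  have e: "2 * (m - 1) + 1 = 2 * m - 1" "m - 1 + 1 = m" "2 * (n - 1) + 1 = 2 * n - 1"
    "Suc (n - 1) = n" "Suc (2 * m - 1) = 2 * m" using mn by simp_all
  have h1r: "h1 * p = p ^ Suc (2 * m - 1) * q ^ m" by (simp add: h1_def mult_ac)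
  have h2r: "h2 * q = p ^ (2 * n - 1) * q ^ Suc (n - 1)" by (simp add: h2_def mult_ac)
  have ok: "radix_ok p (p * q) p p q" using p_pos q_pos by (simp add: radix_ok_def)
  have "modulo_product_form (p ^ 2 * q) (Suc 0) A"
  proof (rule order_step_sym[OF _ refl ok _ A(1), where ?h1.0 = h1 and ?h2.0 = h2])
    have "radix_set p (p * q) p p q = {0..<p * q * p}"
      unfolding radix_set_swap[of p "p * q"] by (rule radix_set_full[OF p_pos q_pos p_pos])
    also have "p * q * p = p ^ 2 * q" by (simp add: power2_eq_square)
    finally show "0 = 0 \<and> set_cong (p ^ 2 * q) (radix_set p (p * q) p p q) {0..<p ^ 2 * q} \<or>
        modulo_product_form (p ^ 2 * q) 0 (radix_set p (p * q) p p q)"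
      using set_cong_refl by simp
    show "p ^ 2 * q > 0" using p_pos q_pos by simp
    show "card A = p * p * q" using A(2) by (simp only: power2_eq_square)
    show "h1 = (p ^ 2 * q) ^ (m - 1) * (p * q)"
      using base_power[of "m - 1" 1 1] by (simp only: h1_def e power_one_right)
    show "h2 = (p ^ 2 * q) ^ (n - 1) * p"
      using base_power[of "n - 1" 1 0] by (simp only: h2_def e power_one_right power_0 mult_1_right add_0_right)
    show "shift_inv A p 1" using p_cycles_iff[OF A(1), of 0 0] A(3) by simp
    show "shift_inv A (h1 * p) h1" unfolding h1r unfolding h1_def p_cycles_iff[OF A(1)] unfolding e by (rule P)
    show "shift_inv A (h2 * q) h2" unfolding h2r unfolding h2_def q_cycles_iff[OF A(1)] unfolding e by (rule Q)
    show "m - 1 \<le> n - 1 \<and> h1 * p dvd h2 \<or> n - 1 \<le> m - 1 \<and> h2 * q dvd h1"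
    proof (cases "m < n")
      case True
      have "h1 * p dvd h2" unfolding h1r unfolding h2_def by (rule dvd_pq) (use True in simp_all)
      moreover have "m - 1 \<le> n - 1" using True by linarith
      ultimately show ?thesis by blast
    next
      case False
      have "h2 * q dvd h1" unfolding h2r unfolding h1_def by (rule dvd_pq) (use False mn in simp_all)
      moreover have "n - 1 \<le> m - 1" using False by linarith
      ultimately show ?thesis by blast
    qed
  qed
  then show ?thesis by simp
qed

text \<open>Here {0..<b} is split with radices q, p, p; the two columns determine the shifts n and m
  - 1 of the two progressions of length p.\<close>

lemma order_1_q:
  assumes A: "finite A" "card A = p ^ 2 * q" "vanishes A q" and mn: "m \<ge> 1" "n \<ge> 1"
    and X: "\<forall>j\<le>n + 1. V A (2 * n + 1) j" and Y: "\<forall>j\<le>m. V A (2 * m) j"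
  shows "modulo_product_form (p ^ 2 * q) 1 A"
proof -
  define h1 h2 where "h1 = p ^ (2 * n) * q ^ (n + 1)" and "h2 = p ^ (2 * m - 1) * q ^ m"
  have e: "2 * (m - 1) + 1 = 2 * m - 1" "m - 1 + 1 = m" "Suc (2 * n) = 2 * n + 1"
    "Suc (2 * m - 1) = 2 * m" using mn by simp_all
  have h1r: "h1 * p = p ^ Suc (2 * n) * q ^ (n + 1)" by (simp add: h1_def mult_ac)
  have h2r: "h2 * p = p ^ Suc (2 * m - 1) * q ^ m" by (simp add: h2_def mult_ac)
  have ok: "radix_ok q q p (p * q) p" using p_pos q_pos by (simp add: radix_ok_def mult.commute)
  have "modulo_product_form (p ^ 2 * q) (Suc 0) A"
  proof (rule order_step_sym[OF _ refl ok _ A(1), where ?h1.0 = h1 and ?h2.0 = h2])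
    have "radix_set q q p (p * q) p = {0..<q * p * p}"
      using radix_set_full[OF q_pos p_pos p_pos] by (simp only: mult.commute[of p q])
    also have "q * p * p = p ^ 2 * q" by (simp add: power2_eq_square)
    finally show "0 = 0 \<and> set_cong (p ^ 2 * q) (radix_set q q p (p * q) p) {0..<p ^ 2 * q} \<or>
        modulo_product_form (p ^ 2 * q) 0 (radix_set q q p (p * q) p)"
      using set_cong_refl by simp
    show "p ^ 2 * q > 0" using p_pos q_pos by simp
    show "card A = q * p * p" using A(2) by (simp add: power2_eq_square)
    show "h1 = (p ^ 2 * q) ^ n * q"
      using base_power[of n 0 1] by (simp only: h1_def power_0 power_one_right mult_1_left add_0_right)
    show "h2 = (p ^ 2 * q) ^ (m - 1) * (p * q)"
      using base_power[of "m - 1" 1 1] by (simp only: h2_def e power_one_right)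
    show "shift_inv A q 1" using q_cycles_iff[OF A(1), of 0 0] A(3) by simp
    show "shift_inv A (h1 * p) h1" unfolding h1r unfolding h1_def p_cycles_iff[OF A(1)] unfolding e by (rule X)
    show "shift_inv A (h2 * p) h2" unfolding h2r unfolding h2_def p_cycles_iff[OF A(1)] unfolding e by (rule Y)
    show "n \<le> m - 1 \<and> h1 * p dvd h2 \<or> m - 1 \<le> n \<and> h2 * p dvd h1"
    proof (cases "n < m")
      case True
      have "h1 * p dvd h2" unfolding h1r unfolding h2_def by (rule dvd_pq) (use True in simp_all)
      moreover have "n \<le> m - 1" using True by linarith
      ultimately show ?thesis by blast
    next
      case False
      have "h2 * p dvd h1" unfolding h2r unfolding h1_def by (rule dvd_pq) (use False mn in simp_all)
      moreover have "m - 1 \<le> n" using False by linarith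
      ultimately show ?thesis by blast
    qed
  qed
  then show ?thesis by simp
qed

end

section \<open>The converse, and both directions combined\<close>

subsection \<open>Modulo product-forms are tile digit sets\<close>

lemma esum_set_cong:
  assumes "set_cong n X Y" "z ^ n = 1"
  shows "esum X z = esum Y z"
proof -
  obtain f where f: "bij_betw f X Y" "\<forall>x\<in>X. [x = f x] (mod n)" using assms(1) by (auto simp: set_cong_def)
  have "z ^ x = z ^ f x" if "x \<in> X" for x
  proof -
    have "x mod n = f x mod n" using f(2) that by (simp add: cong_def)
    then show ?thesis using root_power_mod[OF assms(2), of x] root_power_mod[OF assms(2), of "f x"] by simp
  qed
  then have "esum X z = (\<Sum>x\<in>X. z ^ f x)" by (simp add: esum_def)
  also have "\<dots> = esum Y z" unfolding esum_def by (rule sum.reindex_bij_betw[OF f(1)])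
  finally show ?thesis .
qed

lemma esum_cong_direct_sum:
  assumes "cong_direct_sum n W X Y" "z ^ n = 1"
  shows "esum W z = esum X z * esum Y z"
proof -
  obtain Z where Z: "bij_betw (\<lambda>(x, y). x + y) (X \<times> Y) Z" "set_cong n W Z"
    using assms(1) by (auto simp: cong_direct_sum_def)
  have "esum W z = esum Z z" by (rule esum_set_cong[OF Z(2) assms(2)])
  also have "\<dots> = (\<Sum>u\<in>X \<times> Y. z ^ (case u of (x, y) \<Rightarrow> x + y))"
    unfolding esum_def by (rule sum.reindex_bij_betw[OF Z(1), symmetric])
  also have "\<dots> = esum X z * esum Y z"
    by (simp add: esum_def sum_product sum.cartesian_product case_prod_unfold power_add)
  finally show ?thesis .
qed

lemma card_set_cong:
  assumes "set_cong n X Y" "finite Y" shows "finite X" "card X = card Y"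
  using assms bij_betw_finite bij_betw_same_card unfolding set_cong_def by blast+

lemma card_cong_direct_sum:
  assumes "cong_direct_sum n W X Y" "finite X" "finite Y"
  shows "finite W" "card W = card X * card Y"
proof -
  obtain Z where Z: "bij_betw (\<lambda>(x, y). x + y) (X \<times> Y) Z" "set_cong n W Z"
    using assms(1) by (auto simp: cong_direct_sum_def)
  have "finite Z" "card Z = card X * card Y"
    using bij_betw_finite[OF Z(1)] bij_betw_same_card[OF Z(1)] assms(2,3) by (simp_all add: card_cartesian_product)
  then show "finite W" "card W = card X * card Y" using card_set_cong[OF Z(2)] by simp_all
qed

lemma esum_direct_sum:
  assumes "is_direct_sum G r F" "\<And>i. i \<le> r \<Longrightarrow> finite (F i)"
  shows "esum G z = (\<Prod>i\<le>r. esum (F i) z)"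
proof -
  have "esum G z = (\<Sum>e\<in>PiE {..r} F. z ^ (\<Sum>i\<le>r. e i))"
    unfolding esum_def using assms(1) unfolding is_direct_sum_def
    by (rule sum.reindex_bij_betw[symmetric])
  also have "\<dots> = (\<Sum>e\<in>PiE {..r} F. \<Prod>i\<le>r. z ^ e i)" by (simp add: power_sum)
  also have "\<dots> = (\<Prod>i\<le>r. \<Sum>a\<in>F i. z ^ a)"
    using assms(2) by (intro prod_sum_PiE[symmetric]) auto
  finally show ?thesis by (simp add: esum_def)
qed

lemma finite_cyclotomic_divisors:
  assumes "finite A" "A \<noteq> {}"
  shows "finite {s. s \<ge> 1 \<and> cyclotomic s dvd set_poly A}"
proof (rule finite_imageD[where f = "rou 1"])
  have "poly (set_poly A) 1 \<noteq> 0" using assms by (simp add: poly_set_poly esum_def)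
  then have "set_poly A \<noteq> 0" by auto
  then have "finite {z. poly (set_poly A) z = 0}" by (rule poly_roots_finite)
  moreover have "rou 1 ` {s. s \<ge> 1 \<and> cyclotomic s dvd set_poly A} \<subseteq> {z. poly (set_poly A) z = 0}"
    using prim_root_rou_1 by (auto simp: cyclotomic_dvd_iff)
  ultimately show "finite (rou 1 ` {s. s \<ge> 1 \<and> cyclotomic s dvd set_poly A})" by (rule rev_finite_subset)
  show "inj_on (rou 1) {s. s \<ge> 1 \<and> cyclotomic s dvd set_poly A}"
  proof (rule inj_onI)
    fix s t assume st: "s \<in> {s. s \<ge> 1 \<and> cyclotomic s dvd set_poly A}"
      "t \<in> {s. s \<ge> 1 \<and> cyclotomic s dvd set_poly A}" "rou 1 s = rou 1 t"
    then have "prim_root s (rou 1 s)" "prim_root t (rou 1 s)" using prim_root_rou_1[of s] prim_root_rou_1[of t] by simp_all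
    then show "s = t" by (rule prim_root_unique)
  qed
qed

text \<open>The invariant that passes from one order to the next.  The last clause is the criterion for
  \<open>G\<close> to be a tile digit set, with the zeros taken from \<open>K\<close> instead of \<open>P\<^sub>G\<close>.\<close>

definition tile_kernel :: "nat \<Rightarrow> nat set \<Rightarrow> complex poly \<Rightarrow> bool" where
  "tile_kernel b G K \<longleftrightarrow> finite G \<and> card G = b \<and>
     (\<forall>z. poly K z = 0 \<longrightarrow> esum G z = 0) \<and>
     (\<forall>z. poly K z = 0 \<longrightarrow> (\<exists>s. prim_root s z)) \<and>
     (\<forall>s z w. prim_root s z \<longrightarrow> prim_root s w \<longrightarrow> poly K z = 0 \<longrightarrow> poly K w = 0) \<and>
     (\<exists>k0. \<forall>m. \<not> b dvd m \<longrightarrow> (\<exists>k\<ge>1. k \<le> k0 \<and> poly K (rou m (b ^ k)) = 0))"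

text \<open>At a common zero of P_G and K some factor F_i vanishes as well, and closure of the zeros
  of K under conjugation puts the order of the root into S_i. Replacing z by its power with exponent
  b^(l_i) then moves this zero into the new kernel.\<close>

lemma tile_kernel_step:
  assumes b: "b > 0" and G: "tile_kernel b G K" and sum: "is_direct_sum G r F"
    and S: "\<And>i s. s \<in> S i \<longleftrightarrow> s \<ge> 1 \<and> cyclotomic s dvd set_poly (F i) \<and> cyclotomic s dvd K"
    and chain: "modulo_chain b r F l S D"
  shows "tile_kernel b (D r) (kernel_poly b l S r)"
proof -
  have G1: "finite G" "card G = b" and Gz: "\<And>z. poly K z = 0 \<Longrightarrow> esum G z = 0"
    and Ku: "\<And>z. poly K z = 0 \<Longrightarrow> \<exists>s. prim_root s z"
    and Kc: "\<And>s z w. prim_root s z \<Longrightarrow> prim_root s w \<Longrightarrow> poly K z = 0 \<Longrightarrow> poly K w = 0"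
    using G unfolding tile_kernel_def by blast+
  obtain k0 where k0: "\<And>m. \<not> b dvd m \<Longrightarrow> \<exists>k\<ge>1. k \<le> k0 \<and> poly K (rou m (b ^ k)) = 0"
    using G unfolding tile_kernel_def by blast
  have cardF: "(\<Prod>i\<le>r. card (F i)) = b"
    using bij_betw_same_card[OF sum[unfolded is_direct_sum_def]] G1(2) by (simp add: card_PiE)
  have F: "finite (F i)" "F i \<noteq> {}" if "i \<le> r" for i
  proof -
    have "(\<Prod>i\<le>r. card (F i)) \<noteq> 0" using cardF b by simp
    then have "card (F i) \<noteq> 0" using that by (simp add: prod_zero_iff)
    then show "finite (F i)" "F i \<noteq> {}" by (auto intro: card_ge_0_finite)
  qed
  have finS: "finite (S i)" if "i \<le> r" for i
    by (rule finite_subset[OF _ finite_cyclotomic_divisors[OF F[OF that]]]) (auto simp: S)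
  let ?K = "kernel_poly b l S"
  have zero: "poly (?K i) z = 0 \<longleftrightarrow> (\<exists>j\<le>i. esum (F j) (z ^ b ^ l j) = 0 \<and> poly K (z ^ b ^ l j) = 0)"
    if "i \<le> r" for i z
  proof
    assume "poly (?K i) z = 0"
    then obtain j s where js: "j \<le> i" "s \<in> S j" "prim_root s (z ^ b ^ l j)"
      using poly_kernel_eq_0D[of b l S i z] S by blast
    then have "s > 0" "vanishes (F j) s" "cyclotomic s dvd K" using S by (auto simp: cyclotomic_dvd_set_poly_iff)
    then show "\<exists>j\<le>i. esum (F j) (z ^ b ^ l j) = 0 \<and> poly K (z ^ b ^ l j) = 0"
      using js cyclotomic_dvd_iff[of s K] unfolding vanishes_def by blast
  next
    assume "\<exists>j\<le>i. esum (F j) (z ^ b ^ l j) = 0 \<and> poly K (z ^ b ^ l j) = 0"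
    then obtain j where j: "j \<le> i" "esum (F j) (z ^ b ^ l j) = 0" "poly K (z ^ b ^ l j) = 0" by blast
    obtain s where s: "prim_root s (z ^ b ^ l j)" using Ku[OF j(3)] by blast
    have s0: "s > 0" by (rule prim_root_pos[OF s])
    have "cyclotomic s dvd K" using s0 Kc[OF s _ j(3)] by (simp add: cyclotomic_dvd_iff)
    then have "s \<in> S j" unfolding S using s0 vanishes_if_root[OF s j(2)]
      by (simp add: cyclotomic_dvd_set_poly_iff)
    moreover have "poly (cyclotomic s) (z ^ b ^ l j) = 0" using poly_cyclotomic_eq_0_iff[OF s0] s by blast
    ultimately have "(\<Prod>s\<in>S j. poly (cyclotomic s) (z ^ b ^ l j)) = 0"
      using finS[of j] j(1) that by (intro prod_zero) auto
    then have "(\<Prod>j\<le>i. \<Prod>s\<in>S j. poly (cyclotomic s) (z ^ b ^ l j)) = 0"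
      using j(1) by (intro prod_zero) auto
    then show "poly (?K i) z = 0" by (simp add: kernel_poly_def poly_prod poly_pcompose poly_monom)
  qed
  have unity: "\<exists>s. prim_root s z" if i: "i \<le> r" and 0: "poly (?K i) z = 0" for i z
  proof -
    obtain j where "poly K (z ^ b ^ l j) = 0" using zero[OF i] 0 by blast
    then obtain s where s: "prim_root s (z ^ b ^ l j)" using Ku by blast
    then have "z ^ (b ^ l j * s) = 1" using prim_root_power_eq_1[OF s, of s] by (simp add: power_mult)
    moreover have "b ^ l j * s > 0" using b prim_root_pos[OF s] by simp
    ultimately show ?thesis using prim_root_exists by blast
  qed
  have closed: "poly (?K i) w = 0" if i: "i \<le> r" and zw: "prim_root s z" "prim_root s w" and 0: "poly (?K i) z = 0"
    for i s z w
  proof -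
    obtain j where j: "j \<le> i" "esum (F j) (z ^ b ^ l j) = 0" "poly K (z ^ b ^ l j) = 0"
      using zero[OF i] 0 by blast
    define s' where "s' = s div gcd s (b ^ l j)"
    have s': "prim_root s' (z ^ b ^ l j)" "prim_root s' (w ^ b ^ l j)"
      unfolding s'_def using zw b by (simp_all add: prim_root_power)
    have "esum (F j) (w ^ b ^ l j) = 0" using vanishes_if_root[OF s'(1) j(2)] s'(2) unfolding vanishes_def by blast
    then show ?thesis using zero[OF i] j(1) Kc[OF s' j(3)] by blast
  qed
  \<comment> \<open>Roots of the kernel are killed by the modulus, so the congruences of the chain
    preserve the sums at exactly the roots of interest.\<close>
  have modulus: "z ^ kernel_modulus (?K i) = 1" if i: "i \<le> r" and 0: "poly (?K i) z = 0" for i z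
  proof -
    obtain s where s: "prim_root s z" using unity[OF i 0] by blast
    have "s > 0" by (rule prim_root_pos[OF s])
    then have "cyclotomic s dvd ?K i" using closed[OF i s _ 0] by (simp add: cyclotomic_dvd_iff)
    then have "s dvd kernel_modulus (?K i)" unfolding kernel_modulus_def using \<open>s > 0\<close> by (intro dvd_Lcm) simp
    then show ?thesis using s by (simp add: prim_root_power_eq_1)
  qed
  have D: "finite (D i) \<and> card (D i) = (\<Prod>j\<le>i. card (F j)) \<and> (\<forall>z. poly (?K i) z = 0 \<longrightarrow> esum (D i) z = 0)"
    if "i \<le> r" for i
    using that
  proof (induction i)
    case 0
    have D0: "set_cong (kernel_modulus (?K 0)) (D 0) (F 0)" and l0: "l 0 = 0"
      using chain by (auto simp: modulo_chain_def)
    have "esum (D 0) z = 0" if "poly (?K 0) z = 0" for z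
    proof -
      have "esum (F 0) z = 0" using zero[of 0 z] that l0 by simp
      then show ?thesis using esum_set_cong[OF D0 modulus[of 0 z]] that by simp
    qed
    then show ?case using card_set_cong[OF D0 F(1)[of 0]] by simp
  next
    case (Suc i)
    let ?F = "(\<lambda>x. b ^ l (Suc i) * x) ` F (Suc i)"
    have inj: "inj_on (\<lambda>x. b ^ l (Suc i) * x) (F (Suc i))" using b by (auto simp: inj_on_def)
    have D1: "cong_direct_sum (kernel_modulus (?K (Suc i))) (D (Suc i)) (D i) ?F"
      using chain Suc.prems by (auto simp: modulo_chain_def)
    have IH: "finite (D i)" "card (D i) = (\<Prod>j\<le>i. card (F j))" "\<And>z. poly (?K i) z = 0 \<Longrightarrow> esum (D i) z = 0"
      using Suc by auto
    have finF: "finite ?F" using F(1)[OF Suc.prems] by simp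
    have "esum (D (Suc i)) z = 0" if 0: "poly (?K (Suc i)) z = 0" for z
    proof -
      have eq: "esum (D (Suc i)) z = esum (D i) z * esum ?F z"
        by (rule esum_cong_direct_sum[OF D1 modulus[OF Suc.prems 0]])
      obtain j where j: "j \<le> Suc i" "esum (F j) (z ^ b ^ l j) = 0" "poly K (z ^ b ^ l j) = 0"
        using zero[OF Suc.prems] 0 by blast
      show ?thesis
      proof (cases "j = Suc i")
        case True
        have "esum ?F z = esum (F j) (z ^ b ^ l j)"
          unfolding esum_def sum.reindex[OF inj] using True by (simp add: power_mult)
        then show ?thesis using eq j(2) by simp
      next
        case False
        then have "poly (?K i) z = 0" using zero[of i z] Suc.prems j by auto
        then show ?thesis using eq IH(3) by simp
      qed
    qed
    then show ?case using card_cong_direct_sum[OF D1 IH(1) finF] IH(2) card_image[OF inj] by simp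
  qed
  have "\<exists>k\<ge>1. k \<le> k0 + (\<Sum>i\<le>r. l i) \<and> poly (?K r) (rou m (b ^ k)) = 0" if m: "\<not> b dvd m" for m
  proof -
    obtain k where k: "k \<ge> 1" "k \<le> k0" "poly K (rou m (b ^ k)) = 0" using k0[OF m] by blast
    have "(\<Prod>i\<le>r. esum (F i) (rou m (b ^ k))) = 0"
      using Gz[OF k(3)] esum_direct_sum[OF sum F(1)] by simp
    then obtain i where i: "i \<le> r" "esum (F i) (rou m (b ^ k)) = 0" by auto
    \<comment> \<open>The zero for m moves from level k to level k + l i. The shift is at most the
      sum of all exponents, so the levels remain bounded uniformly in m.\<close>
    have "rou m (b ^ (k + l i)) ^ b ^ l i = rou m (b ^ k)"
      using b by (simp add: rou_power power_add rou_cancel)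
    then have "poly (?K r) (rou m (b ^ (k + l i))) = 0" using zero[of r "rou m (b ^ (k + l i))"] i k(3) by auto
    moreover have "l i \<le> (\<Sum>i\<le>r. l i)" using i(1) by (intro member_le_sum) auto
    ultimately show ?thesis using k by (intro exI[of _ "k + l i"]) auto
  qed
  then have "\<exists>k0. \<forall>m. \<not> b dvd m \<longrightarrow> (\<exists>k\<ge>1. k \<le> k0 \<and> poly (?K r) (rou m (b ^ k)) = 0)" by blast
  moreover have "finite (D r)" "card (D r) = b" "\<forall>z. poly (?K r) z = 0 \<longrightarrow> esum (D r) z = 0"
    using D[OF order_refl] cardF by simp_all
  moreover have "\<forall>z. poly (?K r) z = 0 \<longrightarrow> (\<exists>s. prim_root s z)" using unity[OF order_refl] by blast
  moreover have "\<forall>s z w. prim_root s z \<longrightarrow> prim_root s w \<longrightarrow> poly (?K r) z = 0 \<longrightarrow> poly (?K r) w = 0"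
    using closed[OF order_refl] by blast
  ultimately show ?thesis unfolding tile_kernel_def by blast
qed

text \<open>The product is (X^b - 1) / (X - 1). With it as kernel a complete residue system acts as
  a form of order zero, and the first-order construction becomes an instance of
  \<open>tile_kernel_step\<close>.\<close>

lemma tile_kernel_base:
  assumes b: "b \<ge> 2" and E: "set_cong b E {0..<b}"
  shows "tile_kernel b E (\<Prod>d | d > 1 \<and> d dvd b. cyclotomic d)"
proof -
  let ?I = "{d. d > 1 \<and> d dvd b}"
  let ?K = "\<Prod>d\<in>?I. cyclotomic d"
  have fin: "finite ?I" using b by (intro finite_subset[OF _ finite_divisors_nat[of b]]) auto
  have zero: "poly ?K z = 0 \<longleftrightarrow> (\<exists>d>1. d dvd b \<and> prim_root d z)" for z
    using fin by (auto simp: poly_prod poly_cyclotomic_eq_0_iff)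
  have "esum E z = 0" if 0: "poly ?K z = 0" for z
  proof -
    obtain d where d: "d > 1" "d dvd b" "prim_root d z" using zero 0 by blast
    have zb: "z ^ b = 1" "z \<noteq> 1"
      using prim_root_power_eq_1[OF d(3), of b] prim_root_power_eq_1[OF d(3), of 1] d by auto
    have "esum E z = (\<Sum>x<b. z ^ x)"
      using esum_set_cong[OF E zb(1)] by (simp add: esum_def lessThan_atLeast0)
    then show ?thesis using zb by (simp add: geometric_sum)
  qed
  moreover have "poly ?K (rou m (b ^ 1)) = 0" if "\<not> b dvd m" for m
  proof -
    have "prim_root (b div gcd m b) (rou m b)" using b by (intro prim_root_rou) simp
    moreover have "rou m b \<noteq> 1" using that b by (simp add: rou_eq_1_iff)
    then have "b div gcd m b \<noteq> 1"
      using prim_root_power_eq_1[OF \<open>prim_root (b div gcd m b) (rou m b)\<close>, of 1] by auto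
    moreover have "b div gcd m b > 0" using calculation(1) by (rule prim_root_pos)
    moreover have "b div gcd m b dvd b" using dvd_triv_left[of "b div gcd m b" "gcd m b"] by simp
    ultimately show ?thesis unfolding zero by (intro exI[of _ "b div gcd m b"]) auto
  qed
  then have "\<forall>m. \<not> b dvd m \<longrightarrow> (\<exists>k\<ge>1. k \<le> 1 \<and> poly ?K (rou m (b ^ k)) = 0)" by blast
  then have "\<exists>k0. \<forall>m. \<not> b dvd m \<longrightarrow> (\<exists>k\<ge>1. k \<le> k0 \<and> poly ?K (rou m (b ^ k)) = 0)" by (rule exI)
  moreover have "finite E" "card E = b" using card_set_cong[OF E] by simp_all
  moreover have "\<forall>z. poly ?K z = 0 \<longrightarrow> (\<exists>s. prim_root s z)" using zero by blast
  moreover have "poly ?K w = 0" if zw: "prim_root s z" "prim_root s w" and 0: "poly ?K z = 0" for s z w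
  proof -
    obtain d where d: "d > 1" "d dvd b" "prim_root d z" using zero 0 by blast
    then have "s = d" using prim_root_unique zw(1) by blast
    then show ?thesis using zero d zw(2) by blast
  qed
  ultimately show ?thesis unfolding tile_kernel_def by blast
qed

lemma cyclotomic_dvd_base_kernel:
  assumes "b > 0" "s > 0"
  shows "cyclotomic s dvd (\<Prod>d | d > 1 \<and> d dvd b. cyclotomic d) \<longleftrightarrow> s > 1 \<and> s dvd b"
proof -
  have fin: "finite {d. d > 1 \<and> d dvd b}" using assms(1) by (intro finite_subset[OF _ finite_divisors_nat[of b]]) auto
  show ?thesis
  proof
    assume "cyclotomic s dvd (\<Prod>d | d > 1 \<and> d dvd b. cyclotomic d)"
    then have "poly (\<Prod>d | d > 1 \<and> d dvd b. cyclotomic d) (rou 1 s) = 0"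
      using prim_root_rou_1[OF assms(2)] assms(2) by (simp add: cyclotomic_dvd_iff)
    then obtain d where d: "d > 1" "d dvd b" "prim_root d (rou 1 s)"
      using fin by (auto simp: poly_prod poly_cyclotomic_eq_0_iff)
    have "s = d" by (rule prim_root_unique[OF prim_root_rou_1[OF assms(2)] d(3)])
    then show "s > 1 \<and> s dvd b" using d by simp
  next
    assume "s > 1 \<and> s dvd b"
    then show "cyclotomic s dvd (\<Prod>d | d > 1 \<and> d dvd b. cyclotomic d)" using fin by (intro dvd_prodI) auto
  qed
qed

lemma tile_kernel_if_modulo_product_form_assoc:
  assumes "modulo_product_form_assoc b k G K" "b \<ge> 2"
  shows "tile_kernel b G K"
  using assms
proof (induction rule: modulo_product_form_assoc.induct)
  case (first_order E r F S l D)
  show ?case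
  proof (rule tile_kernel_step[OF _ tile_kernel_base[OF _ first_order(1)] first_order(2) _ first_order(4)])
    show "s \<in> S i \<longleftrightarrow> s \<ge> 1 \<and> cyclotomic s dvd set_poly (F i) \<and>
        cyclotomic s dvd (\<Prod>d | d > 1 \<and> d dvd b. cyclotomic d)" for i s
      unfolding first_order(3) using cyclotomic_dvd_base_kernel[of b s] first_order(5) by auto
  qed (use first_order(5) in simp_all)
next
  case (higher_order k G K r F S l D)
  show ?case
    by (rule tile_kernel_step[OF _ higher_order.IH[OF higher_order.prems] _ _ higher_order(4)])
      (use higher_order in auto)
qed

lemma tile_digit_set_if_modulo_product_form:
  assumes "modulo_product_form b k D" "b \<ge> 2" "0 \<in> D"
  shows "tile_digit_set b D"
proof -
  obtain K where "tile_kernel b D K"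
    using assms(1,2) tile_kernel_if_modulo_product_form_assoc unfolding modulo_product_form_def by blast
  then have D: "finite D" "card D = b" and z: "\<And>z. poly K z = 0 \<Longrightarrow> esum D z = 0"
    and "\<exists>k0. \<forall>m. \<not> b dvd m \<longrightarrow> (\<exists>k\<ge>1. k \<le> k0 \<and> poly K (rou m (b ^ k)) = 0)"
    unfolding tile_kernel_def by blast+
  then obtain k0 where k0: "\<And>m. \<not> b dvd m \<Longrightarrow> \<exists>k\<ge>1. k \<le> k0 \<and> poly K (rou m (b ^ k)) = 0" by blast
  interpret digit_system b D using assms D by unfold_locales auto
  have "interior tile \<noteq> {}"
  proof (rule interior_if_zeros[of k0])
    fix m assume "\<not> b dvd m"
    then obtain k where "k \<ge> 1" "k \<le> k0" "poly K (rou m (b ^ k)) = 0" using k0 by blast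
    then show "\<exists>k\<ge>1. k \<le> k0 \<and> esum D (rou m (b ^ k)) = 0" using z by blast
  qed
  then show ?thesis using assms(2) D by (simp add: tile_digit_set_def)
qed

subsection \<open>The characterization\<close>

lemma (in distinct_digit_system) modulo_product_form:
  assumes p: "prime p" and q: "prime q" and pq: "p \<noteq> q" and b: "b = p ^ 2 * q" and Gcd: "Gcd D = 1"
  shows "\<exists>m\<ge>1. vanishes D (p ^ (2 * m)) \<and> (\<exists>k. 1 \<le> k \<and> k \<le> m \<and> modulo_product_form b k D)"
proof -
  interpret two_primes p q using p q pq by unfold_locales
  have D: "finite D" "card D = p ^ 2 * q" "0 \<in> D" using finite_D card_D zero_D b by auto
  obtain m n l where mnl: "m \<ge> 1" "l \<ge> 1" "vanishes D (p ^ (2 * n + 1))" "vanishes D (p ^ (2 * m))" "vanishes D (q ^ l)"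
    and pu: "\<And>i. i \<ge> 1 \<Longrightarrow> vanishes D (p ^ i) \<Longrightarrow> i = 2 * n + 1 \<or> i = 2 * m"
    and qu: "\<And>j. j \<ge> 1 \<Longrightarrow> vanishes D (q ^ j) \<Longrightarrow> j = l"
    by (rule spectrum[OF p q pq b]) (rule that)
  have lines: "\<exists>k\<ge>1. V D (2 * k - \<alpha>) (k - \<beta>)" for \<alpha> \<beta>
    by (rule vanishing_on_lines[OF p q pq b])
  have "\<exists>k. 1 \<le> k \<and> k \<le> m \<and> modulo_product_form (p ^ 2 * q) k D"
  proof -
    from tile_prime_alternative[OF p q pq D Gcd ex_periodic_tiling pu]
    consider (p) "vanishes D p" | (q) "vanishes D q" "\<not> vanishes D p"
      "\<And>w. w < q \<Longrightarrow> vanishes (res_class D q w) (p ^ (2 * n + 1)) \<and> vanishes (res_class D q w) (p ^ (2 * m))"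
      by blast
    then show ?thesis
    proof cases
      case p
      \<comment> \<open>The exponent 1 is odd, so it must be the unique odd exponent 2 n +
        1.\<close>
      have n: "n = 0" using pu[of 1] p mnl(1) by auto
      have "((\<forall>j\<le>m. V D (2 * m) j) \<and> (\<forall>i\<le>2 * l - 1. V D i l)) \<or>
          (\<exists>t<m. (\<forall>j\<le>m - 1 - t. V D (2 * m) j) \<and> (\<forall>i\<le>2 * (l + t). V D i l))"
      proof (rule structure_p[OF D(1,2) p D(3) Gcd mnl(1) _ mnl(2)])
        show "V D (2 * m) 0" "V D 0 l" using mnl by simp_all
        show "i = 1 \<or> i = 2 * m" if "i \<ge> 1" "V D i 0" for i using pu[of i] that n by simp
        show "j = l" if "j \<ge> 1" "V D 0 j" for j using qu[of j] that by simp
      qed (rule lines)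
      then consider (a) "\<forall>j\<le>m. V D (2 * m) j" "\<forall>i\<le>2 * l - 1. V D i l"
        | (c) t where "t < m" "\<forall>j\<le>m - 1 - t. V D (2 * m) j" "\<forall>i\<le>2 * (l + t). V D i l" by blast
      then show ?thesis
      proof cases
        case a
        then have "modulo_product_form (p ^ 2 * q) 1 D" by (intro order_1_p[OF D(1,2) p mnl(1,2)])
        then show ?thesis using mnl(1) by blast
      next
        case c
        \<comment> \<open>Matches column 2 m with the upper progression of \<open>tower t\<close>
          shifted by J = m - 1 - t; the resulting order t + 1 is at most m because t < m.\<close>
        have "2 * m = 2 * t + 2 + 2 * (m - 1 - t)" using c(1) by simp
        then have "\<forall>j\<le>m - 1 - t. V D (2 * t + 2 + 2 * (m - 1 - t)) j" using c(2) by simp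
        then have "modulo_product_form (p ^ 2 * q) (Suc t) D"
          by (rule p_adic_order_step[OF tower_order D(1,2) p _ c(3) mnl(2)])
        then show ?thesis using c(1) by (intro exI[of _ "Suc t"]) simp
      qed
    next
      case q
      have n: "n \<ge> 1"
        using mnl(3) q(2) by (cases n) auto
      have "(\<forall>j\<le>m. V D (2 * m) j) \<and> (\<forall>j\<le>n + 1. V D (2 * n + 1) j)"
      proof (rule structure_q[OF D(1,2) q(1) D(3) Gcd mnl(1) n])
        show "V D (2 * m) 0" "V D (2 * n + 1) 0" using mnl by simp_all
        show "V (res_class D q w) (2 * m) 0 \<and> V (res_class D q w) (2 * n + 1) 0" if "w < q" for w
          using q(3)[OF that] by simp
      qed (rule lines)
      then have "modulo_product_form (p ^ 2 * q) 1 D" by (intro order_1_q[OF D(1,2) q(1) mnl(1) n]) blast+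
      then show ?thesis using mnl(1) by blast
    qed
  qed
  then show ?thesis using mnl(1,4) b by blast
qed

theorem theorem5p5:
  fixes p q b :: nat and D :: "nat set"
  assumes "prime p" and "prime q" and "p \<noteq> q" and "b = p ^ 2 * q"
    and "finite D" and "card D = b" and "0 \<in> D" and "Gcd D = 1"
  shows "tile_digit_set b D \<longleftrightarrow>
    (\<exists>m\<ge>1. cyclotomic (p ^ (2 * m)) dvd set_poly D \<and>
       (\<exists>k. 1 \<le> k \<and> k \<le> m \<and> modulo_product_form b k D))"
proof
  assume T: "tile_digit_set b D"
  then interpret digit_system b D
    using assms by unfold_locales (auto simp: tile_digit_set_def)
  have "interior tile \<noteq> {}" using T by (simp add: tile_digit_set_def)
  then interpret distinct_digit_system b D
    by unfold_locales (rule card_DK_if_interior)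
  obtain m k where m: "m \<ge> 1" "vanishes D (p ^ (2 * m))" and k: "1 \<le> k" "k \<le> m" "modulo_product_form b k D"
    using modulo_product_form[OF assms(1-4,8)] by blast
  have "cyclotomic (p ^ (2 * m)) dvd set_poly D"
    using m(2) prime_gt_0_nat[OF assms(1)] by (simp add: cyclotomic_dvd_set_poly_iff)
  then show "\<exists>m\<ge>1. cyclotomic (p ^ (2 * m)) dvd set_poly D \<and>
      (\<exists>k. 1 \<le> k \<and> k \<le> m \<and> modulo_product_form b k D)"
    using m(1) k by blast
next
  assume "\<exists>m\<ge>1. cyclotomic (p ^ (2 * m)) dvd set_poly D \<and>
      (\<exists>k. 1 \<le> k \<and> k \<le> m \<and> modulo_product_form b k D)"
  then obtain k where k: "modulo_product_form b k D" by blast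
  have "b > 0" "b \<noteq> 1" using prime_gt_1_nat[OF assms(1)] prime_gt_0_nat[OF assms(2)] assms(4)
    by (auto simp: nat_mult_eq_1_iff)
  then have "b \<ge> 2" by linarith
  then show "tile_digit_set b D" by (rule tile_digit_set_if_modulo_product_form[OF k _ assms(7)])
qed

end
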